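(* There is an algorithm for \textsc{MinIGL} on trees, running on a real RAM, that uses $2^{O((n\log n)^{5/6})}$ time and $O(n^3)$ space, where $n$ is the number of vertices of the input tree.
   Context: For a graph $G=(V,E)$, $d_G(u,v)$ is the number of edges of a shortest $u$–$v$ path, or $\infty$ if none exists, with $1/\infty=0$. The Inverse Geodesic Length is $IGL(G)=\sum_{\{u,v\}\subseteq V}\frac{1}{d_G(u,v)}$ (sum over unordered pairs of distinct vertices). \textsc{MinIGL}: given a graph $G$, an integer $k$ and a real $\tau$, decide whether there is a set $S$ of exactly $k$ vertices with $IGL(G-S)\le\tau$. A real RAM supports addition, subtraction, multiplication, division and comparison of real numbers in constant time (but not rounding or modulo). *)

theory Defs
  imports Complex_Main "HOL-Library.Extended_Nat" "HOL-Library.Landau_Symbols"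
begin

section \<open>Graphs and the inverse geodesic length\<close>

definition simple_graph :: "'a set \<Rightarrow> 'a set set \<Rightarrow> bool" where
  "simple_graph V E \<longleftrightarrow> finite V \<and> (\<forall>e\<in>E. e \<subseteq> V \<and> card e = 2)"

definition graph_path :: "'a set \<Rightarrow> 'a set set \<Rightarrow> 'a \<Rightarrow> 'a list \<Rightarrow> 'a \<Rightarrow> bool" where
  "graph_path V E u p v \<longleftrightarrow> p \<noteq> [] \<and> hd p = u \<and> last p = v \<and> set p \<subseteq> V \<and> distinct p
     \<and> successively (\<lambda>x y. {x, y} \<in> E) p"

definition connected_graph :: "'a set \<Rightarrow> 'a set set \<Rightarrow> bool" where
  "connected_graph V E \<longleftrightarrow> (\<forall>u\<in>V. \<forall>v\<in>V. \<exists>p. graph_path V E u p v)"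

definition graph_cycle :: "'a set \<Rightarrow> 'a set set \<Rightarrow> 'a list \<Rightarrow> bool" where
  "graph_cycle V E p \<longleftrightarrow> length p \<ge> 3 \<and> graph_path V E (hd p) p (last p) \<and> {last p, hd p} \<in> E"

definition tree_graph :: "'a set \<Rightarrow> 'a set set \<Rightarrow> bool" where
  "tree_graph V E \<longleftrightarrow> simple_graph V E \<and> V \<noteq> {} \<and> connected_graph V E \<and> (\<nexists>p. graph_cycle V E p)"

text \<open>A path with \<open>l\<close> edges is a list of length \<open>l + 1\<close>; the infimum over the
  empty set is \<open>\<infinity>\<close>.\<close>

definition gdist :: "'a set \<Rightarrow> 'a set set \<Rightarrow> 'a \<Rightarrow> 'a \<Rightarrow> enat" where
  "gdist V E u v = (INF p\<in>{p. graph_path V E u p v}. enat (length p - 1))"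

definition inv_enat :: "enat \<Rightarrow> real" where
  "inv_enat d = (case d of enat l \<Rightarrow> 1 / real l | \<infinity> \<Rightarrow> 0)"

text \<open>The order on the vertices only serves to list every unordered pair exactly once.\<close>

definition IGL :: "'a::linorder set \<Rightarrow> 'a set set \<Rightarrow> real" where
  "IGL V E = (\<Sum>(u, v)\<in>{(u, v). u \<in> V \<and> v \<in> V \<and> u < v}. inv_enat (gdist V E u v))"

definition MinIGL :: "'a::linorder set \<Rightarrow> 'a set set \<Rightarrow> int \<Rightarrow> real \<Rightarrow> bool" where
  "MinIGL V E k \<tau> \<longleftrightarrow>
     (\<exists>S\<subseteq>V. int (card S) = k \<and> IGL (V - S) {e\<in>E. e \<inter> S = {}} \<le> \<tau>)"


section \<open>The real RAM\<close>

text \<open>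
  A program is a finite list of instructions. It works on registers, of which it can name only a
  fixed finite number, and on an indirectly addressed memory; each register and each memory cell
  holds one real number. In all instructions the first register index is the target, except in
  \<open>Store a i\<close> (register \<open>i\<close> is written to the memory cell whose address is in register \<open>a\<close>) and
  \<open>Jump_Less i j l\<close> (go to line \<open>l\<close> if register \<open>i\<close> is less than register \<open>j\<close>).
  Constants are integers: arbitrary real constants would make the machine non-uniform, since they
  can encode unbounded advice.
\<close>

datatype instr =
    Const nat int
  | Add nat nat nat
  | Sub nat nat nat
  | Mul nat nat nat
  | Div nat nat nat
  | Load nat nat
  | Store nat nat
  | Jump nat
  | Jump_Less nat nat nat
  | Halt bool

text \<open>Program counter, registers, memory.\<close>

type_synonym config = "nat \<times> (nat \<Rightarrow> real) \<times> (nat \<Rightarrow> real)"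

text \<open>
  Division by zero and addresses that are not natural numbers block the machine. In particular
  the floor below is applied only to natural numbers and gives the program no rounding operation.
\<close>

fun exec :: "instr \<Rightarrow> config \<Rightarrow> config option" where
  "exec (Const d c) (pc, r, m) = Some (Suc pc, r(d := of_int c), m)"
| "exec (Add d i j) (pc, r, m) = Some (Suc pc, r(d := r i + r j), m)"
| "exec (Sub d i j) (pc, r, m) = Some (Suc pc, r(d := r i - r j), m)"
| "exec (Mul d i j) (pc, r, m) = Some (Suc pc, r(d := r i * r j), m)"
| "exec (Div d i j) (pc, r, m) =
     (if r j = 0 then None else Some (Suc pc, r(d := r i / r j), m))"
| "exec (Load d a) (pc, r, m) =
     (if r a \<in> \<nat> then Some (Suc pc, r(d := m (nat \<lfloor>r a\<rfloor>)), m) else None)"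
| "exec (Store a i) (pc, r, m) =
     (if r a \<in> \<nat> then Some (Suc pc, r, m(nat \<lfloor>r a\<rfloor> := r i)) else None)"
| "exec (Jump l) (pc, r, m) = Some (l, r, m)"
| "exec (Jump_Less i j l) (pc, r, m) = Some (if r i < r j then l else Suc pc, r, m)"
| "exec (Halt b) (pc, r, m) = None"

fun accessed :: "instr \<Rightarrow> config \<Rightarrow> nat set" where
  "accessed (Load d a) (pc, r, m) = {nat \<lfloor>r a\<rfloor>}"
| "accessed (Store a i) (pc, r, m) = {nat \<lfloor>r a\<rfloor>}"
| "accessed _ _ = {}"

text \<open>
  \<open>runs P c b t A\<close>: from configuration \<open>c\<close> the program \<open>P\<close> halts with answer \<open>b\<close> after exactly \<open>t\<close>
  instructions, and \<open>A\<close> is the set of all memory addresses read or written on the way.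
\<close>

inductive runs :: "instr list \<Rightarrow> config \<Rightarrow> bool \<Rightarrow> nat \<Rightarrow> nat set \<Rightarrow> bool" for P where
  halt: "\<lbrakk>pc < length P; P ! pc = Halt b\<rbrakk> \<Longrightarrow> runs P (pc, r, m) b 1 {}"
| step: "\<lbrakk>pc < length P; exec (P ! pc) (pc, r, m) = Some c'; runs P c' b t A\<rbrakk>
    \<Longrightarrow> runs P (pc, r, m) b (Suc t) (accessed (P ! pc) (pc, r, m) \<union> A)"

lemma runs_deterministic:
  "\<lbrakk>runs P c b t A; runs P c b' t' A'\<rbrakk> \<Longrightarrow> b = b' \<and> t = t' \<and> A = A'"
proof (induction arbitrary: b' t' A' rule: runs.induct)
  case (halt pc b r m)
  from halt(3) show ?case by cases (use halt(2) in auto)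
next
  case (step pc r m c' b t A)
  from step(5) show ?case
  proof cases
    case halt
    with step(2) show ?thesis by simp
  next
    case (step c'' t'' A'')
    with \<open>exec (P ! pc) (pc, r, m) = Some c'\<close> step.IH show ?thesis by auto
  qed
qed

definition init_config :: "real list \<Rightarrow> config" where
  "init_config xs = (0, (\<lambda>_. 0), (\<lambda>a. if a < length xs then xs ! a else 0))"

text \<open>
  The space bound is on the size of the memory, input included, so sparse use of large addresses
  does not help. The registers add only a constant that depends on the program.
\<close>

definition answers_within :: "instr list \<Rightarrow> real list \<Rightarrow> bool \<Rightarrow> real \<Rightarrow> real \<Rightarrow> bool" where
  "answers_within P xs b time space \<longleftrightarrow>
     (\<exists>t A. runs P (init_config xs) b t A \<and> real t \<le> time
        \<and> real (length xs) \<le> space \<and> (\<forall>a\<in>A. real (Suc a) \<le> space))"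


section \<open>Encoding of instances\<close>

text \<open>Each edge is listed once, in one of its two orientations; the order is arbitrary.\<close>

definition edge_list :: "('a \<times> 'a) list \<Rightarrow> 'a set set \<Rightarrow> bool" where
  "edge_list es E \<longleftrightarrow> (\<lambda>(u, v). {u, v}) ` set es = E \<and> length es = card E"

definition encode_instance :: "nat \<Rightarrow> (nat \<times> nat) list \<Rightarrow> int \<Rightarrow> real \<Rightarrow> real list" where
  "encode_instance n es k \<tau> = [real n, real (length es), of_int k, \<tau>]
     @ concat (map (\<lambda>(u, v). [real u, real v]) es)"

end

theory Submission
  imports Defs "HOL-Real_Asymp.Real_Asymp"
begin

text \<open>
  After the deletion of \<open>S\<close>, twice the inverse geodesic length of a tree with distance \<open>d\<close> is
  \<open>J S\<close>, the sum of \<open>1 / d u w\<close> over the ordered pairs \<open>(u, w)\<close> whose path avoids \<open>S\<close>.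

  A dynamic program over the rooted tree keeps, for the cluster of a vertex \<open>p\<close>, a list of deletion
  sets. Only one of smallest \<open>J\<close> is needed among the sets that have the same size and leave, for each
  \<open>j\<close>, the same number of vertices connected to \<open>p\<close> at distance \<open>j\<close>. These lists are short: let \<open>S\<close> be
  optimal of size \<open>k > 0\<close>. Some \<open>x\<close> in \<open>S\<close> cuts off at most \<open>y \<le> n / k\<close> vertices below it. Deleting the
  parent of \<open>x\<close> instead of \<open>x\<close> is no improvement, so the parent sees little of its component, and
  putting \<open>x\<close> back costs only \<open>O(y ^ 3)\<close>. Deleting the middle of a path of length \<open>D\<close> instead gains of
  order \<open>D\<close>. So all components have diameter at most \<open>21 * (n / k) ^ 3\<close>, and there are only
  \<open>(n + 1) ^ (21 * (n / k) ^ 3 + 2)\<close> classes of sets. As there are at most \<open>(n + 1) ^ k\<close> sets of at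
  most \<open>k\<close> vertices, the lists have length \<open>2 powr O(n powr (3 / 4) * log 2 n)\<close>.

  A whole list fits into one memory cell, as the binary expansion of a real number: prepending bits
  is an affine map, and the first bit is found by a comparison with \<open>1\<close> after doubling.
\<close>

section \<open>Tree metrics and the exchange argument\<close>

text \<open>The machine can neither round nor index into a number, so a list packed into one cell is
  a stack: every loop over a list pops from one number and pushes to another, and random access is
  confined to a matrix of \<open>(n + 11) * n\<close> cells. Thus the space stays polynomial
  although the lists do not. The diameter bound holds for optimal sets, while a list keeps one
  representative per class. The invariant therefore does not follow a fixed optimal set: at each
  merge the restriction of the current one is replaced by the representative that was kept, the
  result is again optimal, and the diameter bound applies to it anew. The exponent comes from two
  counts of the sets that a list can contain, one growing with \<open>k\<close> and the other with
  \<open>(n / k) ^ 3\<close>; they balance at \<open>k = n powr (3 / 4)\<close>. The rounds of every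
  loop are bounded by the bound \<open>N\<close> on the list lengths and the program is polynomial
  in \<open>N\<close>, so the time has the same form as \<open>N\<close> and lies within the bound
  claimed.\<close>

text \<open>The metric of a tree on \<open>{..<n}\<close>. A vertex \<open>x\<close> lies on the path between \<open>a\<close> and \<open>b\<close> iff
  \<open>d a x + d x b = d a b\<close>.\<close>

locale tree_metric =
  fixes n :: nat and d :: "nat \<Rightarrow> nat \<Rightarrow> nat"
  assumes n_pos: "0 < n"
    and d_zero: "\<lbrakk>u < n; v < n\<rbrakk> \<Longrightarrow> d u v = 0 \<longleftrightarrow> u = v"
    and d_sym: "\<lbrakk>u < n; v < n\<rbrakk> \<Longrightarrow> d u v = d v u"
    and d_tri: "\<lbrakk>u < n; v < n; w < n\<rbrakk> \<Longrightarrow> d u w \<le> d u v + d v w"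
    and d_less: "\<lbrakk>u < n; v < n\<rbrakk> \<Longrightarrow> d u v < n"
    and d_between: "\<lbrakk>a < n; b < n; r < n; x < n; d a x + d x b = d a b\<rbrakk> \<Longrightarrow>
      d r x + d x a = d r a \<or> d r x + d x b = d r b"
    and d_geodesic: "\<lbrakk>u < n; v < n; i \<le> d u v\<rbrakk> \<Longrightarrow> \<exists>w<n. d u w = i \<and> d w v = d u v - i"
    and d_edge: "\<lbrakk>u < n; v < n; r < n; d u v = 1\<rbrakk> \<Longrightarrow> d r u = d r v + 1 \<or> d r v = d r u + 1"
begin

section \<open>Betweenness and connection in a tree metric\<close>

definition btw :: "nat \<Rightarrow> nat \<Rightarrow> nat \<Rightarrow> bool" where
  "btw a x b \<longleftrightarrow> d a x + d x b = d a b"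

text \<open>An end of the pair that lies in \<open>S\<close> blocks it as well, because
  \<open>btw u u v\<close> and \<open>btw u v v\<close> hold; deleted vertices therefore need no
  separate case.\<close>

definition conn :: "nat set \<Rightarrow> nat \<Rightarrow> nat \<Rightarrow> bool" where
  "conn S u v \<longleftrightarrow> (\<forall>s\<in>S. \<not> btw u s v)"

definition inv_d :: "nat \<Rightarrow> nat \<Rightarrow> real" where
  "inv_d u v = 1 / real (d u v)"

text \<open>Twice the inverse geodesic length after the deletion of \<open>S\<close>: the sum ranges over ordered
  pairs, and the diagonal contributes \<open>1 / 0 = 0\<close>.\<close>

definition J :: "nat set \<Rightarrow> real" where
  "J S = (\<Sum>u<n. \<Sum>v<n. if conn S u v then inv_d u v else 0)"

lemma d_self [simp]: "u < n \<Longrightarrow> d u u = 0"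
  using d_zero by auto

lemma btw_self: "\<lbrakk>a < n; b < n\<rbrakk> \<Longrightarrow> btw a a b" "\<lbrakk>a < n; b < n\<rbrakk> \<Longrightarrow> btw a b b"
  by (auto simp: btw_def)

lemma btw_sym: "\<lbrakk>a < n; b < n; x < n\<rbrakk> \<Longrightarrow> btw a x b \<longleftrightarrow> btw b x a"
  unfolding btw_def using d_sym by (metis add.commute)

lemma conn_sym: "\<lbrakk>S \<subseteq> {..<n}; a < n; b < n\<rbrakk> \<Longrightarrow> conn S a b \<longleftrightarrow> conn S b a"
  unfolding conn_def using btw_sym by blast

text \<open>This is the form in which acyclicity is used: the path between \<open>a\<close> and
  \<open>b\<close> is covered by the paths from \<open>r\<close> to its two ends. It fails in a
  cycle of length four.\<close>

lemma btw_T: "\<lbrakk>a < n; b < n; r < n; x < n; btw a x b\<rbrakk> \<Longrightarrow> btw r x a \<or> btw r x b"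
  unfolding btw_def using d_between by blast

lemma btw_trans1: "\<lbrakk>a < n; b < n; x < n; y < n; btw a x b; btw a y x\<rbrakk> \<Longrightarrow> btw a y b"
  unfolding btw_def using d_tri[of y x b] d_tri[of a y b] by linarith

lemma btw_trans2: "\<lbrakk>a < n; b < n; x < n; y < n; btw a x b; btw x y b\<rbrakk> \<Longrightarrow> btw a y b"
  unfolding btw_def using d_tri[of a x y] d_tri[of a y b] by linarith

lemma btw_trans3: "\<lbrakk>a < n; b < n; x < n; y < n; btw a x b; btw a y x\<rbrakk> \<Longrightarrow> btw y x b"
  unfolding btw_def using d_tri[of y x b] d_tri[of a y b] by linarith

lemma inv_d_nonneg [simp]: "0 \<le> inv_d u v"
  by (simp add: inv_d_def)

lemma inv_d_le_1: "inv_d u v \<le> 1"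
  by (cases "d u v = 0") (auto simp: inv_d_def field_simps)

text \<open>The tree is rooted at \<open>0\<close>.\<close>

lemma parent_exists:
  assumes "c < n" "c \<noteq> 0"
  shows "\<exists>p<n. d c p = 1 \<and> d 0 c = d 0 p + 1"
proof -
  have "1 \<le> d c 0" using assms d_zero[of c 0] n_pos by (simp add: Suc_le_eq)
  then obtain p where "p < n" "d c p = 1" "d p 0 = d c 0 - 1"
    using d_geodesic[of c 0 1] assms n_pos by auto
  with \<open>1 \<le> d c 0\<close> show ?thesis using d_sym[of p 0] d_sym[of c 0] assms n_pos by auto
qed

text \<open>\<open>p\<close> lies between \<open>0\<close> and \<open>c\<close>, so by
  \<open>d_between\<close> it lies between \<open>q\<close> and one of them. As \<open>p\<close> and
  \<open>q\<close> have the same distances to \<open>0\<close> and to \<open>c\<close>, they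
  coincide.\<close>

lemma parent_unique:
  assumes "c < n" "p < n" "q < n" "d c p = 1" "d 0 c = d 0 p + 1" "d c q = 1" "d 0 c = d 0 q + 1"
  shows "p = q"
proof -
  have "d 0 p + d p c = d 0 c" using assms d_sym[of c p] by auto
  then have "d q p + d p 0 = d q 0 \<or> d q p + d p c = d q c"
    using d_between[of 0 c q p] assms n_pos by auto
  moreover have "d q 0 = d p 0" using assms n_pos d_sym[of p 0] d_sym[of q 0] by auto
  moreover have "d q c = d p c" using assms n_pos d_sym[of p c] d_sym[of q c] by auto
  ultimately have "d q p = 0" by linarith
  then show ?thesis using d_zero[of q p] assms by auto
qed

text \<open>The distances from \<open>w\<close> to \<open>c\<close> and to \<open>p\<close> differ
  by one. If \<open>c\<close> were the nearer one, \<open>p\<close> would have to lie between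
  \<open>w\<close> and \<open>0\<close>, and adding up the distances would put \<open>c\<close> on
  the path from \<open>0\<close> to \<open>w\<close>.\<close>

lemma not_below_via_parent:
  assumes "c < n" "p < n" "w < n" "d c p = 1" "d 0 c = d 0 p + 1" "\<not> btw 0 c w"
  shows "d c w = d p w + 1"
proof -
  have "d w c = d w p + 1 \<or> d w p = d w c + 1" using d_edge[of c p w] assms by auto
  moreover have False if *: "d w p = d w c + 1"
  proof -
    have "btw 0 p c" using assms d_sym[of c p] by (auto simp: btw_def)
    then have "btw w p 0 \<or> btw w p c" using btw_T[of 0 c w p] assms n_pos by auto
    moreover have "\<not> btw w p c" using * assms d_sym[of c p] by (auto simp: btw_def)
    ultimately have "d w p + d p 0 = d w 0" by (simp add: btw_def)
    then have "d 0 c + d c w = d 0 w"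
      using * assms n_pos d_sym[of w 0] d_sym[of p 0] d_sym[of w c] by auto
    with assms show False by (simp add: btw_def)
  qed
  ultimately show ?thesis using assms d_sym[of w c] d_sym[of w p] by auto
qed

text \<open>Only pairs whose connection changes contribute. \<open>X\<close> may exceed the set of
  gained connections and \<open>Z\<close> may miss some of the lost ones, so the exchange argument
  never has to determine either set exactly.\<close>

lemma J_diff_le:
  assumes X: "finite X"
    and "\<And>a b. \<lbrakk>a < n; b < n; conn S' a b; \<not> conn S a b\<rbrakk> \<Longrightarrow> (a, b) \<in> X"
    and "\<And>a b. (a, b) \<in> Z \<Longrightarrow> a < n \<and> b < n \<and> conn S a b \<and> \<not> conn S' a b"
  shows "J S' - J S \<le> (\<Sum>(a, b)\<in>X. inv_d a b) - (\<Sum>(a, b)\<in>Z. inv_d a b)"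
proof -
  let ?V = "{..<n} \<times> {..<n}"
  let ?g = "\<lambda>(a, b). inv_d a b"
  have Z: "Z \<subseteq> ?V" using assms(3) by auto
  let ?h = "\<lambda>T p. if conn T (fst p) (snd p) then inv_d (fst p) (snd p) else 0"
  have J: "J T = (\<Sum>p\<in>?V. ?h T p)" for T
    unfolding J_def sum.cartesian_product by (simp add: split_def)
  have "J S' - J S = (\<Sum>p\<in>?V. ?h S' p - ?h S p)"
    unfolding J by (rule sum_subtractf[symmetric])
  also have "\<dots> \<le> (\<Sum>p\<in>?V. (if p \<in> X then ?g p else 0) - (if p \<in> Z then ?g p else 0))"
  proof (rule sum_mono)
    fix p assume "p \<in> ?V"
    then obtain a b where p: "p = (a, b)" "a < n" "b < n" by auto
    show "?h S' p - ?h S p \<le> (if p \<in> X then ?g p else 0) - (if p \<in> Z then ?g p else 0)"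
      using assms(2)[of a b] assms(3)[of a b] p(2,3) inv_d_nonneg[of a b] unfolding p(1) by simp
  qed
  also have "\<dots> = (\<Sum>p\<in>?V. if p \<in> X then ?g p else 0) - (\<Sum>p\<in>?V. if p \<in> Z then ?g p else 0)"
    by (rule sum_subtractf)
  also have "(\<Sum>p\<in>?V. if p \<in> X then ?g p else 0) = (\<Sum>p\<in>?V \<inter> X. ?g p)"
    by (rule sum.inter_restrict[symmetric]) simp
  also have "(\<Sum>p\<in>?V. if p \<in> Z then ?g p else 0) = (\<Sum>p\<in>?V \<inter> Z. ?g p)"
    by (rule sum.inter_restrict[symmetric]) simp
  also have "?V \<inter> Z = Z" using Z by auto
  also have "(\<Sum>p\<in>?V \<inter> X. ?g p) \<le> (\<Sum>p\<in>X. ?g p)" by (rule sum_mono2) (use X in auto)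
  finally show ?thesis by simp
qed

section \<open>Optimal deletion sets and the exchange of one vertex\<close>

definition optimal :: "int \<Rightarrow> nat set \<Rightarrow> bool" where
  "optimal k S \<longleftrightarrow> S \<subseteq> {..<n} \<and> int (card S) = k \<and> (\<forall>S'\<subseteq>{..<n}. int (card S') = k \<longrightarrow> J S \<le> J S')"

lemma optimal_finite: "optimal k S \<Longrightarrow> finite S"
  unfolding optimal_def using finite_subset by blast

text \<open>\<open>Y S x\<close> consists of the vertices below \<open>x\<close> that are connected to \<open>x\<close> once \<open>x\<close> is put back.\<close>

definition Y :: "nat set \<Rightarrow> nat \<Rightarrow> nat set" where
  "Y S x = {y. y < n \<and> btw 0 x y \<and> (\<forall>s\<in>S. btw x s y \<longrightarrow> s = x)}"

lemma finite_Y [simp]: "finite (Y S x)"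
  unfolding Y_def by auto

text \<open>For a common vertex \<open>y\<close>, both \<open>x\<close> and \<open>x'\<close> would
  lie on the path from \<open>0\<close> to \<open>y\<close>, and the lower of them would separate
  \<open>y\<close> from the upper one.\<close>

lemma Y_disjoint:
  assumes "S \<subseteq> {..<n}" "x \<in> S" "x' \<in> S" "x \<noteq> x'"
  shows "Y S x \<inter> Y S x' = {}"
proof (rule ccontr)
  assume "Y S x \<inter> Y S x' \<noteq> {}"
  then obtain y where y: "y \<in> Y S x" "y \<in> Y S x'" by auto
  have lt: "x < n" "x' < n" "y < n" using assms y by (auto simp: Y_def)
  have "btw x x' 0 \<or> btw x x' y"
    using y lt n_pos btw_T[of 0 y x x'] by (auto simp: Y_def)
  moreover have "\<not> btw x x' y" using y assms by (auto simp: Y_def)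
  ultimately have "btw 0 x' x" using btw_sym[of x 0 x'] lt n_pos by auto
  moreover have "btw 0 x y" using y by (auto simp: Y_def)
  ultimately have "btw x' x y" using btw_trans3[of 0 y x x'] lt n_pos by auto
  with y assms show False by (auto simp: Y_def)
qed

text \<open>Averaging: the sets \<open>Y S x\<close> for \<open>x\<close> in \<open>S\<close> are
  disjoint and share \<open>n\<close> vertices, so the smallest of them is at most the mean.\<close>

lemma small_Y:
  assumes "S \<subseteq> {..<n}" "S \<noteq> {}"
  shows "\<exists>x\<in>S. card S * card (Y S x) \<le> n"
proof -
  have fin: "finite S" using assms finite_subset by blast
  obtain x where x: "x \<in> S" "\<forall>x'\<in>S. card (Y S x) \<le> card (Y S x')"
    using ex_is_arg_min_if_finite[OF fin assms(2), of "\<lambda>x. card (Y S x)"]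
    unfolding is_arg_min_linorder by blast
  have "card S * card (Y S x) = (\<Sum>x'\<in>S. card (Y S x))" by simp
  also have "\<dots> \<le> (\<Sum>x'\<in>S. card (Y S x'))" using x by (intro sum_mono) auto
  also have "\<dots> = card (\<Union>x'\<in>S. Y S x')"
    by (rule card_UN_disjoint[symmetric]) (use fin Y_disjoint[OF assms(1)] in simp_all)
  also have "\<dots> \<le> card {..<n}" by (intro card_mono) (auto simp: Y_def)
  finally show ?thesis using x by auto
qed

text \<open>The midpoint of a geodesic of length about \<open>2 * m\<close> separates of order
  \<open>m ^ 2\<close> pairs, each of weight at least of order \<open>1 / m\<close>, so the gain is
  linear in \<open>m\<close>. The pairs are chosen independently of \<open>S'\<close> because the
  set to which they are applied is itself built from \<open>z\<close>.\<close>

lemma geodesic_cut: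
  assumes S: "S \<subseteq> {..<n}" and uv: "u < n" "v < n" "conn S u v" and m: "2 * m \<le> d u v"
  shows "\<exists>z Z. z < n \<and> z \<notin> S \<and> (\<forall>S'. z \<in> S' \<longrightarrow> (\<forall>(a, b)\<in>Z. a < n \<and> b < n \<and> conn S a b \<and> \<not> conn S' a b))
     \<and> real m / 2 \<le> (\<Sum>(a, b)\<in>Z. inv_d a b)"
proof -
  let ?D = "d u v"
  have "\<forall>i. \<exists>w. i \<le> ?D \<longrightarrow> w < n \<and> d u w = i \<and> d w v = ?D - i"
    using d_geodesic[OF uv(1,2)] by blast
  then obtain w where w: "\<And>i. i \<le> ?D \<Longrightarrow> w i < n \<and> d u (w i) = i \<and> d (w i) v = ?D - i" by metis
  \<comment> \<open>The vertices \<open>w i\<close> were chosen separately; that they lie on one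
    path has to be derived from \<open>btw_T\<close>.\<close>
  have dw: "d (w i) (w j) = j - i" if "i \<le> j" "j \<le> ?D" for i j
  proof -
    have i: "w i < n" "d u (w i) = i" "d (w i) v = ?D - i" and j: "w j < n" "d u (w j) = j" "d (w j) v = ?D - j"
      using w[of i] w[of j] that by auto
    have "btw u (w i) v" using i that by (auto simp: btw_def)
    then have "btw (w j) (w i) u \<or> btw (w j) (w i) v" using btw_T[of u v "w j" "w i"] uv i j by auto
    moreover have "d (w j) u = j" "d (w i) u = i" "d (w j) (w i) = d (w i) (w j)"
      using i j d_sym uv by auto
    ultimately show ?thesis using i j that by (auto simp: btw_def)
  qed
  have con: "conn S (w i) (w j)" if "i \<le> j" "j \<le> ?D" for i j
    unfolding conn_def
  proof safe
    fix s assume s: "s \<in> S" "btw (w i) s (w j)"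
    have i: "w i < n" "d u (w i) = i" "d (w i) v = ?D - i" and j: "w j < n" "d u (w j) = j" "d (w j) v = ?D - j"
      using w[of i] w[of j] that by auto
    have "s < n" using s S by auto
    then have "btw u s v"
      using d_tri[of u "w i" s] d_tri[of s "w j" v] d_tri[of u s v] i j s(2) dw[OF that] uv that
      by (auto simp: btw_def)
    with s uv show False by (auto simp: conn_def)
  qed
  \<comment> \<open>\<open>m * m\<close> pairs at distance at most \<open>2 * m\<close> give
    \<open>m / 2\<close>. One orientation of each pair suffices for a lower bound.\<close>
  define Z where "Z = (\<lambda>i. w i) ` {..<m} \<times> w ` {Suc m..2 * m}"
  have inj: "inj_on w {..2 * m}"
    by (rule inj_on_inverseI[of _ "d u"]) (use w m in auto)
  have card: "card Z = m * m"
    unfolding Z_def card_cartesian_product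
    by (subst (1 2) card_image) (auto intro: inj_on_subset[OF inj])
  have finZ: "finite Z" by (auto simp: Z_def)
  have le: "1 / (2 * real m) \<le> inv_d a b" if "(a, b) \<in> Z" for a b
  proof -
    from that obtain i j where ij: "a = w i" "b = w j" "i < m" "m < j" "j \<le> 2 * m" by (auto simp: Z_def)
    then have "d a b = j - i" using dw[of i j] m by auto
    then show ?thesis using ij by (auto simp: inv_d_def intro!: divide_left_mono)
  qed
  have "real m / 2 = real (card Z) * (1 / (2 * real m))"
    unfolding card by (cases "m = 0") (auto simp: field_simps)
  also have "\<dots> = (\<Sum>(a, b)\<in>Z. 1 / (2 * real m))" by (simp add: split_def)
  also have "\<dots> \<le> (\<Sum>(a, b)\<in>Z. inv_d a b)" by (rule sum_mono) (use le in auto)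
  finally have sum: "real m / 2 \<le> (\<Sum>(a, b)\<in>Z. inv_d a b)" .
  have wm: "w m < n" using w[of m] m by auto
  have "w m \<notin> S"
    using con[of m m] m wm by (auto simp: conn_def btw_def)
  moreover have "a < n \<and> b < n \<and> conn S a b \<and> \<not> conn S' a b" if "(a, b) \<in> Z" "w m \<in> S'" for a b S'
  proof -
    from that(1) obtain i j where ij: "a = w i" "b = w j" "i < m" "m < j" "j \<le> 2 * m" by (auto simp: Z_def)
    have "btw a (w m) b" using dw[of i m] dw[of m j] dw[of i j] ij m by (auto simp: btw_def)
    with that have "\<not> conn S' a b" by (auto simp: conn_def)
    then show ?thesis using ij con[of i j] w[of i] w[of j] m by auto
  qed
  ultimately show ?thesis using sum wm by (intro exI[of _ "w m"] exI[of _ Z]) blast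
qed

text \<open>Exchange argument: putting back the vertex \<open>x\<close> with the smallest \<open>Y S x\<close> is cheap, so deleting
  its parent or the middle of a long geodesic instead would be an improvement.\<close>

lemma swap_conn:
  assumes S: "S \<subseteq> {..<n}" "x \<in> S" "z < n"
    and ab: "a < n" "b < n" "conn (insert z (S - {x})) a b" "\<not> conn S a b"
  shows "btw a x b \<and> (a \<in> Y S x \<or> b \<in> Y S x)"
proof -
  have x: "x < n" using S by auto
  have nos: "\<not> btw a s b" if "s \<in> S" "s \<noteq> x" for s using ab that by (auto simp: conn_def)
  with ab(4) have axb: "btw a x b" by (auto simp: conn_def)
  have below: "a' \<in> Y S x" if ab': "a' < n" "b' < n" "btw a' x b'" "\<forall>s. s \<in> S \<longrightarrow> s \<noteq> x \<longrightarrow> \<not> btw a' s b'" "btw 0 x a'" for a' b'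
  proof -
    have "s = x" if s: "s \<in> S" "btw x s a'" for s
    proof (rule ccontr)
      assume "s \<noteq> x"
      have "s < n" using S s by auto
      then have "btw a' s x" using s btw_sym[of x a' s] ab' x by auto
      then have "btw a' s b'" using btw_trans1[of a' b' x s] ab' x \<open>s < n\<close> by auto
      with ab' s \<open>s \<noteq> x\<close> show False by auto
    qed
    then show ?thesis using ab' by (auto simp: Y_def)
  qed
  have "btw 0 x a \<or> btw 0 x b" using btw_T[of a b 0 x] axb ab n_pos x by auto
  then show ?thesis
  proof
    assume "btw 0 x a" with below[of a b] ab nos axb show ?thesis by auto
  next
    assume "btw 0 x b"
    moreover have "\<forall>s. s \<in> S \<longrightarrow> s \<noteq> x \<longrightarrow> \<not> btw b s a" using nos btw_sym[of a b] ab S by blast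
    ultimately show ?thesis using below[of b a] ab axb btw_sym[of a b x] x by auto
  qed
qed

text \<open>If \<open>b\<close> were below \<open>x\<close>, being connected to \<open>a\<close>
  through \<open>x\<close> would put it into \<open>Y S x\<close>. So \<open>b\<close> is not below
  \<open>x\<close>, the path to it leaves \<open>x\<close> through the parent \<open>p\<close>, and
  from \<open>p\<close> on it meets no vertex of \<open>S\<close>. The \<open>1\<close> in the bound
  accounts for the edge between \<open>x\<close> and \<open>p\<close>.\<close>

lemma swap_conn_outside:
  assumes S: "S \<subseteq> {..<n}" "x \<in> S" "z < n"
    and ab: "a < n" "b < n" "conn (insert z (S - {x})) a b" "\<not> conn S a b" "a \<in> Y S x" "b \<notin> Y S x"
  shows "x \<noteq> 0" "\<lbrakk>p < n; d x p = 1; d 0 x = d 0 p + 1\<rbrakk> \<Longrightarrow>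
     btw a p b \<and> conn S p b \<and> inv_d a b \<le> 1 / (1 + real (d p b))"
proof -
  have x: "x < n" using S by auto
  have nos: "\<not> btw a s b" if "s \<in> S" "s \<noteq> x" for s using ab that by (auto simp: conn_def)
  have axb: "btw a x b" using swap_conn[OF S ab(1-4)] by auto
  have nb: "\<not> btw 0 x b"
  proof
    assume *: "btw 0 x b"
    have "s = x" if s: "s \<in> S" "btw x s b" for s
    proof (rule ccontr)
      assume "s \<noteq> x"
      have "s < n" using S s by auto
      then have "btw a s b" using btw_trans2[of a b x s] ab x s axb by auto
      with nos s \<open>s \<noteq> x\<close> show False by auto
    qed
    with * ab show False by (auto simp: Y_def)
  qed
  then show "x \<noteq> 0" using btw_self(1)[of 0 b] ab n_pos by metis
  assume p: "p < n" "d x p = 1" "d 0 x = d 0 p + 1"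
  have dxb: "d x b = d p b + 1" using not_below_via_parent[OF x p(1) ab(2) p(2,3) nb] .
  then have xpb: "btw x p b" using p by (auto simp: btw_def)
  then have apb: "btw a p b" using btw_trans2[of a b x p] ab x p axb by auto
  have "conn S p b" unfolding conn_def
  proof safe
    fix s assume s: "s \<in> S" "btw p s b"
    have sn: "s < n" using S s by auto
    then have "btw x s b" using btw_trans2[of x b p s] xpb s ab x p by auto
    then have "btw a s b" using btw_trans2[of a b x s] axb ab x sn by auto
    with nos s have "s = x" by auto
    with s dxb p x show False using d_sym[of p x] by (auto simp: btw_def)
  qed
  moreover have "inv_d a b \<le> 1 / (1 + real (d p b))"
    unfolding inv_d_def using axb dxb by (intro divide_left_mono) (auto simp: btw_def)
  ultimately show "btw a p b \<and> conn S p b \<and> inv_d a b \<le> 1 / (1 + real (d p b))" using apb by auto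
qed

lemma optimal_swap:
  assumes "optimal k S" "x \<in> S" "z < n" "z \<notin> S"
  shows "J S \<le> J (insert z (S - {x}))"
proof -
  have "finite S" using assms optimal_finite by blast
  then have "card (insert z (S - {x})) = card S" using assms
    by (simp add: card_Diff_singleton) (metis Suc_pred card_gt_0_iff empty_iff)
  then show ?thesis using assms unfolding optimal_def by (metis Diff_subset insert_subset lessThan_iff subset_trans)
qed

text \<open>Three deletion sets of the same size are compared: \<open>S\<close>, \<open>S\<close>
  with \<open>x\<close> moved to its parent, and \<open>S\<close> with \<open>x\<close> moved to the
  middle of the path from \<open>u\<close> to \<open>v\<close>. The second bounds the weight that
  the parent sees, and this bounds the loss in the third. Multiplying out by \<open>k ^ 3\<close>
  keeps division out of the bound.\<close>

lemma optimal_diameter: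
  assumes opt: "optimal k S" and k: "0 < k" and uv: "u < n" "v < n" "conn S u v"
  shows "real (d u v) * of_int k ^ 3 \<le> 21 * real n ^ 3"
proof -
  have S: "S \<subseteq> {..<n}" "int (card S) = k" using opt by (auto simp: optimal_def)
  then have "S \<noteq> {}" using k by auto
  then obtain x where x: "x \<in> S" "card S * card (Y S x) \<le> n" using small_Y S by auto
  define y where "y = card (Y S x)"
  have xn: "x < n" using x S by auto
  have "x \<in> Y S x" using xn n_pos d_zero[of _ x] S
    by (auto simp: Y_def btw_def)
  then have y1: "1 \<le> y" unfolding y_def by (simp add: Suc_le_eq card_gt_0_iff) blast
  let ?S' = "\<lambda>z. insert z (S - {x})"
  define yr where "yr = real y"
  have yr: "1 \<le> yr" using y1 by (simp add: yr_def)
  have YY: "(\<Sum>(a, b)\<in>Y S x \<times> Y S x. inv_d a b) \<le> yr ^ 2"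
  proof -
    have "(\<Sum>(a, b)\<in>Y S x \<times> Y S x. inv_d a b) \<le> (\<Sum>(a, b)\<in>Y S x \<times> Y S x. 1)"
      by (rule sum_mono) (use inv_d_le_1 in auto)
    also have "\<dots> = yr ^ 2" by (simp add: split_def yr_def y_def power2_eq_square card_cartesian_product)
    finally show ?thesis .
  qed
  \<comment> \<open>A bound for the weight that one vertex of \<open>Y S x\<close> sees outside:
    \<open>1\<close> for the parent \<open>p\<close> itself, whose summand is
    \<open>1 / (1 + d p p)\<close>, and \<open>yr ^ 2\<close> for everything that \<open>p\<close>
    sees.\<close>
  define f where "f = 1 + yr ^ 2"
  have cross: "\<exists>X. finite X \<and> (\<forall>a<n. \<forall>b<n. conn (?S' z) a b \<longrightarrow> \<not> conn S a b \<longrightarrow> (a, b) \<in> X)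
     \<and> (\<Sum>(a, b)\<in>X. inv_d a b) \<le> yr ^ 2 + 2 * (yr * f)" if z: "z < n" for z
  proof (cases "x = 0")
    case True
    have "(a, b) \<in> Y S x \<times> Y S x" if "a < n" "b < n" "conn (?S' z) a b" "\<not> conn S a b" for a b
    proof -
      have c: "conn (?S' z) b a" "\<not> conn S b a" using that conn_sym[of S a b] conn_sym[of "?S' z" a b] S z by auto
      show ?thesis using swap_conn[OF S(1) x(1) z that] swap_conn_outside(1)[OF S(1) x(1) z that]
        swap_conn_outside(1)[OF S(1) x(1) z that(2,1) c] True by auto
    qed
    moreover have "0 \<le> yr * f" using yr by (simp add: f_def)
    ultimately show ?thesis using YY by (intro exI[of _ "Y S x \<times> Y S x"]) auto
  next
    case False
    then obtain p where p: "p < n" "d x p = 1" "d 0 x = d 0 p + 1" using parent_exists xn by blast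
    define K where "K = {b. b < n \<and> conn S p b}"
    have finK: "finite K" by (auto simp: K_def)
    \<comment> \<open>If \<open>p\<close> is deleted in place of \<open>x\<close>, all new
      connections stay inside \<open>Y S x\<close>, since the way out is blocked, while all pairs
      \<open>(p, b)\<close> with \<open>b\<close> in \<open>K\<close> are lost. Optimality of
      \<open>S\<close> then bounds \<open>g\<close> by the weight inside
      \<open>Y S x\<close>.\<close>
    define g where "g = (\<Sum>b\<in>K. inv_d p b)"
    have g: "g \<le> yr ^ 2"
    proof (cases "p \<in> S")
      case True
      then have "K = {}" using p btw_self by (auto simp: K_def conn_def)
      then show ?thesis by (simp add: g_def)
    next
      case False
      have inX: "(a, b) \<in> Y S x \<times> Y S x" if "a < n" "b < n" "conn (?S' p) a b" "\<not> conn S a b" for a b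
      proof -
        have c: "conn (?S' p) b a" "\<not> conn S b a" using that conn_sym[of S a b] conn_sym[of "?S' p" a b] S p by auto
        show ?thesis using swap_conn[OF S(1) x(1) p(1) that] swap_conn_outside(2)[OF S(1) x(1) p(1) that _ _ p]
          swap_conn_outside(2)[OF S(1) x(1) p(1) that(2,1) c _ _ p] that c by (auto simp: conn_def)
      qed
      have "J (?S' p) - J S \<le> (\<Sum>(a, b)\<in>Y S x \<times> Y S x. inv_d a b) - (\<Sum>(a, b)\<in>{p} \<times> K. inv_d a b)"
        by (rule J_diff_le) (use inX p btw_self in \<open>auto simp: K_def conn_def\<close>)
      moreover have "(\<Sum>(a, b)\<in>{p} \<times> K. inv_d a b) = g"
        by (simp add: g_def sum.cartesian_product[symmetric])
      ultimately show ?thesis using optimal_swap[OF opt x(1) p(1) False] YY by linarith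
    qed
    have f: "(\<Sum>b\<in>K. 1 / (1 + real (d p b))) \<le> f"
    proof -
      have "(\<Sum>b\<in>K. 1 / (1 + real (d p b))) \<le> (\<Sum>b\<in>K. (if b = p then 1 else 0) + inv_d p b)"
      proof (rule sum_mono)
        fix b assume "b \<in> K"
        then have "b < n" by (auto simp: K_def)
        then show "1 / (1 + real (d p b)) \<le> (if b = p then 1 else 0) + inv_d p b"
          using d_zero[of p b] p by (auto simp: inv_d_def intro!: divide_left_mono)
      qed
      also have "\<dots> = (\<Sum>b\<in>K. if b = p then 1 else 0) + g" by (simp add: sum.distrib g_def)
      also have "(\<Sum>b\<in>K. if b = p then 1 else 0) \<le> (1::real)" using finK by simp
      finally show ?thesis using g by (simp add: f_def)
    qed
    let ?A = "Y S x" let ?K = "K - Y S x"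
    \<comment> \<open>The bound on \<open>inv_d\<close> is made part of \<open>X\<close> because it
      is known only for newly connected pairs; without it the sum over \<open>X\<close> could not be
      estimated.\<close>
    define X where "X = ?A \<times> ?A \<union> {(a, b). a \<in> ?A \<and> b \<in> ?K \<and> inv_d a b \<le> 1 / (1 + real (d p b))}
        \<union> {(b, a). a \<in> ?A \<and> b \<in> ?K \<and> inv_d b a \<le> 1 / (1 + real (d p b))}"
    let ?X1 = "{(a, b). a \<in> ?A \<and> b \<in> ?K \<and> inv_d a b \<le> 1 / (1 + real (d p b))}"
    let ?X2 = "{(b, a). a \<in> ?A \<and> b \<in> ?K \<and> inv_d b a \<le> 1 / (1 + real (d p b))}"
    have fin1: "finite ?X1" by (rule finite_subset[of _ "?A \<times> K"]) (use finK in auto)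
    have fin2: "finite ?X2" by (rule finite_subset[of _ "K \<times> ?A"]) (use finK in auto)
    have inX: "(a, b) \<in> X" if "a < n" "b < n" "conn (?S' z) a b" "\<not> conn S a b" for a b
    proof -
      have c: "conn (?S' z) b a" "\<not> conn S b a" using that conn_sym[of S a b] conn_sym[of "?S' z" a b] S z by auto
      have sy: "inv_d a b = inv_d b a" using d_sym[of a b] that by (simp add: inv_d_def)
      have 1: "a \<in> Y S x \<or> b \<in> Y S x" using swap_conn[OF S(1) x(1) z that] by auto
      have 2: "a \<in> Y S x \<Longrightarrow> b \<notin> Y S x \<Longrightarrow> conn S p b \<and> inv_d a b \<le> 1 / (1 + real (d p b))"
        using swap_conn_outside(2)[OF S(1) x(1) z that _ _ p] by auto
      have 3: "b \<in> Y S x \<Longrightarrow> a \<notin> Y S x \<Longrightarrow> conn S p a \<and> inv_d b a \<le> 1 / (1 + real (d p a))"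
        using swap_conn_outside(2)[OF S(1) x(1) z that(2,1) c _ _ p] by auto
      show ?thesis using 1 2 3 sy that by (auto simp: X_def K_def)
    qed
    have b1: "(\<Sum>(a, b)\<in>?X1. inv_d a b) \<le> yr * f"
    proof -
      have "(\<Sum>(a, b)\<in>?X1. inv_d a b) \<le> (\<Sum>(a, b)\<in>?X1. 1 / (1 + real (d p b)))" by (rule sum_mono) auto
      also have "\<dots> \<le> (\<Sum>(a, b)\<in>?A \<times> K. 1 / (1 + real (d p b)))" by (rule sum_mono2) (use finK in auto)
      also have "\<dots> = (\<Sum>a\<in>?A. \<Sum>b\<in>K. 1 / (1 + real (d p b)))"
        by (rule sum.cartesian_product[symmetric])
      also have "\<dots> = yr * (\<Sum>b\<in>K. 1 / (1 + real (d p b)))"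
        by (simp only: sum_constant yr_def y_def)
      also have "\<dots> \<le> yr * f" using f yr by (intro mult_left_mono) auto
      finally show ?thesis .
    qed
    have b2: "(\<Sum>(a, b)\<in>?X2. inv_d a b) \<le> yr * f"
    proof -
      have "(\<Sum>(a, b)\<in>?X2. inv_d a b) \<le> (\<Sum>(b, a)\<in>?X2. 1 / (1 + real (d p b)))" by (rule sum_mono) auto
      also have "\<dots> \<le> (\<Sum>(b, a)\<in>K \<times> ?A. 1 / (1 + real (d p b)))" by (rule sum_mono2) (use finK in auto)
      also have "\<dots> = (\<Sum>b\<in>K. \<Sum>a\<in>?A. 1 / (1 + real (d p b)))"
        by (rule sum.cartesian_product[symmetric])
      also have "\<dots> = (\<Sum>a\<in>?A. \<Sum>b\<in>K. 1 / (1 + real (d p b)))" by (rule sum.swap)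
      also have "\<dots> = yr * (\<Sum>b\<in>K. 1 / (1 + real (d p b)))"
        by (simp only: sum_constant yr_def y_def)
      also have "\<dots> \<le> yr * f" using f yr by (intro mult_left_mono) auto
      finally show ?thesis .
    qed
    have "(\<Sum>(a, b)\<in>X. inv_d a b) = (\<Sum>(a, b)\<in>?A \<times> ?A. inv_d a b) + (\<Sum>(a, b)\<in>?X1. inv_d a b) + (\<Sum>(a, b)\<in>?X2. inv_d a b)"
    proof -
      have "(\<Sum>(a, b)\<in>X. inv_d a b) = (\<Sum>(a, b)\<in>?A \<times> ?A \<union> ?X1. inv_d a b) + (\<Sum>(a, b)\<in>?X2. inv_d a b)"
        unfolding X_def by (rule sum.union_disjoint) (use fin1 fin2 in auto)
      also have "(\<Sum>(a, b)\<in>?A \<times> ?A \<union> ?X1. inv_d a b) = (\<Sum>(a, b)\<in>?A \<times> ?A. inv_d a b) + (\<Sum>(a, b)\<in>?X1. inv_d a b)"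
        by (rule sum.union_disjoint) (use fin1 in auto)
      finally show ?thesis .
    qed
    with YY b1 b2 have "(\<Sum>(a, b)\<in>X. inv_d a b) \<le> yr ^ 2 + 2 * (yr * f)" by linarith
    moreover have "finite X" using fin1 fin2 by (auto simp: X_def)
    ultimately show ?thesis using inX by (intro exI[of _ X]) blast
  qed
  define m where "m = d u v div 2"
  have "2 * m \<le> d u v" by (simp add: m_def)
  from geodesic_cut[OF S(1) uv this] obtain z Z where z: "z < n" "z \<notin> S"
    and zS: "\<forall>S'. z \<in> S' \<longrightarrow> (\<forall>(a, b)\<in>Z. a < n \<and> b < n \<and> conn S a b \<and> \<not> conn S' a b)"
    and zZ: "real m / 2 \<le> (\<Sum>(a, b)\<in>Z. inv_d a b)" by blast
  obtain X where X: "finite X" "\<forall>a<n. \<forall>b<n. conn (?S' z) a b \<longrightarrow> \<not> conn S a b \<longrightarrow> (a, b) \<in> X"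
     "(\<Sum>(a, b)\<in>X. inv_d a b) \<le> yr ^ 2 + 2 * (yr * f)" using cross[OF z(1)] by blast
  have "J (?S' z) - J S \<le> (\<Sum>(a, b)\<in>X. inv_d a b) - (\<Sum>(a, b)\<in>Z. inv_d a b)"
  proof (rule J_diff_le[OF X(1)])
    show "(a, b) \<in> X" if "a < n" "b < n" "conn (?S' z) a b" "\<not> conn S a b" for a b
      using X(2) that by blast
    show "a < n \<and> b < n \<and> conn S a b \<and> \<not> conn (?S' z) a b" if "(a, b) \<in> Z" for a b
      using zS that by blast
  qed
  with optimal_swap[OF opt x(1) z(1,2)] zZ X(3) have "real m / 2 \<le> yr ^ 2 + 2 * (yr * f)" by linarith
  also have "\<dots> = yr ^ 2 + 2 * yr + 2 * yr ^ 3" by (simp add: f_def algebra_simps power2_eq_square power3_eq_cube)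
  also have "\<dots> \<le> 5 * yr ^ 3"
  proof -
    have "yr ^ 2 \<le> yr ^ 3" "yr ^ 1 \<le> yr ^ 3" using yr by (intro power_increasing; simp)+
    then show ?thesis by simp
  qed
  \<comment> \<open>Next \<open>d u v \<le> 2 * m + 1 \<le> 21 * yr ^ 3\<close>, where the odd unit
    comes from the rounding in \<open>m\<close>. This is the origin of the
    \<open>21\<close>.\<close>
  finally have "real m \<le> 10 * yr ^ 3" by simp
  moreover have "real (d u v) \<le> 2 * real m + 1" unfolding m_def by linarith
  moreover have "1 \<le> yr ^ 3" using yr by simp
  ultimately have "real (d u v) \<le> 21 * yr ^ 3" by linarith
  then have "real (d u v) * of_int k ^ 3 \<le> 21 * yr ^ 3 * of_int k ^ 3" using k by (intro mult_right_mono) auto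
  also have "\<dots> = 21 * (yr * of_int k) ^ 3" by (simp add: power_mult_distrib)
  also have "yr * of_int k = real (card S * card (Y S x))" using S by (simp add: yr_def y_def mult.commute flip: S(2))
  also have "21 * real (card S * card (Y S x)) ^ 3 \<le> 21 * real n ^ 3"
    using x(2) by (intro mult_left_mono power_mono) (simp_all only: of_nat_le_iff of_nat_0_le_iff zero_le_numeral)
  finally show ?thesis .
qed

end


section \<open>From trees to tree metrics\<close>

definition adj :: "'a set set \<Rightarrow> 'a \<Rightarrow> 'a \<Rightarrow> bool" where
  "adj E x y \<longleftrightarrow> {x, y} \<in> E"

definition walk :: "'a set set \<Rightarrow> 'a \<Rightarrow> 'a list \<Rightarrow> 'a \<Rightarrow> bool" where
  "walk E u p v \<longleftrightarrow> p \<noteq> [] \<and> hd p = u \<and> last p = v \<and> successively (adj E) p"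

lemma graph_path_walk: "graph_path V E u p v \<longleftrightarrow> walk E u p v \<and> distinct p \<and> set p \<subseteq> V"
  unfolding graph_path_def walk_def adj_def by auto

lemma walk_singleton [simp]: "walk E u [u] u"
  by (simp add: walk_def)

lemma walk_Cons: "walk E u (x # p) v \<longleftrightarrow> x = u \<and> (p = [] \<and> u = v \<or> (\<exists>w. adj E u w \<and> walk E w p v))"
  by (cases p) (auto simp: walk_def)

lemma walk_append: "walk E u p v \<Longrightarrow> walk E v (v # q) w \<Longrightarrow> walk E u (p @ q) w"
  unfolding walk_def by (cases q) (auto simp: successively_append_iff)

lemma walk_split: "walk E u (p @ x # q) v \<longleftrightarrow> walk E u (p @ [x]) x \<and> walk E x (x # q) v"
proof -
  have "successively (adj E) (p @ x # q) \<longleftrightarrow> successively (adj E) (p @ [x]) \<and> successively (adj E) (x # q)"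
    by (cases q) (auto simp: successively_append_iff)
  moreover have "hd (p @ x # q) = hd (p @ [x])" by (cases p) auto
  ultimately show ?thesis unfolding walk_def by auto
qed

lemma walk_rev: "walk E u p v \<Longrightarrow> walk E v (rev p) u"
  unfolding walk_def adj_def
  by (auto simp: hd_rev last_rev successively_rev insert_commute)

text \<open>Cut out the part between two visits of the same vertex. The strict inequality will
  identify a walk that is as short as the path between its ends with that path.\<close>

lemma walk_to_path:
  assumes "walk E u p v"
  shows "\<exists>q. walk E u q v \<and> distinct q \<and> set q \<subseteq> set p \<and> length q \<le> length p \<and> (\<not> distinct p \<longrightarrow> length q < length p)"
  using assms
proof (induction "length p" arbitrary: p rule: less_induct)
  case less
  show ?case
  proof (cases "distinct p")
    case False
    then obtain xs ys zs y where p: "p = xs @ [y] @ ys @ [y] @ zs" using not_distinct_decomp by blast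
    have "walk E u (xs @ [y]) y" "walk E y (y # zs) v"
      using less.prems walk_split[of E u xs y "ys @ [y] @ zs" v] walk_split[of E y "y # ys" y zs v]
      unfolding p by auto
    then have "walk E u (xs @ y # zs) v" using walk_split[of E u xs y zs v] by auto
    moreover have "length (xs @ y # zs) < length p" unfolding p by simp
    ultimately obtain q where "walk E u q v" "distinct q" "set q \<subseteq> set (xs @ y # zs)" "length q \<le> length (xs @ y # zs)"
      using less.hyps[of "xs @ y # zs"] by blast
    then show ?thesis unfolding p by (intro exI[of _ q]) auto
  qed (use less.prems in auto)
qed

lemma walk_set:
  assumes "walk E u p v" "u \<in> V" "\<forall>e\<in>E. e \<subseteq> V"
  shows "set p \<subseteq> V"
  using assms(1,2)
proof (induction p arbitrary: u)
  case (Cons x p)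
  show ?case
  proof (cases "p = []")
    case False
    then obtain w where w: "adj E u w" "walk E w p v" using Cons.prems(1) by (auto simp: walk_Cons)
    then have "w \<in> V" using assms(3) by (auto simp: adj_def)
    with Cons.IH[OF w(2)] Cons.prems show ?thesis by (auto simp: walk_Cons)
  qed (use Cons.prems in \<open>auto simp: walk_Cons\<close>)
qed simp

text \<open>Where two paths part, follow the first to its first vertex \<open>y\<close> on the
  second and return along the second; this closes a cycle.\<close>

lemma no_cycle_unique:
  assumes nc: "\<nexists>p. graph_cycle V E p" and sg: "simple_graph V E"
    and p: "graph_path V E u (u # ps) v" and q: "graph_path V E u (u # qs) v"
  shows "ps = qs"
  using p q
proof (induction ps arbitrary: u qs)
  case Nil
  then have "u = v" by (simp add: graph_path_def)
  with Nil show ?case by (cases qs) (auto simp: graph_path_def split: if_splits)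
next
  case (Cons a ps)
  have "qs \<noteq> []" using Cons.prems by (auto simp: graph_path_def split: if_splits)
  then obtain b qs' where qs: "qs = b # qs'" by (cases qs) auto
  show ?case
  proof (cases "a = b")
    case True
    have "graph_path V E a (a # ps) v" "graph_path V E a (a # qs') v"
      using Cons.prems unfolding qs True by (auto simp: graph_path_def)
    from Cons.IH[OF this] show ?thesis using qs True by simp
  next
    case False
    have "v = last (a # ps)" "v = last qs" using Cons.prems \<open>qs \<noteq> []\<close> unfolding graph_path_def by auto
    then have "v \<in> set (a # ps)" "v \<in> set qs" using \<open>qs \<noteq> []\<close> by (metis last_in_set list.distinct(1))+
    then have "\<exists>x\<in>set (a # ps). x \<in> set qs" by blast
    then obtain ps1 y ps2 where ps: "a # ps = ps1 @ y # ps2" "y \<in> set qs" "\<forall>x\<in>set ps1. x \<notin> set qs"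
      using split_list_first_prop[of "a # ps" "\<lambda>x. x \<in> set qs"] by blast
    obtain qs1 qs2 where qs12: "qs = qs1 @ y # qs2" using ps(2) split_list by metis
    have sub: "set (u # a # ps) \<subseteq> V" "distinct (u # a # ps)" "set (u # qs) \<subseteq> V" "distinct (u # qs)"
      using Cons.prems by (auto simp: graph_path_def)
    have w1: "walk E u (u # ps1 @ [y]) y"
      using Cons.prems(1) walk_split[of E u "u # ps1" y ps2 v] unfolding graph_path_walk ps(1) by simp
    have w2: "walk E u (u # qs1 @ [y]) y"
      using Cons.prems(2) walk_split[of E u "u # qs1" y qs2 v] unfolding graph_path_walk qs12 by simp
    obtain z where z: "adj E u z" "walk E z (qs1 @ [y]) y" using w2 by (auto simp: walk_Cons)
    have "walk E y (y # rev qs1) z" using walk_rev[OF z(2)] by simp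
    from walk_append[OF w1 this]
    have w: "walk E u (u # ps1 @ y # rev qs1) z" by simp
    have dis: "distinct (u # ps1 @ y # rev qs1)"
      using sub ps unfolding ps(1) qs12 by auto
    \<comment> \<open>The paths leave \<open>u\<close> by different edges, so they cannot both reach
      \<open>y\<close> in one step; this yields the third vertex of the cycle.\<close>
    have "ps1 \<noteq> [] \<or> qs1 \<noteq> []" using False ps(1) qs12 qs by (cases ps1; cases qs1) auto
    then have "length (u # ps1 @ y # rev qs1) \<ge> 3" by (cases ps1; cases qs1) auto
    moreover have "set (u # ps1 @ y # rev qs1) \<subseteq> V" using sub unfolding ps(1) qs12 by auto
    moreover have "{z, u} \<in> E" using z(1) by (simp add: adj_def insert_commute)
    moreover have "last (u # ps1 @ y # rev qs1) = z" using w by (simp add: walk_def)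
    ultimately have "graph_cycle V E (u # ps1 @ y # rev qs1)"
      unfolding graph_cycle_def graph_path_walk using w dis by simp
    with nc show ?thesis by blast
  qed
qed

section \<open>The metric of a tree\<close>

locale tree_instance =
  fixes n :: nat and E :: "nat set set"
  assumes tree: "tree_graph {..<n} E"
begin

lemma sg: "simple_graph {..<n} E" and n_gt_0: "0 < n"
  using tree by (auto simp: tree_graph_def)

lemma path_ex: "\<lbrakk>u < n; v < n\<rbrakk> \<Longrightarrow> \<exists>p. graph_path {..<n} E u p v"
  using tree by (auto simp: tree_graph_def connected_graph_def)

lemma path_unique: "\<lbrakk>graph_path {..<n} E u p v; graph_path {..<n} E u q v\<rbrakk> \<Longrightarrow> p = q"
proof -
  assume *: "graph_path {..<n} E u p v" "graph_path {..<n} E u q v"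
  then obtain ps qs where "p = u # ps" "q = u # qs" unfolding graph_path_def by (metis list.collapse)
  with * no_cycle_unique[of "{..<n}" E u ps v qs] tree show ?thesis by (auto simp: tree_graph_def)
qed

definition P :: "nat \<Rightarrow> nat \<Rightarrow> nat list" where
  "P u v = (THE p. graph_path {..<n} E u p v)"

definition dist :: "nat \<Rightarrow> nat \<Rightarrow> nat" where
  "dist u v = length (P u v) - 1"

lemma P_path: "\<lbrakk>u < n; v < n\<rbrakk> \<Longrightarrow> graph_path {..<n} E u (P u v) v"
  unfolding P_def using path_ex path_unique by (metis theI')

lemma P_eq: "graph_path {..<n} E u p v \<Longrightarrow> P u v = p"
  unfolding P_def using path_unique by blast

lemma P_walk: "\<lbrakk>u < n; v < n\<rbrakk> \<Longrightarrow> walk E u (P u v) v"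
  using P_path by (auto simp: graph_path_walk)

lemma P_len: "\<lbrakk>u < n; v < n\<rbrakk> \<Longrightarrow> length (P u v) = Suc (dist u v)"
  using P_path[of u v] unfolding dist_def graph_path_def by (cases "P u v") auto

lemma walk_P:
  assumes "walk E u p v" "u < n"
  shows "set (P u v) \<subseteq> set p" "length (P u v) \<le> length p" "length (P u v) = length p \<Longrightarrow> P u v = p"
proof -
  have V: "set p \<subseteq> {..<n}" by (rule walk_set[OF assms(1)]) (use assms sg in \<open>auto simp: simple_graph_def\<close>)
  obtain q where q: "walk E u q v" "distinct q" "set q \<subseteq> set p" "length q \<le> length p"
    "\<not> distinct p \<longrightarrow> length q < length p"
    using walk_to_path[OF assms(1)] by blast
  have "P u v = q" using q V by (intro P_eq) (auto simp: graph_path_walk)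
  with q show "set (P u v) \<subseteq> set p" "length (P u v) \<le> length p" by auto
  show "P u v = p" if "length (P u v) = length p"
    using that q V \<open>P u v = q\<close> assms(1) by (intro P_eq) (auto simp: graph_path_walk)
qed

lemma walk_join:
  assumes "u < n" "v < n" "w < n"
  shows "walk E u (P u v @ tl (P v w)) w"
proof -
  have "P v w = v # tl (P v w)" using P_walk[OF assms(2,3)] unfolding walk_def by (metis list.collapse)
  then show ?thesis using walk_append[OF P_walk[OF assms(1,2)]] P_walk[OF assms(2,3)] by metis
qed

lemma set_P_join: "\<lbrakk>u < n; v < n; w < n\<rbrakk> \<Longrightarrow> set (P u v @ tl (P v w)) = set (P u v) \<union> set (P v w)"
proof -
  assume a: "u < n" "v < n" "w < n"
  have "P v w = v # tl (P v w)" using P_walk[OF a(2,3)] unfolding walk_def by (metis list.collapse)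
  then have "set (P v w) = insert v (set (tl (P v w)))" by (metis list.simps(15))
  moreover have "v \<in> set (P u v)" using P_walk[OF a(1,2)] unfolding walk_def by (metis last_in_set)
  ultimately show ?thesis by auto
qed

text \<open>If the distances add up, the paths from \<open>u\<close> to \<open>x\<close> and from
  \<open>x\<close> to \<open>v\<close> concatenate to a walk of the length of \<open>P u v\<close>,
  hence to \<open>P u v\<close> itself. Conversely, cutting a path at \<open>x\<close> leaves two
  paths.\<close>

lemma btw_P:
  assumes "u < n" "v < n" "x < n"
  shows "dist u x + dist x v = dist u v \<longleftrightarrow> x \<in> set (P u v)"
proof
  assume "x \<in> set (P u v)"
  then obtain p q where pq: "P u v = p @ x # q" using split_list by metis
  have "graph_path {..<n} E u (p @ [x]) x" "graph_path {..<n} E x (x # q) v"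
    using P_path[OF assms(1,2)] walk_split[of E u p x q v] unfolding pq graph_path_walk by auto
  then have "P u x = p @ [x]" "P x v = x # q" using P_eq by auto
  then show "dist u x + dist x v = dist u v" using pq by (simp add: dist_def)
next
  assume *: "dist u x + dist x v = dist u v"
  note w = walk_join[OF assms(1,3,2)]
  have "length (P u x @ tl (P x v)) = length (P u v)" using * P_len assms by simp
  then have "P u v = P u x @ tl (P x v)" using walk_P(3)[OF w assms(1)] by simp
  moreover have "x \<in> set (P u x)" using P_walk[OF assms(1,3)] unfolding walk_def by (metis last_in_set)
  ultimately show "x \<in> set (P u v)" by simp
qed

lemma dist_edge: "\<lbrakk>{u, v} \<in> E\<rbrakk> \<Longrightarrow> u < n \<and> v < n \<and> u \<noteq> v \<and> dist u v = 1"
proof -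
  assume e: "{u, v} \<in> E"
  then have uv: "u < n" "v < n" "u \<noteq> v" using sg by (auto simp: simple_graph_def)
  then have "P u v = [u, v]" using e by (intro P_eq) (auto simp: graph_path_def)
  with uv show ?thesis by (simp add: dist_def)
qed

lemma edge_dist: "\<lbrakk>u < n; v < n; dist u v = 1\<rbrakk> \<Longrightarrow> {u, v} \<in> E"
proof -
  assume a: "u < n" "v < n" "dist u v = 1"
  have "length (P u v) = 2" using P_len[OF a(1,2)] a(3) by simp
  then obtain x y where "P u v = [x, y]" by (auto simp: length_Suc_conv numeral_2_eq_2)
  then show ?thesis using P_path[OF a(1,2)] by (auto simp: graph_path_def)
qed

lemma dist_sym: "\<lbrakk>u < n; v < n\<rbrakk> \<Longrightarrow> dist u v = dist v u"
proof -
  assume a: "u < n" "v < n"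
  have "graph_path {..<n} E v (rev (P u v)) u"
    using P_path[OF a] walk_rev by (auto simp: graph_path_walk)
  then have "P v u = rev (P u v)" by (rule P_eq)
  then show ?thesis by (simp add: dist_def)
qed

sublocale tree_metric n dist
proof
  show "0 < n" by (rule n_gt_0)
next
  fix u v assume a: "u < n" "v < n"
  show "dist u v = 0 \<longleftrightarrow> u = v"
  proof
    assume "dist u v = 0"
    then have "length (P u v) = 1" using P_len[OF a] by simp
    then obtain x where "P u v = [x]" by (auto simp: length_Suc_conv)
    then show "u = v" using P_path[OF a] by (auto simp: graph_path_def)
  next
    assume "u = v"
    then have "P u v = [u]" using a by (intro P_eq) (auto simp: graph_path_def)
    then show "dist u v = 0" by (simp add: dist_def)
  qed
  show "dist u v = dist v u" by (rule dist_sym[OF a])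
  have "card (set (P u v)) \<le> card {..<n}"
    using P_path[OF a] by (intro card_mono) (auto simp: graph_path_def)
  moreover have "card (set (P u v)) = length (P u v)" using P_path[OF a] by (intro distinct_card) (auto simp: graph_path_def)
  ultimately show "dist u v < n" using P_len[OF a] by simp
next
  fix u v w assume a: "u < n" "v < n" "w < n"
  show "dist u w \<le> dist u v + dist v w"
    using walk_P(2)[OF walk_join[OF a] a(1)] P_len a by simp
next
  fix a b r x assume a: "a < n" "b < n" "r < n" "x < n" "dist a x + dist x b = dist a b"
  have "x \<in> set (P a b)" using a btw_P by blast
  \<comment> \<open>The walk from \<open>a\<close> over \<open>r\<close> to \<open>b\<close>
    contains all vertices of the path from \<open>a\<close> to \<open>b\<close>.\<close>
  then have "x \<in> set (P a r) \<or> x \<in> set (P r b)"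
    using walk_P(1)[OF walk_join[OF a(1,3,2)] a(1)] set_P_join[OF a(1,3,2)] by blast
  then have "dist a x + dist x r = dist a r \<or> dist r x + dist x b = dist r b" using btw_P a by blast
  then show "dist r x + dist x a = dist r a \<or> dist r x + dist x b = dist r b"
    using dist_sym a by (metis add.commute)
next
  fix u v i assume a: "u < n" "v < n" "i \<le> dist u v"
  define p where "p = P u v"
  have len: "i < length p" using P_len[OF a(1,2)] a(3) by (simp add: p_def)
  let ?x = "p ! i"
  have x: "?x < n" using P_path[OF a(1,2)] len unfolding graph_path_def p_def by (meson lessThan_iff nth_mem subsetD)
  have pq: "P u v = take i p @ ?x # drop (Suc i) p" using len by (simp add: p_def id_take_nth_drop[symmetric])
  have "graph_path {..<n} E u (take i p @ [?x]) ?x"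
    using P_path[OF a(1,2)] walk_split[of E u "take i p" ?x "drop (Suc i) p" v] unfolding graph_path_walk pq by auto
  then have "P u ?x = take i p @ [?x]" by (rule P_eq)
  then have "dist u ?x = i" using len by (simp add: dist_def)
  moreover have "dist u ?x + dist ?x v = dist u v" using btw_P[OF a(1,2) x] pq by (metis in_set_conv_decomp)
  ultimately show "\<exists>w<n. dist u w = i \<and> dist w v = dist u v - i" using x by (intro exI[of _ ?x]) auto
next
  fix u v r assume a: "u < n" "v < n" "r < n" "dist u v = 1"
  then have e: "{u, v} \<in> E" using edge_dist by blast
  \<comment> \<open>Either \<open>u\<close> is on the path from \<open>r\<close> to
    \<open>v\<close>, or appending \<open>u\<close> to this path gives the path from
    \<open>r\<close> to \<open>u\<close>.\<close>
  show "dist r u = dist r v + 1 \<or> dist r v = dist r u + 1"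
  proof (cases "u \<in> set (P r v)")
    case True
    then have "dist r u + dist u v = dist r v" using btw_P a by blast
    with a show ?thesis by simp
  next
    case False
    have "walk E r (P r v @ [u]) u"
      by (rule walk_append[OF P_walk[OF a(3,2)]]) (use e in \<open>auto simp: walk_Cons adj_def insert_commute\<close>)
    then have "graph_path {..<n} E r (P r v @ [u]) u"
      using False P_path[OF a(3,2)] a by (auto simp: graph_path_walk)
    then have "P r u = P r v @ [u]" by (rule P_eq)
    then show ?thesis using P_len[OF a(3,2)] by (simp add: dist_def)
  qed
qed

section \<open>Deletion of vertices, and the number of edges\<close>

lemma graph_path_delete:
  assumes "S \<subseteq> {..<n}"
  shows "graph_path ({..<n} - S) {e \<in> E. e \<inter> S = {}} u p v \<longleftrightarrow> graph_path {..<n} E u p v \<and> set p \<inter> S = {}"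
proof -
  have "successively (\<lambda>x y. {x, y} \<in> {e \<in> E. e \<inter> S = {}}) p = successively (\<lambda>x y. {x, y} \<in> E) p"
    if "set p \<inter> S = {}" using that
    by (induction p rule: induct_list012) auto
  then show ?thesis unfolding graph_path_def by auto
qed

text \<open>The only candidate for a path after the deletion is \<open>P u v\<close>, so the infimum
  is over one path or over none, and in the latter case \<open>1 / \<infinity>\<close> is
  \<open>0\<close>.\<close>

lemma inv_gdist:
  assumes "S \<subseteq> {..<n}" "u < n" "v < n"
  shows "inv_enat (gdist ({..<n} - S) {e \<in> E. e \<inter> S = {}} u v) = (if conn S u v then inv_d u v else 0)"
proof -
  have c: "conn S u v \<longleftrightarrow> set (P u v) \<inter> S = {}"
    unfolding conn_def btw_def using btw_P assms by blast
  have "{p. graph_path ({..<n} - S) {e \<in> E. e \<inter> S = {}} u p v} = (if conn S u v then {P u v} else {})"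
  proof -
    have "graph_path {..<n} E u p v \<longleftrightarrow> p = P u v" for p using P_path[OF assms(2,3)] P_eq by blast
    then show ?thesis unfolding graph_path_delete[OF assms(1)] c by auto
  qed
  then have "gdist ({..<n} - S) {e \<in> E. e \<inter> S = {}} u v = (if conn S u v then enat (dist u v) else \<infinity>)"
    by (simp add: gdist_def dist_def flip: top_enat_def)
  then show ?thesis by (simp add: inv_enat_def inv_d_def)
qed

lemma J_IGL:
  assumes S: "S \<subseteq> {..<n}"
  shows "J S = 2 * IGL ({..<n} - S) {e \<in> E. e \<inter> S = {}}"
proof -
  let ?V = "{..<n} \<times> {..<n}"
  define h where "h = (\<lambda>p. if conn S (fst p) (snd p) then inv_d (fst p) (snd p) else 0)"
  have h0: "h (u, v) = 0" if "u < n" "v < n" "u \<in> S \<or> v \<in> S" for u v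
  proof -
    have "\<not> conn S u v" using that btw_self[of u v] by (auto simp: conn_def)
    then show ?thesis by (simp add: h_def)
  qed
  have h1: "h (u, u) = 0" if "u < n" for u using that by (simp add: h_def inv_d_def)
  have hs: "h (u, v) = h (v, u)" if "u < n" "v < n" for u v
    using conn_sym[OF S that] dist_sym[OF that] by (simp add: h_def inv_d_def)
  let ?A = "{(u, v). u < n \<and> v < n \<and> u < v}" let ?B = "{(u, v). u < n \<and> v < n \<and> v < u}"
  have finA: "finite ?A" by (rule finite_subset[of _ ?V]) auto
  have finB: "finite ?B" by (rule finite_subset[of _ ?V]) auto
  have "IGL ({..<n} - S) {e \<in> E. e \<inter> S = {}} = sum h {(u, v). u \<in> {..<n} - S \<and> v \<in> {..<n} - S \<and> u < v}"
    unfolding IGL_def by (rule sum.cong[OF refl]) (use inv_gdist[OF S] in \<open>auto simp: h_def\<close>)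
  also have "\<dots> = sum h ?A"
    by (rule sum.mono_neutral_left[OF finA]) (use h0 in auto)
  finally have I: "IGL ({..<n} - S) {e \<in> E. e \<inter> S = {}} = sum h ?A" .
  have "J S = sum h ?V" unfolding J_def sum.cartesian_product by (simp add: h_def split_def)
  also have "\<dots> = sum h (?A \<union> ?B)"
  proof (rule sum.mono_neutral_right)
    show "\<forall>p\<in>?V - (?A \<union> ?B). h p = 0"
    proof
      fix p assume p: "p \<in> ?V - (?A \<union> ?B)"
      then obtain a b where ab: "p = (a, b)" "a < n" "b < n" by auto
      then have "a = b" using p by auto
      then show "h p = 0" using h1 ab by blast
    qed
  qed auto
  also have "\<dots> = sum h ?A + sum h ?B" by (rule sum.union_disjoint) (use finA finB in auto)
  also have "sum h ?B = sum h ?A"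
    by (rule sum.reindex_bij_witness[of _ prod.swap prod.swap]) (use hs in auto)
  finally show ?thesis using I by simp
qed

lemma MinIGL_J: "MinIGL {..<n} E k \<tau> \<longleftrightarrow> (\<exists>S\<subseteq>{..<n}. int (card S) = k \<and> J S \<le> 2 * \<tau>)"
  unfolding MinIGL_def using J_IGL by auto

text \<open>Every edge joins a vertex other than the root to its parent. The bound makes the input
  fit into the first four rows of the memory and lets a sum over \<open>n\<close> terms scan all
  edges.\<close>

lemma card_edges: "card E \<le> n - 1"
proof -
  define par where "par = (\<lambda>c. SOME p. p < n \<and> dist c p = 1 \<and> dist 0 c = dist 0 p + 1)"
  have par: "par c < n \<and> dist c (par c) = 1 \<and> dist 0 c = dist 0 (par c) + 1" if "c < n" "c \<noteq> 0" for c
    unfolding par_def by (rule someI_ex) (use parent_exists[OF that] in auto)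
  have "E \<subseteq> (\<lambda>c. {c, par c}) ` {1..<n}"
  proof
    fix e assume e: "e \<in> E"
    then have "card e = 2" using sg by (auto simp: simple_graph_def)
    then obtain u v where uv: "e = {u, v}" by (meson card_2_iff)
    have key: "{a, b} \<in> (\<lambda>c. {c, par c}) ` {1..<n}" if "a < n" "b < n" "dist a b = 1" "dist 0 a = dist 0 b + 1" for a b
    proof -
      have "a \<noteq> 0" using that(4) d_self[OF n_pos] by (cases "a = 0") auto
      then have "par a = b" using par[OF that(1)] parent_unique[OF that(1) _ that(2), of "par a"] that(3,4) by blast
      then have "{a, b} = {a, par a}" "a \<in> {1..<n}" using that \<open>a \<noteq> 0\<close> by auto
      then show ?thesis by (rule image_eqI)
    qed
    have d: "u < n" "v < n" "dist u v = 1" "dist v u = 1" using dist_edge[of u v] dist_sym[of u v] e uv by auto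
    then have "dist 0 u = dist 0 v + 1 \<or> dist 0 v = dist 0 u + 1" using d_edge n_pos by blast
    moreover have "e = {v, u}" using uv by blast
    ultimately show "e \<in> (\<lambda>c. {c, par c}) ` {1..<n}"
      using key[OF d(1,2,3)] key[OF d(2,1,4)] uv by metis
  qed
  then have "card E \<le> card ((\<lambda>c. {c, par c}) ` {1..<n})" by (intro card_mono) auto
  also have "\<dots> \<le> card {1..<n}" by (rule card_image_le) simp
  finally show ?thesis by simp
qed

end


section \<open>Dynamic programming over clusters\<close>

lemma digits_unique:
  fixes a b :: "nat \<Rightarrow> nat"
  assumes "\<And>j. j < m \<Longrightarrow> a j < B" "\<And>j. j < m \<Longrightarrow> b j < B"
    "(\<Sum>j<m. a j * B ^ j) = (\<Sum>j<m. b j * B ^ j)" "j < m"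
  shows "a j = b j"
  using assms
proof (induction m arbitrary: a b j)
  case (Suc m)
  have split: "(\<Sum>j<Suc m. f j * B ^ j) = f 0 + B * (\<Sum>j<m. f (Suc j) * B ^ j)" for f :: "nat \<Rightarrow> nat"
    unfolding sum.lessThan_Suc_shift by (simp add: sum_distrib_left mult_ac)
  have lt: "a 0 < B" "b 0 < B" using Suc.prems by auto
  have eq: "a 0 + B * (\<Sum>j<m. a (Suc j) * B ^ j) = b 0 + B * (\<Sum>j<m. b (Suc j) * B ^ j)"
    using Suc.prems(3) unfolding split .
  from arg_cong[OF eq, of "\<lambda>x. x mod B"] lt have 0: "a 0 = b 0" by simp
  with eq lt have "(\<Sum>j<m. a (Suc j) * B ^ j) = (\<Sum>j<m. b (Suc j) * B ^ j)" by simp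
  then have "a (Suc i) = b (Suc i)" if "i < m" for i
    using Suc.IH[of "\<lambda>j. a (Suc j)" "\<lambda>j. b (Suc j)" i] Suc.prems(1,2) that by simp
  with 0 Suc.prems(4) show ?case by (cases j) auto
qed simp

lemma sum_by_value:
  fixes h :: "nat \<Rightarrow> 'b :: semiring_1"
  assumes "finite X" "\<And>u. u \<in> X \<Longrightarrow> f u < m"
  shows "(\<Sum>u\<in>X. h (f u)) = (\<Sum>j<m. of_nat (card {u \<in> X. f u = j}) * h j)"
proof -
  have "(\<Sum>u\<in>X. h (f u)) = (\<Sum>j<m. \<Sum>u\<in>{u \<in> X. f u = j}. h (f u))"
    by (rule sum.group[symmetric]) (use assms in auto)
  also have "\<dots> = (\<Sum>j<m. of_nat (card {u \<in> X. f u = j}) * h j)"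
    by (rule sum.cong) auto
  finally show ?thesis .
qed

text \<open>\<open>card X < B\<close> excludes carries, so the digits of the sum of powers count the
  elements of \<open>X\<close> by the value of \<open>f\<close>. The sum encodes the whole
  distribution of \<open>f\<close>, and the sum of \<open>h (f u)\<close> depends on nothing
  else.\<close>

lemma sum_power_determines:
  fixes h :: "nat \<Rightarrow> real"
  assumes "finite X" "finite X'" "card X < B" "card X' < B"
    and "\<And>u. u \<in> X \<Longrightarrow> f u < m" "\<And>u. u \<in> X' \<Longrightarrow> f u < m"
    and eq: "(\<Sum>u\<in>X. B ^ f u) = (\<Sum>u\<in>X'. B ^ f u)"
  shows "(\<Sum>u\<in>X. h (f u)) = (\<Sum>u\<in>X'. h (f u))"
proof -
  have "card {u \<in> X. f u = j} = card {u \<in> X'. f u = j}" if "j < m" for j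
  proof (rule digits_unique[of m "\<lambda>j. card {u \<in> X. f u = j}" B "\<lambda>j. card {u \<in> X'. f u = j}"])
    show "card {u \<in> X. f u = j} < B" for j
      by (rule le_less_trans[OF card_mono assms(3)]) (use assms in auto)
    show "card {u \<in> X'. f u = j} < B" for j
      by (rule le_less_trans[OF card_mono assms(4)]) (use assms in auto)
    show "(\<Sum>j<m. card {u \<in> X. f u = j} * B ^ j) = (\<Sum>j<m. card {u \<in> X'. f u = j} * B ^ j)"
      using eq sum_by_value[of X f m "\<lambda>j. B ^ j"] sum_by_value[of X' f m "\<lambda>j. B ^ j"] assms by simp
  qed (use that in auto)
  then show ?thesis using sum_by_value[of X f m h] sum_by_value[of X' f m h] assms by simp
qed

context tree_metric
begin

definition hang :: "nat set \<Rightarrow> nat \<Rightarrow> bool" where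
  "hang C p \<longleftrightarrow> p \<in> C \<and> C \<subseteq> {..<n} \<and> (\<forall>u\<in>C. \<forall>w<n. w \<notin> C \<longrightarrow> btw u p w)"

text \<open>In base \<open>n + 1\<close> the digits are the numbers of vertices of \<open>C\<close>
  connected to \<open>p\<close>, sorted by distance. One real number holds the whole distribution,
  so the machine compares two of them directly.\<close>

definition prof :: "nat set \<Rightarrow> nat \<Rightarrow> nat set \<Rightarrow> nat" where
  "prof C p S = (\<Sum>u\<in>{u \<in> C. conn S p u}. (n + 1) ^ d p u)"

text \<open>The depth bound is that of \<open>optimal_diameter\<close>.\<close>

definition okf :: "int \<Rightarrow> nat set \<Rightarrow> nat \<Rightarrow> nat set \<Rightarrow> bool" where
  "okf k C p S \<longleftrightarrow> int (card S) \<le> k \<and>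
     (\<forall>u\<in>C. conn S p u \<longrightarrow> real (d p u) * of_int k ^ 3 \<le> 21 * real n ^ 3)"

definition sig :: "nat set \<Rightarrow> nat \<Rightarrow> nat set \<Rightarrow> nat \<times> nat" where
  "sig C p S = (card S, prof C p S)"

text \<open>A vertex \<open>x\<close> outside is reached from \<open>u\<close> and from
  \<open>w\<close> only through \<open>p\<close>. The detour over \<open>x\<close> has excess at
  least \<open>2 * d p x\<close>, so it is a geodesic only for \<open>x = p\<close>, which is in
  \<open>C\<close>.\<close>

lemma hang_convex:
  assumes "hang C p" "u \<in> C" "w \<in> C" "x < n" "btw u x w"
  shows "x \<in> C"
proof (rule ccontr)
  assume x: "x \<notin> C"
  have lt: "u < n" "w < n" "p < n" using assms by (auto simp: hang_def)
  have "btw u p x" "btw w p x" using assms x by (auto simp: hang_def)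
  then have "d u x = d u p + d p x" "d x w = d w p + d p x"
    using d_sym[of x w] lt assms by (auto simp: btw_def)
  then have "d p x = 0" using assms(5) d_tri[of u p w] d_sym[of w p] lt by (auto simp: btw_def)
  then have "p = x" using d_zero lt assms by auto
  with x assms show False by (auto simp: hang_def)
qed

lemma prof_determines:
  fixes h :: "nat \<Rightarrow> real"
  assumes "C \<subseteq> {..<n}" "p < n" "prof C p S1 = prof C p S2"
  shows "(\<Sum>u\<in>{u \<in> C. conn S1 p u}. h (d p u)) = (\<Sum>u\<in>{u \<in> C. conn S2 p u}. h (d p u))"
proof (rule sum_power_determines[of _ _ "n + 1" _ n])
  have "finite C" using assms finite_subset by blast
  then show "finite {u \<in> C. conn S1 p u}" "finite {u \<in> C. conn S2 p u}" by auto
  have "card {u \<in> C. conn S p u} \<le> card {..<n}" for S by (rule card_mono) (use assms in auto)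
  then show "card {u \<in> C. conn S1 p u} < n + 1" "card {u \<in> C. conn S2 p u} < n + 1"
    by (auto simp: less_Suc_eq_le)
  show "(\<Sum>u\<in>{u \<in> C. conn S1 p u}. (n + 1) ^ d p u) = (\<Sum>u\<in>{u \<in> C. conn S2 p u}. (n + 1) ^ d p u)"
    using assms(3) unfolding prof_def .
qed (use assms d_less in auto)

text \<open>For pairs inside \<open>C\<close>, convexity makes \<open>A\<close> irrelevant. For a
  pair across, the path passes \<open>p\<close>: its length is a sum and its connection a
  conjunction of one condition on \<open>S\<close> and one on \<open>A\<close>. The path of a pair
  outside can meet \<open>C\<close> in vertices of \<open>S\<close> only at \<open>p\<close>, so of
  \<open>S\<close> only \<open>S \<inter> {p}\<close> is felt.\<close>

lemma J_split:
  assumes "hang C p" "S \<subseteq> C" "A \<subseteq> {..<n}" "A \<inter> C = {}"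
  shows "J (A \<union> S) = (\<Sum>u\<in>C. \<Sum>w\<in>C. if conn S u w then inv_d u w else 0)
    + 2 * (\<Sum>w\<in>{..<n} - C. if conn A p w then (\<Sum>u\<in>{u \<in> C. conn S p u}. 1 / (real (d p u) + real (d p w))) else 0)
    + (\<Sum>u\<in>{..<n} - C. \<Sum>w\<in>{..<n} - C. if conn (A \<union> (S \<inter> {p})) u w then inv_d u w else 0)"
proof -
  have C: "C \<subseteq> {..<n}" "p < n" "p \<in> C" "finite C"
    using assms finite_subset[of C "{..<n}"] by (auto simp: hang_def)
  let ?V = "{..<n} - C"
  define g where "g = (\<lambda>u w. if conn (A \<union> S) u w then inv_d u w else 0)"
  have SV: "A \<union> S \<subseteq> {..<n}" using assms C by auto
  have split: "(\<Sum>u<n. f u) = (\<Sum>u\<in>C. f u) + (\<Sum>u\<in>?V. f u)" for f :: "nat \<Rightarrow> real"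
    using sum.subset_diff[of C "{..<n}" f] C by (simp add: add.commute)
  have J: "J (A \<union> S) = (\<Sum>u\<in>C. \<Sum>w\<in>C. g u w) + (\<Sum>u\<in>C. \<Sum>w\<in>?V. g u w)
     + ((\<Sum>u\<in>?V. \<Sum>w\<in>C. g u w) + (\<Sum>u\<in>?V. \<Sum>w\<in>?V. g u w))"
    unfolding J_def split sum.distrib by (simp add: g_def)
  have gsym: "g u w = g w u" if "u < n" "w < n" for u w
    using that conn_sym[OF SV] d_sym by (simp add: g_def inv_d_def)
  have 1: "(\<Sum>u\<in>C. \<Sum>w\<in>C. g u w) = (\<Sum>u\<in>C. \<Sum>w\<in>C. if conn S u w then inv_d u w else 0)"
  proof (intro sum.cong refl)
    fix u w assume uw: "u \<in> C" "w \<in> C"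
    have "\<not> btw u s w" if "s \<in> A" for s
      using hang_convex[OF assms(1) uw, of s] that assms by blast
    then have "conn (A \<union> S) u w \<longleftrightarrow> conn S u w" by (auto simp: conn_def)
    then show "g u w = (if conn S u w then inv_d u w else 0)" by (simp add: g_def)
  qed
  have 2: "g u w = (if conn A p w \<and> conn S p u then 1 / (real (d p u) + real (d p w)) else 0)"
    if uw: "u \<in> C" "w \<in> ?V" for u w
  proof -
    have lt: "u < n" "w < n" "w \<notin> C" using uw C by auto
    have upw: "d u w = d p u + d p w" using assms(1) uw d_sym[of p u] lt C by (auto simp: hang_def btw_def)
    have "btw u s w \<longleftrightarrow> btw p s u" if "s \<in> S" for s
    proof -
      have s: "s \<in> C" "s < n" using that assms C by auto
      have "d s w = d s p + d p w" using assms(1) s lt by (auto simp: hang_def btw_def)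
      then show ?thesis using upw d_sym[of u s] d_sym[of p s] lt s C by (auto simp: btw_def)
    qed
    moreover have "btw u s w \<longleftrightarrow> btw p s w" if "s \<in> A" for s
    proof -
      have s: "s \<notin> C" "s < n" using that assms by auto
      have "d u s = d u p + d p s" using assms(1) s uw by (auto simp: hang_def btw_def)
      then show ?thesis using upw d_sym[of p u] lt s C by (auto simp: btw_def)
    qed
    ultimately have "conn (A \<union> S) u w \<longleftrightarrow> conn A p w \<and> conn S p u" by (auto simp: conn_def)
    then show ?thesis by (simp add: g_def inv_d_def upw)
  qed
  have 3: "(\<Sum>u\<in>?V. \<Sum>w\<in>C. g u w) = (\<Sum>w\<in>?V. if conn A p w then (\<Sum>u\<in>{u \<in> C. conn S p u}. 1 / (real (d p u) + real (d p w))) else 0)"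
  proof (rule sum.cong[OF refl])
    fix w assume w: "w \<in> ?V"
    have "(\<Sum>u\<in>C. g w u) = (\<Sum>u\<in>C. if conn A p w \<and> conn S p u then 1 / (real (d p u) + real (d p w)) else 0)"
    proof (rule sum.cong[OF refl])
      fix u assume "u \<in> C"
      then show "g w u = (if conn A p w \<and> conn S p u then 1 / (real (d p u) + real (d p w)) else 0)"
        using 2[of u w] gsym[of u w] w C by auto
    qed
    also have "\<dots> = (if conn A p w then (\<Sum>u\<in>{u \<in> C. conn S p u}. 1 / (real (d p u) + real (d p w))) else 0)"
      using C(4) by (simp add: sum.inter_filter)
    finally show "(\<Sum>u\<in>C. g w u) = \<dots>" .
  qed
  have 4: "(\<Sum>u\<in>C. \<Sum>w\<in>?V. g u w) = (\<Sum>u\<in>?V. \<Sum>w\<in>C. g u w)"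
  proof -
    have "(\<Sum>u\<in>C. \<Sum>w\<in>?V. g u w) = (\<Sum>w\<in>?V. \<Sum>u\<in>C. g u w)" by (rule sum.swap)
    also have "\<dots> = (\<Sum>u\<in>?V. \<Sum>w\<in>C. g u w)"
    proof (intro sum.cong refl)
      fix u w assume "u \<in> ?V" "w \<in> C"
      then show "g w u = g u w" using gsym[of u w] C by auto
    qed
    finally show ?thesis .
  qed
  have 5: "(\<Sum>u\<in>?V. \<Sum>w\<in>?V. g u w) = (\<Sum>u\<in>?V. \<Sum>w\<in>?V. if conn (A \<union> (S \<inter> {p})) u w then inv_d u w else 0)"
  proof (intro sum.cong refl)
    fix u w assume uw: "u \<in> ?V" "w \<in> ?V"
    have "s = p" if "s \<in> S" "btw u s w" for s
    proof -
      have s: "s \<in> C" "s < n" using that assms C by auto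
      have lt: "u < n" "w < n" using uw by auto
      have "d s w = d s p + d p w" "d s u = d s p + d p u" using assms(1) s uw by (auto simp: hang_def btw_def)
      then have "d s p = 0" using that(2) d_tri[of u p w] d_sym[of u s] d_sym[of p u] lt s C by (auto simp: btw_def)
      then show ?thesis using d_zero s C by auto
    qed
    then have "conn (A \<union> S) u w \<longleftrightarrow> conn (A \<union> (S \<inter> {p})) u w" by (auto simp: conn_def)
    then show "g u w = (if conn (A \<union> (S \<inter> {p})) u w then inv_d u w else 0)" by (simp add: g_def)
  qed
  show ?thesis unfolding J 1 4 3 5 by simp
qed

text \<open>Within a cluster that is attached to the rest of the tree only at \<open>p\<close>, the rest sees of a
  deletion set only how many vertices remain connected to \<open>p\<close> at each distance.\<close>

lemma dominate:
  assumes "hang C p" "S1 \<subseteq> C" "S2 \<subseteq> C" "A \<subseteq> {..<n}" "A \<inter> C = {}" "prof C p S1 = prof C p S2" "J S1 \<le> J S2"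
  shows "J (A \<union> S1) \<le> J (A \<union> S2)"
proof -
  have C: "C \<subseteq> {..<n}" "p < n" "p \<in> C" "finite C"
    using assms finite_subset[of C "{..<n}"] by (auto simp: hang_def)
  note det = prof_determines[OF C(1,2) assms(6)]
  \<comment> \<open>Whether \<open>p\<close> is deleted can be read off the profile, since
    \<open>p\<close> is the only vertex at distance \<open>0\<close>.\<close>
  have p: "(\<Sum>u\<in>{u \<in> C. conn S p u}. if d p u = 0 then 1 else 0) = (if p \<in> S then 0 else 1 :: real)" if "S \<subseteq> C" for S
  proof -
    have "conn S p p \<longleftrightarrow> p \<notin> S" using that C d_zero d_self by (auto simp: conn_def btw_def subset_iff)
    moreover have "(\<Sum>u\<in>{u \<in> C. conn S p u}. if d p u = 0 then 1 else (0::real)) = (\<Sum>u\<in>{u \<in> C. conn S p u}. if u = p then 1 else 0)"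
      by (rule sum.cong) (use C d_zero in auto)
    ultimately show ?thesis using C by simp
  qed
  have "p \<in> S1 \<longleftrightarrow> p \<in> S2"
    using det[of "\<lambda>j. if j = 0 then 1 else 0"] p[OF assms(2)] p[OF assms(3)] by (auto split: if_splits)
  then have int: "S1 \<inter> {p} = S2 \<inter> {p}" by auto
  have c: "(\<Sum>u\<in>{u \<in> C. conn S1 p u}. 1 / (real (d p u) + real (d p w))) = (\<Sum>u\<in>{u \<in> C. conn S2 p u}. 1 / (real (d p u) + real (d p w)))" for w
    using det[of "\<lambda>j. 1 / (real j + real (d p w))"] .
  \<comment> \<open>With \<open>A = {}\<close> the same decomposition applies to \<open>J S1\<close>
    and \<open>J S2\<close>; so their comparison is one of the terms inside \<open>C\<close>, which
    carries over to any \<open>A\<close>.\<close>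
  have "{} \<subseteq> {..<n}" "{} \<inter> C = {}" by auto
  note e = J_split[OF assms(1,2) this] J_split[OF assms(1,3) this]
  show ?thesis
    using assms(7) e unfolding J_split[OF assms(1,2,4,5)] J_split[OF assms(1,3,4,5)] int c by simp
qed

section \<open>Insertion into and merging of candidate lists\<close>

definition ins_step :: "nat set \<Rightarrow> nat \<Rightarrow> nat set \<times> nat set list \<Rightarrow> nat set \<Rightarrow> nat set \<times> nat set list" where
  "ins_step C p cn W = (if sig C p W = sig C p (fst cn)
     then (if J W < J (fst cn) then W else fst cn, snd cn) else (fst cn, W # snd cn))"

text \<open>A single pass over \<open>R\<close>: the candidate absorbs the members of its own class,
  keeping the better one, and all others move to a second list in reverse order. A loop with two
  stacks can execute exactly this.\<close>

definition ins :: "nat set \<Rightarrow> nat \<Rightarrow> nat set \<Rightarrow> nat set list \<Rightarrow> nat set list" where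
  "ins C p U R = (let cn = foldl (ins_step C p) (U, []) R in fst cn # snd cn)"

lemma foldl_ins_step:
  fixes C p R c0 n0
  defines "cn \<equiv> foldl (ins_step C p) (c0, n0) R"
  shows "sig C p (fst cn) = sig C p c0 \<and> fst cn \<in> insert c0 (set R) \<and> J (fst cn) \<le> J c0 \<and>
     (\<forall>W\<in>set R. sig C p W = sig C p c0 \<longrightarrow> J (fst cn) \<le> J W) \<and>
     snd cn = rev (filter (\<lambda>W. sig C p W \<noteq> sig C p c0) R) @ n0"
  unfolding cn_def
proof (induction R arbitrary: c0 n0)
  case (Cons W R)
  define c1 where "c1 = (if sig C p W = sig C p c0 \<and> J W < J c0 then W else c0)"
  define n1 where "n1 = (if sig C p W = sig C p c0 then n0 else W # n0)"
  have st: "ins_step C p (c0, n0) W = (c1, n1)" by (simp add: ins_step_def c1_def n1_def)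
  have c1: "sig C p c1 = sig C p c0" "c1 \<in> {c0, W}" "J c1 \<le> J c0" "sig C p W = sig C p c0 \<longrightarrow> J c1 \<le> J W"
    by (auto simp: c1_def)
  show ?case
    using Cons.IH[of c1 n1] c1 unfolding foldl_Cons st n1_def by auto
qed simp

lemma ins_props:
  assumes "distinct (map (sig C p) R)"
  shows "distinct (map (sig C p) (ins C p U R))" "set (ins C p U R) \<subseteq> insert U (set R)"
    "\<exists>W\<in>set (ins C p U R). sig C p W = sig C p U \<and> J W \<le> J U"
    "W \<in> set R \<Longrightarrow> \<exists>W'\<in>set (ins C p U R). sig C p W' = sig C p W \<and> J W' \<le> J W"
proof -
  define cn where "cn = foldl (ins_step C p) (U, []) R"
  note f = foldl_ins_step[of C p U "[]" R, folded cn_def]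
  have i: "ins C p U R = fst cn # rev (filter (\<lambda>W. sig C p W \<noteq> sig C p U) R)"
    using f by (simp add: ins_def cn_def[symmetric])
  show "distinct (map (sig C p) (ins C p U R))"
    using assms f unfolding i by (auto simp: rev_map[symmetric] distinct_map intro: inj_on_subset)
  show "set (ins C p U R) \<subseteq> insert U (set R)" using f unfolding i by auto
  show "\<exists>W\<in>set (ins C p U R). sig C p W = sig C p U \<and> J W \<le> J U" using f unfolding i by auto
  show "\<exists>W'\<in>set (ins C p U R). sig C p W' = sig C p W \<and> J W' \<le> J W" if "W \<in> set R"
    using f that unfolding i by (cases "sig C p W = sig C p U") auto
qed

definition add :: "int \<Rightarrow> nat set \<Rightarrow> nat \<Rightarrow> nat set list \<Rightarrow> nat set \<Rightarrow> nat set list" where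
  "add k C p R U = (if okf k C p U then ins C p U R else R)"

definition mrg :: "int \<Rightarrow> nat set \<Rightarrow> nat \<Rightarrow> nat set list \<Rightarrow> nat set list \<Rightarrow> nat set list" where
  "mrg k C p Lp Lc = foldl (\<lambda>R S. foldl (\<lambda>R S'. add k C p R (S \<union> S')) R Lc) [] Lp"

definition Good :: "int \<Rightarrow> nat set \<Rightarrow> nat \<Rightarrow> nat set list \<Rightarrow> bool" where
  "Good k C p R \<longleftrightarrow> distinct (map (sig C p) R) \<and> (\<forall>U\<in>set R. okf k C p U \<and> U \<subseteq> C)"

lemma Good_Nil: "Good k C p []"
  by (simp add: Good_def)

lemma Good_add: "Good k C p R \<Longrightarrow> U \<subseteq> C \<Longrightarrow> Good k C p (add k C p R U)"
  using ins_props(1,2)[of C p R U] unfolding Good_def add_def by auto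

text \<open>A member is replaced only by one of its class with smaller \<open>J\<close>, so being
  represented is transitive along the fold and is never lost by later insertions.\<close>

lemma foldl_add:
  assumes "Good k C p R" "\<forall>U\<in>set Us. U \<subseteq> C"
  shows "Good k C p (foldl (add k C p) R Us) \<and>
    (\<forall>U\<in>set R \<union> {U \<in> set Us. okf k C p U}. \<exists>W\<in>set (foldl (add k C p) R Us). sig C p W = sig C p U \<and> J W \<le> J U)"
  using assms
proof (induction Us arbitrary: R)
  case (Cons U Us)
  let ?R = "add k C p R U"
  have G: "Good k C p ?R" using Good_add Cons.prems by simp
  note IH = Cons.IH[OF G]
  have 1: "\<exists>W\<in>set ?R. sig C p W = sig C p U' \<and> J W \<le> J U'" if "U' \<in> set R \<or> U' = U \<and> okf k C p U" for U'
    using that ins_props(3)[of C p R U] ins_props(4)[where C = C and p = p and R = R and U = U and W = U'] Cons.prems unfolding add_def Good_def by (cases "okf k C p U") auto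
  have 2: "\<exists>W\<in>set (foldl (add k C p) R (U # Us)). sig C p W = sig C p U' \<and> J W \<le> J U'"
    if "U' \<in> set R \<union> {U' \<in> set (U # Us). okf k C p U'}" for U'
  proof (cases "U' \<in> set Us \<and> okf k C p U'")
    case True
    then show ?thesis using IH Cons.prems by auto
  next
    case False
    then obtain W where W: "W \<in> set ?R" "sig C p W = sig C p U'" "J W \<le> J U'" using 1[of U'] \<open>U' \<in> _\<close> by auto
    have "\<forall>U\<in>set Us. U \<subseteq> C" using Cons.prems by simp
    with IH W(1) obtain W' where "W' \<in> set (foldl (add k C p) ?R Us)" "sig C p W' = sig C p W" "J W' \<le> J W"
      by blast
    with W show ?thesis by (intro bexI[of _ W']) auto
  qed
  show ?case using IH Cons.prems 2 by simp
qed auto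

lemma mrg_flat: "mrg k C p Lp Lc = foldl (add k C p) [] (concat (map (\<lambda>S. map (\<lambda>S'. S \<union> S') Lc) Lp))"
proof -
  have 1: "foldl (\<lambda>R S'. add k C p R (S \<union> S')) R Lc = foldl (add k C p) R (map (\<lambda>S'. S \<union> S') Lc)" for R S
    by (induction Lc arbitrary: R) auto
  have "foldl (\<lambda>R S. foldl (\<lambda>R S'. add k C p R (S \<union> S')) R Lc) R Lp
     = foldl (add k C p) R (concat (map (\<lambda>S. map (\<lambda>S'. S \<union> S') Lc) Lp))" for R
    by (induction Lp arbitrary: R) (auto simp: 1)
  then show ?thesis by (simp add: mrg_def)
qed

lemma mrg_props:
  assumes "\<forall>S\<in>set Lp. S \<subseteq> C" "\<forall>S\<in>set Lc. S \<subseteq> C"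
  shows "Good k C p (mrg k C p Lp Lc)"
    "\<lbrakk>S \<in> set Lp; S' \<in> set Lc; okf k C p (S \<union> S')\<rbrakk> \<Longrightarrow>
      \<exists>W\<in>set (mrg k C p Lp Lc). sig C p W = sig C p (S \<union> S') \<and> J W \<le> J (S \<union> S')"
proof -
  let ?Us = "concat (map (\<lambda>S. map (\<lambda>S'. S \<union> S') Lc) Lp)"
  have Us: "\<forall>U\<in>set ?Us. U \<subseteq> C" using assms by auto
  note f = foldl_add[OF Good_Nil Us, of k p, folded mrg_flat]
  from f show "Good k C p (mrg k C p Lp Lc)" by blast
  assume S: "S \<in> set Lp" "S' \<in> set Lc" "okf k C p (S \<union> S')"
  then have "S \<union> S' \<in> {U \<in> set ?Us. okf k C p U}" by auto
  with f show "\<exists>W\<in>set (mrg k C p Lp Lc). sig C p W = sig C p (S \<union> S') \<and> J W \<le> J (S \<union> S')" by blast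
qed

section \<open>Clusters and the invariant of merging\<close>

definition par :: "nat \<Rightarrow> nat" where
  "par c = (THE p. p < n \<and> d c p = 1 \<and> d 0 c = d 0 p + 1)"

lemma par:
  assumes "c < n" "c \<noteq> 0"
  shows "par c < n" "d c (par c) = 1" "d 0 c = d 0 (par c) + 1"
    "\<lbrakk>p < n; d c p = 1; d 0 c = d 0 p + 1\<rbrakk> \<Longrightarrow> p = par c"
proof -
  have "\<exists>!p. p < n \<and> d c p = 1 \<and> d 0 c = d 0 p + 1"
    using parent_exists[OF assms] parent_unique[OF assms(1)] by blast
  from theI'[OF this] show *: "par c < n" "d c (par c) = 1" "d 0 c = d 0 (par c) + 1"
    unfolding par_def by auto
  show "p = par c" if "p < n" "d c p = 1" "d 0 c = d 0 p + 1"
    by (rule parent_unique[OF assms(1) that(1) *(1) that(2,3) *(2,3)])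
qed

definition cl :: "(nat \<Rightarrow> nat) \<Rightarrow> nat \<Rightarrow> nat set" where
  "cl rep v = {u. u < n \<and> rep u = v}"

definition stp :: "int \<Rightarrow> nat \<Rightarrow> (nat \<Rightarrow> nat) \<times> (nat \<Rightarrow> nat set list) \<Rightarrow> (nat \<Rightarrow> nat) \<times> (nat \<Rightarrow> nat set list)" where
  "stp k c st = (let p = par c; rep' = (\<lambda>u. if fst st u = c then p else fst st u) in
     (rep', (snd st)(p := mrg k (cl rep' p) p (snd st p) (snd st c))))"

text \<open>\<open>D\<close> contains the vertices already merged into their parents,
  \<open>fst st u\<close> is the root of the cluster of \<open>u\<close>, and clusters are closed
  under paths to their roots. The last conjunct asks for some optimal set, the same for all clusters
  at one time but possibly another one after the next step.\<close>

definition Inv :: "int \<Rightarrow> nat \<Rightarrow> nat set \<Rightarrow> (nat \<Rightarrow> nat) \<times> (nat \<Rightarrow> nat set list) \<Rightarrow> bool" where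
  "Inv k Nb D st \<longleftrightarrow> (\<forall>u<n. fst st u < n \<and> fst st u \<notin> D \<and> btw 0 (fst st u) u \<and> (fst st u = u \<longleftrightarrow> u \<notin> D)
       \<and> (\<forall>x<n. btw (fst st u) x u \<longrightarrow> fst st x = fst st u)) \<and>
     (\<forall>v<n. v \<notin> D \<longrightarrow> hang (cl (fst st) v) v \<and> (\<forall>S\<in>set (snd st v). S \<subseteq> cl (fst st) v) \<and> length (snd st v) \<le> Nb) \<and>
     ((\<exists>S\<subseteq>{..<n}. int (card S) = k) \<longrightarrow> (\<exists>S. optimal k S \<and> (\<forall>v<n. v \<notin> D \<longrightarrow> S \<inter> cl (fst st) v \<in> set (snd st v))))"

lemma optimal_exists:
  assumes "\<exists>S\<subseteq>{..<n}. int (card S) = k"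
  shows "\<exists>S. optimal k S"
proof -
  let ?F = "{S. S \<subseteq> {..<n} \<and> int (card S) = k}"
  have "finite ?F" by (rule finite_subset[of _ "Pow {..<n}"]) auto
  moreover have "?F \<noteq> {}" using assms by blast
  ultimately obtain S where "is_arg_min J (\<lambda>S. S \<in> ?F) S" using ex_is_arg_min_if_finite[of ?F J] by blast
  then show ?thesis unfolding is_arg_min_linorder optimal_def by auto
qed

definition st0 :: "(nat \<Rightarrow> nat) \<times> (nat \<Rightarrow> nat set list)" where
  "st0 = (\<lambda>u. u, \<lambda>v. [{v}, {}])"

lemma Inv_init: "2 \<le> Nb \<Longrightarrow> Inv k Nb {} st0"
proof -
  assume Nb: "2 \<le> Nb"
  have c: "cl (\<lambda>u. u) v = {v}" if "v < n" for v using that by (auto simp: cl_def)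
  have 1: "x = u" if "u < n" "x < n" "btw u x u" for u x
    using that d_zero[of u x] by (simp add: btw_def)
  have 2: "hang {v} v" if "v < n" for v using that btw_self by (auto simp: hang_def)
  have 3: "S \<inter> {v} \<in> set [{v}, {}]" for S :: "nat set" and v by auto
  have "\<exists>S. optimal k S \<and> (\<forall>v<n. v \<notin> {} \<longrightarrow> S \<inter> cl (\<lambda>u. u) v \<in> set [{v}, {}])"
    if "\<exists>S\<subseteq>{..<n}. int (card S) = k"
    using optimal_exists[OF that] 3 c by metis
  moreover have "\<forall>v<n. v \<notin> {} \<longrightarrow> hang (cl (\<lambda>u. u) v) v \<and> (\<forall>S\<in>set [{v}, {}]. S \<subseteq> cl (\<lambda>u. u) v) \<and> length [{v}, {}] \<le> Nb"
    using 2 c Nb by simp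
  moreover have "\<forall>u<n. u < n \<and> u \<notin> {} \<and> btw 0 u u \<and> (u = u \<longleftrightarrow> u \<notin> {}) \<and> (\<forall>x<n. btw u x u \<longrightarrow> x = u)"
    using 1 btw_self n_pos by blast
  ultimately show ?thesis unfolding Inv_def st0_def fst_conv snd_conv by blast
qed

text \<open>As \<open>c\<close> is among the deepest vertices left, its cluster is everything below
  it, so joining it to the parent's cluster creates no second exit. The optimal set is exchanged
  inside the new cluster for the representative kept by \<open>mrg\<close>.\<close>

lemma Inv_step:
  assumes inv: "Inv k Nb D st" and c: "c < n" "c \<noteq> 0" "c \<notin> D" "\<forall>u\<in>D. d 0 c \<le> d 0 u"
    "\<forall>u<n. d 0 c < d 0 u \<longrightarrow> u \<in> D"
    and Nb: "\<And>C p R. C \<subseteq> {..<n} \<Longrightarrow> p < n \<Longrightarrow> Good k C p R \<Longrightarrow> length R \<le> Nb"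
  shows "Inv k Nb (insert c D) (stp k c st)"
    "hang (cl (fst (stp k c st)) (par c)) (par c)"
    "\<forall>S\<in>set (snd st (par c)) \<union> set (snd st c). S \<subseteq> cl (fst (stp k c st)) (par c)"
    "length (snd st (par c)) \<le> Nb" "length (snd st c) \<le> Nb"
proof -
  obtain rep Ls where st: "st = (rep, Ls)" by force
  define p where "p = par c"
  define rep' where "rep' = (\<lambda>u. if rep u = c then p else rep u)"
  define C where "C = cl rep' p"
  have stp: "stp k c st = (rep', Ls(p := mrg k C p (Ls p) (Ls c)))"
    unfolding C_def rep'_def p_def stp_def st Let_def fst_conv snd_conv by (rule refl)
  note p = par(1-3)[OF c(1,2), folded p_def]
  note inv' = inv[unfolded Inv_def st fst_conv snd_conv]
  have inv1: "rep u < n \<and> rep u \<notin> D \<and> btw 0 (rep u) u \<and> (rep u = u \<longleftrightarrow> u \<notin> D) \<and> (\<forall>x<n. btw (rep u) x u \<longrightarrow> rep x = rep u)"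
    if "u < n" for u using conjunct1[OF inv'] that by blast
  have I: "rep u < n" "rep u \<notin> D" "btw 0 (rep u) u" "rep u = u \<longleftrightarrow> u \<notin> D" if "u < n" for u
    using inv1[OF that] by blast+
  have I3: "rep x = rep u" if "u < n" "x < n" "btw (rep u) x u" for u x
    using inv1[OF that(1)] that by blast
  have IL: "hang (cl rep v) v" "\<forall>S\<in>set (Ls v). S \<subseteq> cl rep v" "length (Ls v) \<le> Nb" if "v < n" "v \<notin> D" for v
    using conjunct1[OF conjunct2[OF inv']] that by blast+
  have pD: "p \<notin> D" using c(4) p(3) by force
  have pc: "p \<noteq> c" using p(3) by auto
  have repc: "rep c = c" "rep p = p" using I c p pD by auto
  have C: "C = cl rep c \<union> cl rep p" using pc by (auto simp: C_def cl_def rep'_def)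
  have CV: "C \<subseteq> {..<n}" by (auto simp: C_def cl_def)
  \<comment> \<open>The root \<open>?a\<close> of the cluster of \<open>w\<close> is at most as deep
    as \<open>c\<close>. If it lies on the path from \<open>c\<close> to \<open>0\<close>, then
    \<open>c\<close> is on the path from \<open>?a\<close> to \<open>w\<close> and belongs to the
    same cluster; otherwise it is \<open>c\<close> by its depth.\<close>
  have below: "w \<in> cl rep c" if w: "w < n" "btw 0 c w" for w
  proof -
    let ?a = "rep w"
    have a: "?a < n" "?a \<notin> D" "btw 0 ?a w" using I w by auto
    then have da: "d 0 ?a \<le> d 0 c" using c(5) by (meson not_le)
    have "btw c ?a 0 \<or> btw c ?a w" using btw_T[of 0 w c ?a] a w n_pos c by auto
    then show ?thesis
    proof
      assume "btw c ?a 0"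
      then have "btw 0 ?a c" using btw_sym a c n_pos by blast
      then have "btw ?a c w" using btw_trans3[of 0 w c ?a] w a c n_pos by auto
      then have "rep c = ?a" using I3[OF w(1) c(1)] by simp
      then show ?thesis using repc w by (simp add: cl_def)
    next
      assume "btw c ?a w"
      then have "d c ?a = 0" using a(3) w(2) da by (auto simp: btw_def)
      then have "c = ?a" using d_zero a c by auto
      then show ?thesis using w by (simp add: cl_def)
    qed
  qed
  have via: "btw u c p" if "u \<in> cl rep c" for u
    using IL(1)[OF c(1,3)] that p(1) repc pc by (auto simp: hang_def cl_def)
  have pcs: "p \<in> C" using repc p by (simp add: C cl_def)
  have hang: "hang C p" unfolding hang_def
  proof (intro conjI ballI allI impI)
    fix u w assume uw: "u \<in> C" "w < n" "w \<notin> C"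
    show "btw u p w"
    proof (cases "u \<in> cl rep p")
      case True
      then show ?thesis using IL(1)[OF p(1) pD] uw by (auto simp: hang_def C)
    next
      case False
      then have u: "u \<in> cl rep c" "u < n" using uw by (auto simp: C cl_def)
      have "btw u c w" using IL(1)[OF c(1,3)] u uw by (auto simp: hang_def C)
      moreover have "\<not> btw 0 c w" using below uw by (auto simp: C)
      then have "d c w = d p w + 1" using not_below_via_parent[OF c(1) p(1) uw(2) p(2,3)] by simp
      ultimately show ?thesis using via[OF u(1)] p by (auto simp: btw_def)
    qed
  qed (use pcs CV in auto)
  have Lsub: "S \<subseteq> C" if "S \<in> set (Ls p) \<or> S \<in> set (Ls c)" for S
    using IL(2)[OF p(1) pD] IL(2)[OF c(1,3)] that by (auto simp: C)
  have clv: "cl rep' v = cl rep v" if "v \<noteq> p" "v \<noteq> c" for v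
    using that by (auto simp: cl_def rep'_def)
  show "hang (cl (fst (stp k c st)) (par c)) (par c)" using hang by (simp add: stp p_def C_def)
  show "\<forall>S\<in>set (snd st (par c)) \<union> set (snd st c). S \<subseteq> cl (fst (stp k c st)) (par c)"
    unfolding stp fst_conv p_def[symmetric] C_def[symmetric]
    unfolding st snd_conv using Lsub by blast
  show "length (snd st (par c)) \<le> Nb" "length (snd st c) \<le> Nb"
    using IL(3)[OF p(1) pD] IL(3)[OF c(1,3)] by (auto simp: st p_def)
  let ?L = "mrg k C p (Ls p) (Ls c)"
  have mg: "Good k C p ?L" using mrg_props(1)[of "Ls p" C "Ls c" k p] Lsub by auto
  have part1: "rep' u < n \<and> rep' u \<notin> insert c D \<and> btw 0 (rep' u) u \<and> (rep' u = u \<longleftrightarrow> u \<notin> insert c D)" if u: "u < n" for u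
  proof (cases "rep u = c")
    case True
    have "btw 0 c u" using I(3)[OF u] True by simp
    moreover have "btw 0 p c" using p d_sym[of c p] c by (auto simp: btw_def)
    ultimately have "btw 0 p u" using btw_trans1[of 0 u c p] u c p n_pos by auto
    moreover have "p \<noteq> u" using True repc pc by auto
    ultimately show ?thesis using True p pD pc I(4)[OF u] by (auto simp: rep'_def)
  next
    case False
    then have "u \<noteq> c" using repc by auto
    then show ?thesis using False I[OF u] by (auto simp: rep'_def)
  qed
  have part2: "rep' x = rep' u" if u: "u < n" and x: "x < n" "btw (rep' u) x u" for u x
  proof (cases "rep u = c")
    case True
    then have r: "rep' u = p" "u \<in> cl rep c" using u by (auto simp: rep'_def cl_def)
    have "btw c x p \<or> btw c x u" using btw_T[of p u c x] x r u c p by auto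
    then have "x = p \<or> btw c x u"
    proof
      assume "btw c x p"
      then have "d c x = 0 \<or> d x p = 0" using p by (auto simp: btw_def)
      then have "c = x \<or> x = p" using d_zero x c p by auto
      then show ?thesis using btw_self(1)[of c u] c u by auto
    qed auto
    then show ?thesis
    proof
      assume "x = p" then show ?thesis using r repc pc by (simp add: rep'_def)
    next
      assume "btw c x u"
      then have "rep x = c" using I3[OF u x(1)] True by simp
      then show ?thesis using r by (simp add: rep'_def)
    qed
  next
    case False
    then have "rep x = rep u" using I3[OF u x(1)] x(2) by (simp add: rep'_def)
    then show ?thesis by (simp add: rep'_def)
  qed
  have part3: "hang (cl rep' v) v \<and> (\<forall>S\<in>set ((Ls(p := ?L)) v). S \<subseteq> cl rep' v) \<and> length ((Ls(p := ?L)) v) \<le> Nb"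
    if v: "v < n" "v \<notin> insert c D" for v
  proof (cases "v = p")
    case True
    then show ?thesis using hang mg Nb[OF CV p(1) mg] by (auto simp: C_def[symmetric] Good_def)
  next
    case False
    then show ?thesis using clv[of v] v IL[of v] by auto
  qed
  have part4: "\<exists>S. optimal k S \<and> (\<forall>v<n. v \<notin> insert c D \<longrightarrow> S \<inter> cl rep' v \<in> set ((Ls(p := ?L)) v))"
    if ex: "\<exists>S\<subseteq>{..<n}. int (card S) = k"
  proof -
    obtain S where S: "optimal k S" "\<And>v. v < n \<Longrightarrow> v \<notin> D \<Longrightarrow> S \<inter> cl rep v \<in> set (Ls v)"
      using conjunct2[OF conjunct2[OF inv']] ex by blast
    have SV: "S \<subseteq> {..<n}" "int (card S) = k" "finite S" using S(1) optimal_finite[OF S(1)] by (auto simp: optimal_def)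
    define U where "U = S \<inter> C"
    have U: "U = (S \<inter> cl rep p) \<union> (S \<inter> cl rep c)" by (auto simp: U_def C)
    have "okf k C p U" unfolding okf_def
    proof (intro conjI ballI impI)
      show "int (card U) \<le> k" using SV card_mono[of S U] by (auto simp: U_def)
      fix u assume u: "u \<in> C" "conn U p u"
      then have un: "u < n" using CV by auto
      show "real (d p u) * of_int k ^ 3 \<le> 21 * real n ^ 3"
      proof (cases "0 < k")
        case True
        \<comment> \<open>By convexity of \<open>C\<close>, deletions outside cannot separate
          \<open>p\<close> from \<open>u\<close>; thus the diameter bound for the whole of
          \<open>S\<close> can be applied.\<close>
        have "conn S p u" unfolding conn_def
        proof safe
          fix s assume s: "s \<in> S" "btw p s u"
          then have "s \<in> C" using hang_convex[OF hang pcs u(1), of s] SV by auto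
          then show False using s u(2) by (auto simp: U_def conn_def)
        qed
        then show ?thesis using optimal_diameter[OF S(1) True p(1) un] by simp
      next
        case False
        \<comment> \<open>Here the bound in \<open>okf\<close> is void, since both sides were
          multiplied by \<open>k ^ 3\<close>.\<close>
        then have "k = 0" using SV by auto
        then show ?thesis by simp
      qed
    qed
    then obtain W where W: "W \<in> set ?L" "sig C p W = sig C p U" "J W \<le> J U"
      using mrg_props(2)[of "Ls p" C "Ls c" "S \<inter> cl rep p" "S \<inter> cl rep c" k p] Lsub S(2)[OF p(1) pD] S(2)[OF c(1,3)]
      unfolding U[symmetric] by auto
    have WC: "W \<subseteq> C" using W(1) mg by (auto simp: Good_def)
    \<comment> \<open>By \<open>dominate\<close> this set is no worse than \<open>S\<close>, and the
      signature fixes its size; so it is optimal too and becomes the new witness.\<close>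
    define S' where "S' = (S - C) \<union> W"
    have finW: "finite W" using WC CV finite_subset by (meson finite_lessThan)
    have "J S' \<le> J ((S - C) \<union> U)"
      unfolding S'_def using W WC SV by (intro dominate[OF hang]) (auto simp: U_def sig_def)
    moreover have "(S - C) \<union> U = S" by (auto simp: U_def)
    moreover have "card S' = card S"
    proof -
      have "card S' = card (S - C) + card W" unfolding S'_def
        by (rule card_Un_disjoint) (use SV finW WC in auto)
      also have "card W = card U" using W(2) by (simp add: sig_def)
      also have "card (S - C) + card U = card ((S - C) \<union> U)" unfolding U_def
        by (rule card_Un_disjoint[symmetric]) (use SV in auto)
      also have "(S - C) \<union> U = S" by (auto simp: U_def)
      finally show ?thesis .
    qed
    ultimately have opt: "optimal k S'"
      using S(1) WC CV SV unfolding optimal_def S'_def by (metis Diff_subset Un_least order_trans)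
    have "S' \<inter> cl rep' v \<in> set ((Ls(p := ?L)) v)" if v: "v < n" "v \<notin> insert c D" for v
    proof (cases "v = p")
      case True
      have "S' \<inter> C = W" using WC by (auto simp: S'_def)
      then show ?thesis using True W by (simp add: C_def)
    next
      case False
      have "C \<inter> cl rep v = {}" using False v by (auto simp: C cl_def)
      then have "S' \<inter> cl rep v = S \<inter> cl rep v" using WC by (auto simp: S'_def)
      then show ?thesis using False v clv[of v] S(2)[of v] by auto
    qed
    with opt show ?thesis by blast
  qed
  show "Inv k Nb (insert c D) (stp k c st)"
    unfolding Inv_def stp fst_conv snd_conv using part1 part2 part3 part4 by blast
qed

text \<open>The vertices treated before \<open>c\<close> in the round for depth \<open>l\<close>: by
  decreasing depth, and by increasing index within one depth. The root is never merged.\<close>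

definition dead :: "nat \<Rightarrow> nat \<Rightarrow> nat set" where
  "dead l c = {u. u < n \<and> u \<noteq> 0 \<and> (l < d 0 u \<or> d 0 u = l \<and> u < c)}"

lemma dead_init: "dead (n - 1) 0 = {}"
proof -
  have "\<not> n - Suc 0 < d 0 u" if "u < n" for u using d_less[OF n_pos that] by simp
  then show ?thesis by (auto simp: dead_def)
qed

lemma dead_next: "0 < l \<Longrightarrow> dead l n = dead (l - 1) 0"
  by (auto simp: dead_def)

lemma dead_Suc: "c < n \<Longrightarrow> dead l (Suc c) = (if 0 < l \<and> d 0 c = l then insert c (dead l c) else dead l c)"
proof -
  assume "c < n"
  then have "d 0 c = 0 \<longleftrightarrow> c = 0" using d_zero[of 0 c] n_pos by auto
  then show ?thesis using \<open>c < n\<close> by (auto simp: dead_def less_Suc_eq)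
qed

text \<open>Only the root is left, so its cluster is everything and its list contains an optimal
  set. A threshold is met by some set of size \<open>k\<close> if and only if it is met by an
  optimal one.\<close>

lemma Inv_final:
  assumes "Inv k Nb (dead 0 0) st"
  shows "(\<exists>S\<in>set (snd st 0). int (card S) = k \<and> J S \<le> t) \<longleftrightarrow> (\<exists>S\<subseteq>{..<n}. int (card S) = k \<and> J S \<le> t)"
proof -
  have "0 < d 0 u" if "u < n" "u \<noteq> 0" for u using d_zero[OF n_pos that(1)] that(2) by simp
  then have D: "dead 0 0 = {1..<n}" by (auto simp: dead_def)
  note inv = assms[unfolded Inv_def D]
  have "fst st u = 0" if "u < n" for u
  proof -
    have "fst st u < n \<and> fst st u \<notin> {1..<n}" using conjunct1[OF inv] that by blast
    then show ?thesis by auto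
  qed
  then have c: "cl (fst st) 0 = {..<n}" by (auto simp: cl_def)
  have 0: "0 \<notin> {1..<n}" by auto
  then have s: "\<forall>S\<in>set (snd st 0). S \<subseteq> {..<n}" using conjunct1[OF conjunct2[OF inv]] n_pos unfolding c[symmetric] by blast
  have "\<exists>S\<in>set (snd st 0). int (card S) = k \<and> J S \<le> t" if ex: "\<exists>S\<subseteq>{..<n}. int (card S) = k \<and> J S \<le> t"
  proof -
    obtain S where S: "S \<subseteq> {..<n}" "int (card S) = k" "J S \<le> t" using ex by blast
    then obtain S' where S': "optimal k S'" "S' \<inter> cl (fst st) 0 \<in> set (snd st 0)"
      using conjunct2[OF conjunct2[OF inv]] 0 n_pos by blast
    have "S' \<subseteq> {..<n}" "int (card S') = k" "J S' \<le> J S" using S'(1) S unfolding optimal_def by blast+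
    moreover from this have "S' \<in> set (snd st 0)" using S'(2) unfolding c by (simp add: Int_absorb2)
    ultimately show ?thesis using S(3) by force
  qed
  with s show ?thesis by blast
qed

text \<open>Distinct signatures force distinct sets, and a set of at most \<open>k\<close> vertices
  is the set of entries of a list of length \<open>k\<close> over \<open>{..n}\<close>, where the
  entry \<open>n\<close> serves as padding.\<close>

lemma Good_length1:
  assumes "C \<subseteq> {..<n}" "Good k C p R"
  shows "length R \<le> (n + 1) ^ nat k"
proof (cases "k < 0")
  case True
  then have "R = []" using assms by (cases R) (auto simp: Good_def okf_def)
  then show ?thesis by simp
next
  case False
  define F where "F = (\<lambda>xs. set xs \<inter> {..<n}) ` {xs. set xs \<subseteq> {..n} \<and> length xs = nat k}"
  have fin: "finite F" unfolding F_def by (intro finite_imageI finite_lists_length_eq) simp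
  have "S \<in> F" if "S \<in> set R" for S
  proof -
    have S: "S \<subseteq> {..<n}" "card S \<le> nat k" using that assms False by (auto simp: Good_def okf_def)
    then have "finite S" using finite_subset by blast
    then obtain xs where xs: "set xs = S" "length xs = card S" using finite_distinct_list distinct_card by metis
    let ?ys = "xs @ replicate (nat k - card S) n"
    have "set ?ys \<inter> {..<n} = S" "set ?ys \<subseteq> {..n}" "length ?ys = nat k" using S xs by auto
    then show ?thesis unfolding F_def by (intro image_eqI[of _ _ ?ys]) auto
  qed
  then have "card (set R) \<le> card F" using fin by (intro card_mono) auto
  moreover have "distinct R" using assms by (simp add: Good_def distinct_map)
  moreover have "card F \<le> card {xs. set xs \<subseteq> {..n} \<and> length xs = nat k}"
    unfolding F_def by (intro card_image_le finite_lists_length_eq) simp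
  moreover have "\<dots> = (n + 1) ^ nat k" by (subst card_lists_length_eq) auto
  ultimately show ?thesis by (simp add: distinct_card)
qed

text \<open>Counts signatures: a size up to \<open>n\<close> gives one factor \<open>n + 1\<close>,
  and a profile with distances up to \<open>D\<close> has \<open>D + 1\<close> digits in base
  \<open>n + 1\<close>.\<close>

lemma Good_length2:
  assumes "C \<subseteq> {..<n}" "p < n" "Good k C p R" "0 < k" "21 * real n ^ 3 < (real D + 1) * of_int k ^ 3"
  shows "length R \<le> (n + 1) ^ (D + 2)"
proof -
  have finC: "finite C" using assms finite_subset by blast
  have "sig C p S \<in> {..n} \<times> {..<(n + 1) ^ (D + 1)}" if "S \<in> set R" for S
  proof -
    have S: "okf k C p S" "S \<subseteq> {..<n}" using that assms by (auto simp: Good_def)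
    have "card S \<le> n" using card_mono[OF _ S(2)] by simp
    have dD: "d p u \<le> D" if "u \<in> C" "conn S p u" for u
    proof -
      have "real (d p u) * of_int k ^ 3 < (real D + 1) * of_int k ^ 3"
      proof (rule le_less_trans[OF _ assms(5)])
        show "real (d p u) * of_int k ^ 3 \<le> 21 * real n ^ 3" using S(1) that unfolding okf_def by blast
      qed
      then have "real (d p u) < real D + 1" using assms(4) by (simp add: mult_less_cancel_right)
      then show ?thesis by linarith
    qed
    have "prof C p S \<le> (\<Sum>u\<in>{u \<in> C. conn S p u}. (n + 1) ^ D)"
      unfolding prof_def by (rule sum_mono) (use dD in \<open>auto intro!: power_increasing\<close>)
    also have "\<dots> = card {u \<in> C. conn S p u} * (n + 1) ^ D" by simp
    also have "\<dots> \<le> card {..<n} * (n + 1) ^ D" using assms(1) finC by (intro mult_right_mono card_mono) auto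
    also have "\<dots> < (n + 1) ^ (D + 1)" by simp
    finally show ?thesis using \<open>card S \<le> n\<close> by (simp add: sig_def)
  qed
  then have "sig C p ` set R \<subseteq> {..n} \<times> {..<(n + 1) ^ (D + 1)}" by blast
  then have "card (sig C p ` set R) \<le> card ({..n} \<times> {..<(n + 1) ^ (D + 1)})" by (intro card_mono) auto
  moreover have "card (sig C p ` set R) = length R"
    using assms(3) by (metis Good_def distinct_card length_map list.set_map)
  ultimately show ?thesis by (simp add: card_cartesian_product)
qed

end


section \<open>Expressions and their compilation\<close>

datatype bop = Pl | Mi | Ti | Dv

fun bopv :: "bop \<Rightarrow> real \<Rightarrow> real \<Rightarrow> real" where
  "bopv Pl a b = a + b" | "bopv Mi a b = a - b" | "bopv Ti a b = a * b" | "bopv Dv a b = a / b"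

fun binstr :: "bop \<Rightarrow> nat \<Rightarrow> nat \<Rightarrow> nat \<Rightarrow> instr" where
  "binstr Pl = Add" | "binstr Mi = Sub" | "binstr Ti = Mul" | "binstr Dv = Div"

text \<open>With sums and case distinctions inside expressions, connection tests, \<open>J\<close>
  and profiles become formulas, verified by evaluation and not by loop invariants.\<close>

datatype aexp = V nat | C int | Bin bop aexp aexp | Mat aexp aexp
  | Ite aexp aexp aexp aexp | Sm nat aexp

definition cell :: "nat \<Rightarrow> nat \<Rightarrow> nat \<Rightarrow> nat" where
  "cell n i j = i * n + j"

fun ev :: "aexp \<Rightarrow> (nat \<Rightarrow> real) \<Rightarrow> (nat \<Rightarrow> real) \<Rightarrow> real" where
  "ev (V x) r m = r x"
| "ev (C c) r m = of_int c"
| "ev (Bin f a b) r m = bopv f (ev a r m) (ev b r m)"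
| "ev (Mat a b) r m = m (cell (nat \<lfloor>r 0\<rfloor>) (nat \<lfloor>ev a r m\<rfloor>) (nat \<lfloor>ev b r m\<rfloor>))"
| "ev (Ite a b c d) r m = (if ev a r m < ev b r m then ev c r m else ev d r m)"
| "ev (Sm x e) r m = (\<Sum>i<nat \<lfloor>r 0\<rfloor>. ev e (r(x := real i)) m)"

text \<open>Excludes everything that would block the machine; \<open>M\<close> bounds the addresses,
  hence the space, and \<open>N\<close> the length of a sum, hence the time. In \<open>Ite\<close>
  only the branch taken has to be safe, so a test can guard a division.\<close>

fun safe :: "nat \<Rightarrow> nat \<Rightarrow> aexp \<Rightarrow> (nat \<Rightarrow> real) \<Rightarrow> (nat \<Rightarrow> real) \<Rightarrow> bool" where
  "safe M N (V x) r m \<longleftrightarrow> True"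
| "safe M N (C c) r m \<longleftrightarrow> True"
| "safe M N (Bin f a b) r m \<longleftrightarrow> safe M N a r m \<and> safe M N b r m \<and> (f = Dv \<longrightarrow> ev b r m \<noteq> 0)"
| "safe M N (Mat a b) r m \<longleftrightarrow> safe M N a r m \<and> safe M N b r m \<and> r 0 \<in> \<nat> \<and> ev a r m \<in> \<nat> \<and> ev b r m \<in> \<nat>
     \<and> cell (nat \<lfloor>r 0\<rfloor>) (nat \<lfloor>ev a r m\<rfloor>) (nat \<lfloor>ev b r m\<rfloor>) < M"
| "safe M N (Ite a b c d) r m \<longleftrightarrow> safe M N a r m \<and> safe M N b r m
     \<and> (if ev a r m < ev b r m then safe M N c r m else safe M N d r m)"
| "safe M N (Sm x e) r m \<longleftrightarrow> r 0 \<in> \<nat> \<and> nat \<lfloor>r 0\<rfloor> \<le> N \<and> (\<forall>i<nat \<lfloor>r 0\<rfloor>. safe M N e (r(x := real i)) m)"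

fun cost :: "nat \<Rightarrow> aexp \<Rightarrow> nat" where
  "cost N (V x) = 2"
| "cost N (C c) = 1"
| "cost N (Bin f a b) = cost N a + cost N b + 1"
| "cost N (Mat a b) = cost N a + cost N b + 3"
| "cost N (Ite a b c d) = cost N a + cost N b + cost N c + cost N d + 2"
| "cost N (Sm x e) = N * (cost N e + 5) + 4"

text \<open>\<open>K\<close> separates the registers named by a program from the temporaries of the compiler. A summation
  variable must not be in \<open>B\<close>, the set of registers whose contents are still needed.\<close>

fun wf_aexp :: "nat \<Rightarrow> nat set \<Rightarrow> aexp \<Rightarrow> bool" where
  "wf_aexp K B (V x) \<longleftrightarrow> x \<in> B"
| "wf_aexp K B (C c) \<longleftrightarrow> True"
| "wf_aexp K B (Bin f a b) \<longleftrightarrow> wf_aexp K B a \<and> wf_aexp K B b"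
| "wf_aexp K B (Mat a b) \<longleftrightarrow> wf_aexp K B a \<and> wf_aexp K B b"
| "wf_aexp K B (Ite a b c d) \<longleftrightarrow> wf_aexp K B a \<and> wf_aexp K B b \<and> wf_aexp K B c \<and> wf_aexp K B d"
| "wf_aexp K B (Sm x e) \<longleftrightarrow> x \<notin> B \<and> x < K \<and> wf_aexp K (insert x B) e"

lemma ev_cong:
  assumes "wf_aexp K B e" "0 \<in> B" "\<forall>x\<in>B. r' x = r x"
  shows "ev e r' m = ev e r m"
  using assms
proof (induction e arbitrary: B r r')
  case (Sm x e)
  have "ev e (r'(x := real i)) m = ev e (r(x := real i)) m" for i
    by (rule Sm.IH[of "insert x B"]) (use Sm.prems in auto)
  with Sm.prems show ?case by auto
next
  case (Mat a b)
  have "ev a r' m = ev a r m" "ev b r' m = ev b r m" "r' 0 = r 0"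
    using Mat.IH[of B r' r] Mat.prems by auto
  then show ?case by simp
next
  case (Bin f a b)
  then show ?case using Bin.IH[of B r' r] by auto
next
  case (Ite a b c d)
  then show ?case using Ite.IH[of B r' r] by auto
qed auto

lemma safe_cong:
  assumes "wf_aexp K B e" "0 \<in> B" "\<forall>x\<in>B. r' x = r x"
  shows "safe M N e r' m = safe M N e r m"
  using assms
proof (induction e arbitrary: B r r')
  case (Sm x e)
  have "safe M N e (r'(x := real i)) m = safe M N e (r(x := real i)) m" for i
    by (rule Sm.IH[of "insert x B"]) (use Sm.prems in auto)
  with Sm.prems show ?case by auto
next
  case (Mat a b)
  have "ev a r' m = ev a r m" "ev b r' m = ev b r m" "r' 0 = r 0"
    using ev_cong[of K B _ r' r] Mat.prems by auto
  then show ?case using Mat.IH[of B r' r] Mat.prems by auto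
next
  case (Bin f a b)
  have "ev b r' m = ev b r m"
    using ev_cong[of K B _ r' r] Bin.prems by auto
  with Bin show ?case using Bin.IH[of B r' r] by auto
next
  case (Ite a b c d)
  have "ev a r' m = ev a r m" "ev b r' m = ev b r m"
    using ev_cong[of K B _ r' r] Ite.prems by auto
  with Ite show ?case using Ite.IH[of B r' r] by auto
qed auto

fun len :: "aexp \<Rightarrow> nat" where
  "len (V x) = 2"
| "len (C c) = 1"
| "len (Bin f a b) = len a + len b + 1"
| "len (Mat a b) = len a + len b + 3"
| "len (Ite a b c d) = len a + len b + len c + len d + 2"
| "len (Sm x e) = len e + 8"

text \<open>The result goes to register \<open>k\<close>, and the registers from \<open>K\<close> to
  \<open>k - 1\<close> hold pending operands, as on a stack. The position \<open>p\<close> is passed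
  along because jumps are absolute. \<open>V x\<close> copies by adding to \<open>0\<close>, as
  there is no move instruction.\<close>

fun compile :: "aexp \<Rightarrow> nat \<Rightarrow> nat \<Rightarrow> instr list" where
  "compile (V x) k p = [Const k 0, Add k k x]"
| "compile (C c) k p = [Const k c]"
| "compile (Bin f a b) k p = compile a k p @ compile b (Suc k) (p + len a) @ [binstr f k k (Suc k)]"
| "compile (Mat a b) k p = compile a k p @ compile b (Suc k) (p + len a) @ [Mul k k 0, Add k k (Suc k), Load k k]"
| "compile (Ite a b c d) k p = compile a k p @ compile b (Suc k) (p + len a)
     @ [Jump_Less k (Suc k) (p + len a + len b + len d + 2)]
     @ compile d k (p + len a + len b + 1)
     @ [Jump (p + len a + len b + len d + len c + 2)]
     @ compile c k (p + len a + len b + len d + 2)"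
| "compile (Sm x e) k p = [Const x 0, Const k 0, Jump_Less x 0 (p + 4), Jump (p + len e + 8)]
     @ compile e (Suc k) (p + 4)
     @ [Add k k (Suc k), Const (Suc k) 1, Add x x (Suc k), Jump (p + 2)]"

lemma length_compile [simp]: "length (compile e k p) = len e"
  by (induction e arbitrary: k p) auto

section \<open>Executions of compiled code\<close>

definition code_at :: "instr list \<Rightarrow> nat \<Rightarrow> instr list \<Rightarrow> bool" where
  "code_at P p c \<longleftrightarrow> (\<forall>i<length c. p + i < length P \<and> P ! (p + i) = c ! i)"

lemma code_at_Nil [simp]: "code_at P p []"
  by (simp add: code_at_def)

lemma code_at_Cons [simp]: "code_at P p (i # c) \<longleftrightarrow> p < length P \<and> P ! p = i \<and> code_at P (Suc p) c"
proof -
  have "code_at P p (i # c) \<longleftrightarrow> (\<forall>j<Suc (length c). p + j < length P \<and> P ! (p + j) = (i # c) ! j)"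
    by (simp add: code_at_def)
  also have "\<dots> \<longleftrightarrow> p < length P \<and> P ! p = i \<and> code_at P (Suc p) c"
    unfolding All_less_Suc2 code_at_def by simp
  finally show ?thesis .
qed

lemma code_at_append [simp]:
  "code_at P p (c @ c') \<longleftrightarrow> code_at P p c \<and> code_at P (p + length c) c'"
  by (induction c arbitrary: p) auto

lemma code_at_self: "code_at (c @ c') 0 c"
  by (auto simp: code_at_def nth_append)

inductive steps :: "instr list \<Rightarrow> nat \<Rightarrow> config \<Rightarrow> nat \<Rightarrow> config \<Rightarrow> bool" for P M where
  steps_refl: "steps P M c 0 c"
| steps_step: "\<lbrakk>pc < length P; exec (P ! pc) (pc, r, m) = Some c';
     accessed (P ! pc) (pc, r, m) \<subseteq> {..<M}; steps P M c' t c''\<rbrakk> \<Longrightarrow> steps P M (pc, r, m) (Suc t) c''"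

lemma steps_trans: "steps P M c t c' \<Longrightarrow> steps P M c' t' c'' \<Longrightarrow> steps P M c (t + t') c''"
  by (induction rule: steps.induct) (auto intro: steps.intros)

lemma steps_runs:
  assumes "steps P M c t c'" "c' = (pc, r, m)" "pc < length P" "P ! pc = Halt b"
  shows "\<exists>A. runs P c b (Suc t) A \<and> A \<subseteq> {..<M}"
  using assms
proof (induction rule: steps.induct)
  case (steps_refl c)
  then show ?case using runs.halt[of pc P b r m] by auto
next
  case (steps_step pc r m c' t c'')
  then show ?case using runs.step[of pc P r m c' b] by (metis Un_least)
qed

definition reach :: "instr list \<Rightarrow> nat \<Rightarrow> config \<Rightarrow> nat \<Rightarrow> config \<Rightarrow> bool" where
  "reach P M c T c' \<longleftrightarrow> (\<exists>t\<le>T. steps P M c t c')"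

lemma reach_trans: "reach P M c T c' \<Longrightarrow> reach P M c' T' c'' \<Longrightarrow> reach P M c (T + T') c''"
  unfolding reach_def using steps_trans by (meson add_mono)

lemma reach_weaken: "reach P M c T c' \<Longrightarrow> T \<le> T' \<Longrightarrow> reach P M c T' c'"
  unfolding reach_def by (meson order_trans)

lemma reach_refl: "reach P M c T c"
  unfolding reach_def using steps_refl by blast

lemma reach_1:
  assumes "pc < length P" "exec (P ! pc) (pc, r, m) = Some c'" "accessed (P ! pc) (pc, r, m) \<subseteq> {..<M}"
  shows "reach P M (pc, r, m) 1 c'"
  unfolding reach_def using steps_step[OF assms steps_refl] by auto

lemma reach_Cons:
  assumes "pc < length P" "exec (P ! pc) (pc, r, m) = Some c'" "accessed (P ! pc) (pc, r, m) \<subseteq> {..<M}"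
    "reach P M c' T c''"
  shows "reach P M (pc, r, m) (Suc T) c''"
  using reach_trans[OF reach_1[OF assms(1-3)] assms(4)] by simp

lemma Nats_cell:
  assumes "(x::real) \<in> \<nat>" "a \<in> \<nat>" "b \<in> \<nat>"
  shows "a * x + b \<in> \<nat>" "nat \<lfloor>a * x + b\<rfloor> = cell (nat \<lfloor>x\<rfloor>) (nat \<lfloor>a\<rfloor>) (nat \<lfloor>b\<rfloor>)"
proof -
  from assms obtain i j k where "x = real i" "a = real j" "b = real k"
    by (auto simp: Nats_def)
  then show "a * x + b \<in> \<nat>" "nat \<lfloor>a * x + b\<rfloor> = cell (nat \<lfloor>x\<rfloor>) (nat \<lfloor>a\<rfloor>) (nat \<lfloor>b\<rfloor>)"
    by (auto simp: cell_def) (metis floor_of_nat nat_int of_nat_add of_nat_mult)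
qed

text \<open>The contract for subexpressions: besides the live registers in \<open>B\<close>, the
  operands pending below \<open>k\<close> have to survive.\<close>

definition agree :: "nat set \<Rightarrow> nat \<Rightarrow> nat \<Rightarrow> (nat \<Rightarrow> real) \<Rightarrow> (nat \<Rightarrow> real) \<Rightarrow> bool" where
  "agree B K k r' r \<longleftrightarrow> (\<forall>y. y \<in> B \<or> (K \<le> y \<and> y < k) \<longrightarrow> r' y = r y)"

lemma comp_correct:
  assumes "wf_aexp K B e" "0 \<in> B" "B \<subseteq> {..<K}" "K \<le> k" "safe M N e r m" "code_at P p (compile e k p)"
  shows "\<exists>r'. reach P M (p, r, m) (cost N e) (p + len e, r', m) \<and> r' k = ev e r m \<and> agree B K k r' r"
  using assms
proof (induction e arbitrary: B k p r)
  case (V x)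
  then have "x \<noteq> k" by auto
  define r1 where "r1 = r(k := r x)"
  have "reach P M (p, r, m) (Suc (Suc 0)) (p + 2, r1, m)"
    by (rule reach_Cons; (rule reach_Cons; (rule reach_refl)?)?) (use V \<open>x \<noteq> k\<close> in \<open>auto simp: r1_def\<close>)
  moreover have "agree B K k r1 r" "r1 k = r x" using V by (auto simp: agree_def r1_def)
  ultimately show ?case by (auto simp: numeral_2_eq_2)
next
  case (C c)
  define r1 where "r1 = r(k := of_int c)"
  have "reach P M (p, r, m) (Suc 0) (p + 1, r1, m)"
    by (rule reach_Cons; (rule reach_refl)?) (use C in \<open>auto simp: r1_def\<close>)
  moreover have "agree B K k r1 r" "r1 k = of_int c" using C by (auto simp: agree_def r1_def)
  ultimately show ?case by auto
next
  case (Bin f a b)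
  obtain r1 where r1: "reach P M (p, r, m) (cost N a) (p + len a, r1, m)" "r1 k = ev a r m" "agree B K k r1 r"
    using Bin.IH(1)[of B k r p] Bin.prems by auto
  have eq: "safe M N b r1 m = safe M N b r m" "ev b r1 m = ev b r m"
    using r1(3) Bin.prems safe_cong[of K B b r1 r] ev_cong[of K B b r1 r] by (simp_all add: agree_def)
  then obtain r2 where r2: "reach P M (p + len a, r1, m) (cost N b) (p + len a + len b, r2, m)"
    "r2 (Suc k) = ev b r m" "agree B K (Suc k) r2 r1"
    using Bin.IH(2)[of B "Suc k" r1 "p + len a"] Bin.prems by auto
  define r3 where "r3 = r2(k := bopv f (ev a r m) (ev b r m))"
  have "r2 k = ev a r m" using r1(2) r2(3) Bin.prems by (auto simp: agree_def)
  then have "reach P M (p + len a + len b, r2, m) 1 (p + len a + len b + 1, r3, m)"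
    using Bin.prems r2(2) by (intro reach_1; cases f) (auto simp: add.assoc r3_def)
  from reach_trans[OF reach_trans[OF r1(1) r2(1)] this]
  have "reach P M (p, r, m) (cost N (Bin f a b)) (p + len (Bin f a b), r3, m)" by (simp add: add.assoc)
  moreover have "agree B K k r3 r" "r3 k = ev (Bin f a b) r m"
    using r1(3) r2(3) Bin.prems by (auto simp: agree_def r3_def)
  ultimately show ?case by blast
next
  case (Mat a b)
  obtain r1 where r1: "reach P M (p, r, m) (cost N a) (p + len a, r1, m)" "r1 k = ev a r m" "agree B K k r1 r"
    using Mat.IH(1)[of B k r p] Mat.prems by auto
  have eq: "safe M N b r1 m = safe M N b r m" "ev b r1 m = ev b r m"
    using r1(3) Mat.prems safe_cong[of K B b r1 r] ev_cong[of K B b r1 r] by (simp_all add: agree_def)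
  then obtain r2 where r2: "reach P M (p + len a, r1, m) (cost N b) (p + len a + len b, r2, m)"
    "r2 (Suc k) = ev b r m" "agree B K (Suc k) r2 r1"
    using Mat.IH(2)[of B "Suc k" r1 "p + len a"] Mat.prems by auto
  have k0: "0 < K" "0 \<noteq> k" using Mat.prems by auto
  have r20: "r2 k = ev a r m" "r2 0 = r 0" using r1(2,3) r2(3) Mat.prems by (auto simp: agree_def)
  note cl = Nats_cell[of "r 0" "ev a r m" "ev b r m"]
  define r3 where "r3 = r2(k := ev (Mat a b) r m)"
  have "reach P M (p + len a + len b, r2, m) (Suc (Suc (Suc 0))) (p + len a + len b + 3, r3, m)"
    by (rule reach_Cons; (rule reach_Cons; (rule reach_Cons; (rule reach_refl)?)?)?)
       (use k0 Mat.prems r2(2) r20 cl in \<open>auto simp: add.assoc r3_def numeral_3_eq_3\<close>)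
  from reach_trans[OF reach_trans[OF r1(1) r2(1)] this]
  have "reach P M (p, r, m) (cost N (Mat a b)) (p + len (Mat a b), r3, m)"
    by (simp add: add.assoc numeral_3_eq_3)
  moreover have "agree B K k r3 r" "r3 k = ev (Mat a b) r m"
    using r1(3) r2(3) Mat.prems by (auto simp: agree_def r3_def)
  ultimately show ?case by blast
next
  case (Ite a b c d)
  obtain r1 where r1: "reach P M (p, r, m) (cost N a) (p + len a, r1, m)" "r1 k = ev a r m" "agree B K k r1 r"
    using Ite.IH(1)[of B k r p] Ite.prems by auto
  have eq: "safe M N b r1 m = safe M N b r m" "ev b r1 m = ev b r m"
    using r1(3) Ite.prems safe_cong[of K B b r1 r] ev_cong[of K B b r1 r] by (simp_all add: agree_def)
  then obtain r2 where r2: "reach P M (p + len a, r1, m) (cost N b) (p + len a + len b, r2, m)"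
    "r2 (Suc k) = ev b r m" "agree B K (Suc k) r2 r1"
    using Ite.IH(2)[of B "Suc k" r1 "p + len a"] Ite.prems by auto
  have r2k: "r2 k = ev a r m" using r1(2) r2(3) Ite.prems by (auto simp: agree_def)
  have ag: "agree B K k r2 r" using r1(3) r2(3) by (auto simp: agree_def)
  note start = reach_trans[OF r1(1) r2(1)]
  show ?case
  proof (cases "ev a r m < ev b r m")
    case True
    let ?q = "p + len a + len b + len d + 2"
    have j: "reach P M (p + len a + len b, r2, m) 1 (?q, r2, m)"
      using Ite.prems True r2k r2(2) by (intro reach_1) (auto simp: add.assoc)
    have eq: "safe M N c r2 m = safe M N c r m" "ev c r2 m = ev c r m"
      using ag Ite.prems safe_cong[of K B c r2 r] ev_cong[of K B c r2 r] by (simp_all add: agree_def)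
    then obtain r3 where r3: "reach P M (?q, r2, m) (cost N c) (?q + len c, r3, m)"
      "r3 k = ev c r m" "agree B K k r3 r2"
      using Ite.IH(3)[of B k r2 ?q] Ite.prems True by (auto simp: ac_simps)
    have "reach P M (p, r, m) (cost N (Ite a b c d)) (p + len (Ite a b c d), r3, m)"
      by (rule reach_weaken, rule back_subst[where P = "\<lambda>c. reach P M (p, r, m) _ c"],
          rule reach_trans[OF start reach_trans[OF j r3(1)]]) auto
    with r3 ag True show ?thesis by (intro exI[of _ r3]) (auto simp: agree_def)
  next
    case False
    let ?q = "p + len a + len b + 1"
    have j: "reach P M (p + len a + len b, r2, m) 1 (?q, r2, m)"
      using Ite.prems False r2k r2(2) by (intro reach_1) (auto simp: add.assoc)
    have eq: "safe M N d r2 m = safe M N d r m" "ev d r2 m = ev d r m"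
      using ag Ite.prems safe_cong[of K B d r2 r] ev_cong[of K B d r2 r] by (simp_all add: agree_def)
    then obtain r3 where r3: "reach P M (?q, r2, m) (cost N d) (?q + len d, r3, m)"
      "r3 k = ev d r m" "agree B K k r3 r2"
      using Ite.IH(4)[of B k r2 ?q] Ite.prems False by (auto simp: ac_simps)
    have j': "reach P M (?q + len d, r3, m) 1 (p + len a + len b + len d + len c + 2, r3, m)"
      using Ite.prems by (intro reach_1) (auto simp: ac_simps)
    have "reach P M (p, r, m) (cost N (Ite a b c d)) (p + len (Ite a b c d), r3, m)"
      by (rule reach_weaken, rule back_subst[where P = "\<lambda>c. reach P M (p, r, m) _ c"],
          rule reach_trans[OF start reach_trans[OF j reach_trans[OF r3(1) j']]]) auto
    with r3 ag False show ?thesis by (intro exI[of _ r3]) (auto simp: agree_def)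
  qed
next
  case (Sm x e)
  let ?n = "nat \<lfloor>r 0\<rfloor>"
  have r0: "r 0 = real ?n" "?n \<le> N" using Sm.prems by (auto simp: Nats_def)
  have x: "x \<notin> B" "x < K" "x \<noteq> k" "x \<noteq> Suc k" "0 \<noteq> x" "0 \<noteq> k" using Sm.prems by (auto intro!: gr0I)
  let ?e = "\<lambda>i. ev e (r(x := real i)) m"
  define ri where "ri = r(x := 0, k := 0)"
  have init: "reach P M (p, r, m) (Suc (Suc 0)) (p + 2, ri, m)"
    by (rule reach_Cons; (rule reach_Cons; (rule reach_refl)?)?) (use Sm.prems in \<open>auto simp: ri_def\<close>)
  have loop: "\<exists>r'. reach P M (p + 2, ri, m) (i * (cost N e + 5)) (p + 2, r', m)
      \<and> r' x = real i \<and> r' k = (\<Sum>j<i. ?e j) \<and> agree B K k r' r" if "i \<le> ?n" for i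
    using that
  proof (induction i)
    case 0
    have "agree B K k ri r" "ri x = 0" "ri k = 0" using x Sm.prems by (auto simp: agree_def ri_def)
    then show ?case using reach_refl by force
  next
    case (Suc i)
    then obtain r1 where r1: "reach P M (p + 2, ri, m) (i * (cost N e + 5)) (p + 2, r1, m)"
      "r1 x = real i" "r1 k = (\<Sum>j<i. ?e j)" "agree B K k r1 r" by (metis Suc_leD)
    have r10: "r1 0 = r 0" using r1(4) Sm.prems by (auto simp: agree_def)
    have j: "reach P M (p + 2, r1, m) 1 (p + 4, r1, m)"
      using Sm.prems r1(2) r10 Suc.prems r0 by (intro reach_1) auto
    define rxi where "rxi = r(x := real i)"
    \<comment> \<open>Inside the sum its variable is live. Using the induction hypothesis with
      \<open>insert x B\<close> also guarantees that \<open>e\<close> does not destroy the loop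
      counter.\<close>
    have ag: "\<forall>y\<in>insert x B. r1 y = rxi y" using r1 x by (auto simp: agree_def rxi_def)
    have eq: "safe M N e r1 m = safe M N e rxi m" "ev e r1 m = ev e rxi m"
      using Sm.prems safe_cong[of K "insert x B" e, OF _ _ ag] ev_cong[of K "insert x B" e, OF _ _ ag] by simp_all
    have "\<exists>r2. reach P M (p + 4, r1, m) (cost N e) (p + 4 + len e, r2, m)
       \<and> r2 (Suc k) = ev e r1 m \<and> agree (insert x B) K (Suc k) r2 r1"
    proof (rule Sm.IH)
      have "Suc (Suc (Suc (Suc p))) = p + 4" by simp
      moreover have "code_at P (Suc (Suc (Suc (Suc p)))) (compile e (Suc k) (p + 4))" using Sm.prems by simp
      ultimately show "code_at P (p + 4) (compile e (Suc k) (p + 4))" by (simp only:)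
    qed (use Sm.prems eq Suc.prems in \<open>auto simp: rxi_def\<close>)
    then obtain r2 where r2: "reach P M (p + 4, r1, m) (cost N e) (p + 4 + len e, r2, m)"
       "r2 (Suc k) = ?e i" "agree (insert x B) K (Suc k) r2 r1" using eq rxi_def by auto
    have r2': "r2 k = (\<Sum>j<i. ?e j)" "r2 x = real i" "agree B K k r2 r"
      using r2(3) r1 Sm.prems by (auto simp: agree_def)
    define r3 where "r3 = r2(k := r2 k + r2 (Suc k), Suc k := 1, x := r2 x + 1)"
    define q where "q = p + 4 + len e"
    have "q = Suc (Suc (Suc (Suc (p + len e))))" by (simp add: q_def)
    then have cd: "q < length P" "Suc q < length P" "Suc (Suc q) < length P" "Suc (Suc (Suc q)) < length P"
      "P ! q = Add k k (Suc k)" "P ! Suc q = Const (Suc k) 1" "P ! Suc (Suc q) = Add x x (Suc k)"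
      "P ! Suc (Suc (Suc q)) = Jump (Suc (Suc p))"
      using Sm.prems by simp_all
    have s1: "reach P M (q, r2, m) 1 (Suc q, r2(k := r2 k + r2 (Suc k)), m)"
      by (rule reach_1) (use cd in auto)
    have s2: "reach P M (Suc q, r2(k := r2 k + r2 (Suc k)), m) 1
        (Suc (Suc q), r2(k := r2 k + r2 (Suc k), Suc k := 1), m)"
      by (rule reach_1) (use cd in auto)
    have s3: "reach P M (Suc (Suc q), r2(k := r2 k + r2 (Suc k), Suc k := 1), m) 1 (Suc (Suc (Suc q)), r3, m)"
      by (rule reach_1) (use cd x in \<open>auto simp: r3_def\<close>)
    have s4: "reach P M (Suc (Suc (Suc q)), r3, m) 1 (p + 2, r3, m)"
      by (rule reach_1) (use cd in auto)
    from reach_trans[OF reach_trans[OF s1 s2] reach_trans[OF s3 s4]]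
    have "reach P M (p + 4 + len e, r2, m) (1 + 1 + (1 + 1)) (p + 2, r3, m)"
      by (simp only: q_def)
    from reach_trans[OF r1(1) reach_trans[OF j reach_trans[OF r2(1) this]]]
    have "reach P M (p + 2, ri, m) (Suc i * (cost N e + 5)) (p + 2, r3, m)"
      by (rule reach_weaken) auto
    moreover have "agree B K k r3 r" using r2'(3) x Sm.prems by (auto simp: agree_def r3_def)
    moreover have "r3 x = real (Suc i)" "r3 k = (\<Sum>j<Suc i. ?e j)" using x r2'(1,2) r2(2) by (auto simp: r3_def)
    ultimately show ?case by blast
  qed
  from loop[of ?n] obtain r1 where r1: "reach P M (p + 2, ri, m) (?n * (cost N e + 5)) (p + 2, r1, m)"
    "r1 x = real ?n" "r1 k = (\<Sum>j<?n. ?e j)" "agree B K k r1 r" by auto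
  have "r1 0 = r 0" using r1(4) Sm.prems by (auto simp: agree_def)
  then have "reach P M (Suc (Suc p), r1, m) 1 (Suc (Suc (Suc p)), r1, m)"
    by (intro reach_1) (use Sm.prems r1(2) r0 in auto)
  moreover have "reach P M (Suc (Suc (Suc p)), r1, m) 1 (p + len e + 8, r1, m)"
    by (intro reach_1) (use Sm.prems in auto)
  ultimately have "reach P M (p + 2, r1, m) (1 + 1) (p + len e + 8, r1, m)"
    using reach_trans by fastforce
  from reach_trans[OF init reach_trans[OF r1(1) this]]
  have "reach P M (p, r, m) (cost N (Sm x e)) (p + len (Sm x e), r1, m)"
  proof (rule back_subst[where P = "\<lambda>c. reach P M (p, r, m) _ c", OF reach_weaken])
    have "?n * (cost N e + 5) \<le> N * (cost N e + 5)" using r0(2) by (rule mult_right_mono) simp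
    then show "Suc (Suc 0) + (?n * (cost N e + 5) + (1 + 1)) \<le> cost N (Sm x e)" by simp
  qed auto
  with r1 show ?case by (intro exI[of _ r1]) auto
qed


section \<open>A while language\<close>

datatype com = Skip | Asg nat aexp | Sto aexp aexp aexp | Sq com com
  | Cond aexp aexp com com | Wh aexp aexp com

type_synonym state = "(nat \<Rightarrow> real) \<times> (nat \<Rightarrow> real)"

fun safes :: "nat \<Rightarrow> nat \<Rightarrow> aexp \<Rightarrow> state \<Rightarrow> bool" where
  "safes M N e (r, m) = safe M N e r m"

fun evs :: "aexp \<Rightarrow> state \<Rightarrow> real" where
  "evs e (r, m) = ev e r m"

inductive bs :: "nat \<Rightarrow> nat \<Rightarrow> com \<Rightarrow> state \<Rightarrow> nat \<Rightarrow> state \<Rightarrow> bool" for M N where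
  bs_Skip: "bs M N Skip s 0 s"
| bs_Asg: "safe M N e r m \<Longrightarrow> bs M N (Asg x e) (r, m) (cost N e + 2) (r(x := ev e r m), m)"
| bs_Sto: "\<lbrakk>safe M N (Mat a b) r m; safe M N e r m\<rbrakk> \<Longrightarrow>
    bs M N (Sto a b e) (r, m) (cost N a + cost N b + cost N e + 3)
      (r, m(cell (nat \<lfloor>r 0\<rfloor>) (nat \<lfloor>ev a r m\<rfloor>) (nat \<lfloor>ev b r m\<rfloor>) := ev e r m))"
| bs_Sq: "\<lbrakk>bs M N c1 s t1 s1; bs M N c2 s1 t2 s2\<rbrakk> \<Longrightarrow> bs M N (Sq c1 c2) s (t1 + t2) s2"
| bs_If1: "\<lbrakk>safes M N a s; safes M N b s; evs a s < evs b s; bs M N c1 s t s'\<rbrakk> \<Longrightarrow>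
    bs M N (Cond a b c1 c2) s (cost N a + cost N b + t + 2) s'"
| bs_If2: "\<lbrakk>safes M N a s; safes M N b s; \<not> evs a s < evs b s; bs M N c2 s t s'\<rbrakk> \<Longrightarrow>
    bs M N (Cond a b c1 c2) s (cost N a + cost N b + t + 2) s'"
| bs_Wh1: "\<lbrakk>safes M N a s; safes M N b s; \<not> evs a s < evs b s\<rbrakk> \<Longrightarrow>
    bs M N (Wh a b c) s (cost N a + cost N b + 2) s"
| bs_Wh2: "\<lbrakk>safes M N a s; safes M N b s; evs a s < evs b s; bs M N c s t s';
     bs M N (Wh a b c) s' t' s''\<rbrakk> \<Longrightarrow>
    bs M N (Wh a b c) s (cost N a + cost N b + 2 + t + t') s''"

fun lenc :: "com \<Rightarrow> nat" where
  "lenc Skip = 0"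
| "lenc (Asg x e) = len e + 2"
| "lenc (Sto a b e) = len a + len b + len e + 3"
| "lenc (Sq c1 c2) = lenc c1 + lenc c2"
| "lenc (Cond a b c1 c2) = len a + len b + lenc c1 + lenc c2 + 2"
| "lenc (Wh a b c) = len a + len b + lenc c + 3"

fun compc :: "nat \<Rightarrow> com \<Rightarrow> nat \<Rightarrow> instr list" where
  "compc K Skip p = []"
| "compc K (Asg x e) p = compile e K p @ [Const (Suc K) 0, Add x K (Suc K)]"
| "compc K (Sto a b e) p = compile a K p @ compile b (Suc K) (p + len a)
     @ compile e (Suc (Suc K)) (p + len a + len b) @ [Mul K K 0, Add K K (Suc K), Store K (Suc (Suc K))]"
| "compc K (Sq c1 c2) p = compc K c1 p @ compc K c2 (p + lenc c1)"
| "compc K (Cond a b c1 c2) p = compile a K p @ compile b (Suc K) (p + len a)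
     @ [Jump_Less K (Suc K) (p + len a + len b + lenc c2 + 2)]
     @ compc K c2 (p + len a + len b + 1)
     @ [Jump (p + len a + len b + lenc c2 + lenc c1 + 2)]
     @ compc K c1 (p + len a + len b + lenc c2 + 2)"
| "compc K (Wh a b c) p = compile a K p @ compile b (Suc K) (p + len a)
     @ [Jump_Less K (Suc K) (p + len a + len b + 2), Jump (p + len a + len b + lenc c + 3)]
     @ compc K c (p + len a + len b + 2) @ [Jump p]"

lemma length_compc [simp]: "length (compc K c p) = lenc c"
  by (induction c arbitrary: p) auto

fun wfc :: "nat \<Rightarrow> nat set \<Rightarrow> com \<Rightarrow> bool" where
  "wfc K B Skip \<longleftrightarrow> True"
| "wfc K B (Asg x e) \<longleftrightarrow> x \<in> B \<and> wf_aexp K B e"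
| "wfc K B (Sto a b e) \<longleftrightarrow> wf_aexp K B a \<and> wf_aexp K B b \<and> wf_aexp K B e"
| "wfc K B (Sq c1 c2) \<longleftrightarrow> wfc K B c1 \<and> wfc K B c2"
| "wfc K B (Cond a b c1 c2) \<longleftrightarrow> wf_aexp K B a \<and> wf_aexp K B b \<and> wfc K B c1 \<and> wfc K B c2"
| "wfc K B (Wh a b c) \<longleftrightarrow> wf_aexp K B a \<and> wf_aexp K B b \<and> wfc K B c"

definition sagree :: "nat set \<Rightarrow> (nat \<Rightarrow> real) \<Rightarrow> (nat \<Rightarrow> real) \<Rightarrow> bool" where
  "sagree B r' r \<longleftrightarrow> (\<forall>y\<in>B. r' y = r y)"

text \<open>Earlier commands leave garbage in the temporaries, so the machine registers
  \<open>r0\<close> match the registers \<open>r\<close> of the source semantics only on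
  \<open>B\<close>.\<close>

lemma comp_correct':
  assumes "wf_aexp K B e" "0 \<in> B" "B \<subseteq> {..<K}" "K \<le> k" "safe M N e r m" "code_at P p (compile e k p)"
    "sagree B r0 r"
  shows "\<exists>r'. reach P M (p, r0, m) (cost N e) (p + len e, r', m) \<and> r' k = ev e r m \<and>
      sagree B r' r \<and> (\<forall>y. K \<le> y \<and> y < k \<longrightarrow> r' y = r0 y)"
proof -
  have "safe M N e r0 m = safe M N e r m" "ev e r0 m = ev e r m"
    using assms safe_cong[of K B e r0 r] ev_cong[of K B e r0 r] by (simp_all add: sagree_def)
  then obtain r' where "reach P M (p, r0, m) (cost N e) (p + len e, r', m)" "r' k = ev e r m" "agree B K k r' r0"
    using comp_correct[of K B e k M N r0 m P p] assms by auto
  with assms show ?thesis by (intro exI[of _ r']) (auto simp: agree_def sagree_def)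
qed

lemma comp2_correct:
  assumes "wf_aexp K B a" "wf_aexp K B b" "0 \<in> B" "B \<subseteq> {..<K}" "safe M N a r m" "safe M N b r m"
    "code_at P p (compile a K p)" "code_at P (p + len a) (compile b (Suc K) (p + len a))" "sagree B r0 r"
  shows "\<exists>r'. reach P M (p, r0, m) (cost N a + cost N b) (p + len a + len b, r', m) \<and>
      r' K = ev a r m \<and> r' (Suc K) = ev b r m \<and> sagree B r' r"
proof -
  obtain r1 where r1: "reach P M (p, r0, m) (cost N a) (p + len a, r1, m)" "r1 K = ev a r m" "sagree B r1 r"
    using comp_correct'[of K B a K M N r m P p r0] assms by auto
  obtain r2 where r2: "reach P M (p + len a, r1, m) (cost N b) (p + len a + len b, r2, m)"
     "r2 (Suc K) = ev b r m" "sagree B r2 r" "r2 K = r1 K"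
    using comp_correct'[of K B b "Suc K" M N r m P "p + len a" r1] assms r1 by auto
  from reach_trans[OF r1(1) r2(1)] r1 r2 show ?thesis by auto
qed

lemma compc_correct:
  assumes "bs M N c s t s'" "wfc K B c" "0 \<in> B" "B \<subseteq> {..<K}" "code_at P p (compc K c p)"
    "sagree B r0 (fst s)"
  shows "\<exists>r'. reach P M (p, r0, snd s) t (p + lenc c, r', snd s') \<and> sagree B r' (fst s')"
  using assms
proof (induction arbitrary: p r0 rule: bs.induct)
  case (bs_Skip s)
  then show ?case by (auto simp: reach_refl intro!: exI[of _ r0])
next
  case (bs_Asg e r m x)
  then obtain r1 where r1: "reach P M (p, r0, m) (cost N e) (p + len e, r1, m)" "r1 K = ev e r m" "sagree B r1 r"
    using comp_correct'[of K B e K M N r m P p r0] by auto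
  define r2 where "r2 = r1(Suc K := 0, x := r1 K)"
  have "x \<noteq> K" "x \<noteq> Suc K" using bs_Asg.prems by auto
  then have "reach P M (p + len e, r1, m) (Suc (Suc 0)) (p + len e + 2, r2, m)"
    by (intro reach_Cons[of "p + len e"] reach_Cons[of "Suc (p + len e)"] reach_refl)
       (use bs_Asg.prems in \<open>auto simp: r2_def intro!: reach_Cons reach_refl\<close>)
  from reach_trans[OF r1(1) this]
  have "reach P M (p, r0, m) (cost N e + 2) (p + lenc (Asg x e), r2, m)" by simp
  moreover have "sagree B r2 (r(x := ev e r m))" using r1 bs_Asg.prems by (auto simp: r2_def sagree_def)
  ultimately show ?case by (metis fst_conv snd_conv)
next
  case (bs_Sto a b r m e)
  have ss: "safe M N a r m" "safe M N b r m" using bs_Sto by auto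
  obtain r2 where r2: "reach P M (p, r0, m) (cost N a + cost N b) (p + len a + len b, r2, m)"
      "r2 K = ev a r m" "r2 (Suc K) = ev b r m" "sagree B r2 r"
    using comp2_correct[of K B a b M N r m P p r0] bs_Sto.prems ss by (auto simp: ac_simps)
  obtain r3 where r3: "reach P M (p + len a + len b, r2, m) (cost N e) (p + len a + len b + len e, r3, m)"
     "r3 (Suc (Suc K)) = ev e r m" "sagree B r3 r" "r3 K = r2 K" "r3 (Suc K) = r2 (Suc K)"
    using comp_correct'[of K B e "Suc (Suc K)" M N r m P "p + len a + len b" r2] bs_Sto r2(4) by (auto simp: ac_simps)
  have k0: "0 < K" "r3 0 = r 0" using bs_Sto.prems r3(3) by (auto simp: sagree_def)
  define q where "q = p + len a + len b + len e"
  define m' where "m' = m(cell (nat \<lfloor>r 0\<rfloor>) (nat \<lfloor>ev a r m\<rfloor>) (nat \<lfloor>ev b r m\<rfloor>) := ev e r m)"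
  define r4 where "r4 = r3(K := ev a r m * r 0 + ev b r m)"
  note cl = Nats_cell[of "r 0" "ev a r m" "ev b r m"]
  have cd: "q < length P" "Suc q < length P" "Suc (Suc q) < length P"
     "P ! q = Mul K K 0" "P ! Suc q = Add K K (Suc K)" "P ! Suc (Suc q) = Store K (Suc (Suc K))"
    using bs_Sto.prems by (auto simp: q_def ac_simps)
  define r5 where "r5 = r3(K := ev a r m * r 0)"
  have s1: "reach P M (q, r3, m) 1 (Suc q, r5, m)"
    by (rule reach_1) (use k0 cd r3 r2 in \<open>auto simp: r5_def\<close>)
  have s2: "reach P M (Suc q, r5, m) 1 (Suc (Suc q), r4, m)"
    by (rule reach_1) (use k0 cd r3 r2 in \<open>auto simp: r5_def r4_def\<close>)
  have s3: "reach P M (Suc (Suc q), r4, m) 1 (q + 3, r4, m')"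
    by (rule reach_1) (use k0 cd r3 r2 bs_Sto.hyps cl in \<open>auto simp: r4_def m'_def numeral_3_eq_3\<close>)
  from reach_trans[OF s1 reach_trans[OF s2 s3]]
  have "reach P M (q, r3, m) 3 (q + 3, r4, m')" by (simp add: numeral_3_eq_3)
  from reach_trans[OF r2(1) reach_trans[OF r3(1) this[unfolded q_def]]]
  have "reach P M (p, r0, m) (cost N a + cost N b + cost N e + 3) (p + lenc (Sto a b e), r4, m')"
    by (simp add: ac_simps)
  moreover have "sagree B r4 r" using r3(3) bs_Sto.prems by (auto simp: sagree_def r4_def)
  ultimately show ?case unfolding m'_def by (metis fst_conv snd_conv)
next
  case (bs_Sq c1 s t1 s1 c2 t2 s2)
  obtain r1 where r1: "reach P M (p, r0, snd s) t1 (p + lenc c1, r1, snd s1)" "sagree B r1 (fst s1)"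
    using bs_Sq.IH(1)[of p r0] bs_Sq.prems by auto
  obtain r2 where r2: "reach P M (p + lenc c1, r1, snd s1) t2 (p + lenc c1 + lenc c2, r2, snd s2)" "sagree B r2 (fst s2)"
    using bs_Sq.IH(2)[of "p + lenc c1" r1] bs_Sq.prems r1 by auto
  from reach_trans[OF r1(1) r2(1)] r2(2) show ?case by (auto simp: add.assoc)
next
  case (bs_If1 a s b c1 t s' c2)
  obtain r m where s: "s = (r, m)" by force
  let ?l = "p + len a + len b"
  obtain r2 where r2: "reach P M (p, r0, m) (cost N a + cost N b) (?l, r2, m)"
      "r2 K = ev a r m" "r2 (Suc K) = ev b r m" "sagree B r2 r"
    using comp2_correct[of K B a b M N r m P p r0] bs_If1 s by (auto simp: ac_simps)
  let ?q = "p + len a + len b + lenc c2 + 2"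
  have j: "reach P M (?l, r2, m) 1 (?q, r2, m)"
    using bs_If1 s r2 by (intro reach_1) (auto simp: ac_simps)
  obtain r3 where r3: "reach P M (?q, r2, m) t (?q + lenc c1, r3, snd s')" "sagree B r3 (fst s')"
    using bs_If1.IH[of ?q r2] bs_If1.prems r2 s by (auto simp: ac_simps)
  have "reach P M (p, r0, m) (cost N a + cost N b + t + 2) (p + lenc (Cond a b c1 c2), r3, snd s')"
    by (rule reach_weaken, rule back_subst[where P = "\<lambda>c. reach P M (p, r0, m) _ c"],
        rule reach_trans[OF r2(1) reach_trans[OF j r3(1)]]) auto
  with r3(2) s show ?case by auto
next
  case (bs_If2 a s b c2 t s' c1)
  obtain r m where s: "s = (r, m)" by force
  let ?l = "p + len a + len b"
  obtain r2 where r2: "reach P M (p, r0, m) (cost N a + cost N b) (?l, r2, m)"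
      "r2 K = ev a r m" "r2 (Suc K) = ev b r m" "sagree B r2 r"
    using comp2_correct[of K B a b M N r m P p r0] bs_If2 s by (auto simp: ac_simps)
  let ?q = "p + len a + len b + 1"
  have j: "reach P M (?l, r2, m) 1 (?q, r2, m)"
    using bs_If2 s r2 by (intro reach_1) (auto simp: ac_simps)
  obtain r3 where r3: "reach P M (?q, r2, m) t (?q + lenc c2, r3, snd s')" "sagree B r3 (fst s')"
    using bs_If2.IH[of ?q r2] bs_If2.prems r2 s by (auto simp: ac_simps)
  have j': "reach P M (?q + lenc c2, r3, snd s') 1 (p + len a + len b + lenc c2 + lenc c1 + 2, r3, snd s')"
    using bs_If2.prems by (intro reach_1) (auto simp: ac_simps)
  have "reach P M (p, r0, m) (cost N a + cost N b + t + 2) (p + lenc (Cond a b c1 c2), r3, snd s')"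
    by (rule reach_weaken, rule back_subst[where P = "\<lambda>c. reach P M (p, r0, m) _ c"],
        rule reach_trans[OF r2(1) reach_trans[OF j reach_trans[OF r3(1) j']]]) auto
  with r3(2) s show ?case by auto
next
  case (bs_Wh1 a s b c)
  obtain r m where s: "s = (r, m)" by force
  let ?l = "p + len a + len b"
  obtain r2 where r2: "reach P M (p, r0, m) (cost N a + cost N b) (?l, r2, m)"
      "r2 K = ev a r m" "r2 (Suc K) = ev b r m" "sagree B r2 r"
    using comp2_correct[of K B a b M N r m P p r0] bs_Wh1 s by (auto simp: ac_simps)
  have j: "reach P M (?l, r2, m) 1 (Suc ?l, r2, m)"
    using bs_Wh1 s r2 by (intro reach_1) (auto simp: ac_simps)
  have j': "reach P M (Suc ?l, r2, m) 1 (p + lenc (Wh a b c), r2, m)"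
    using bs_Wh1.prems by (intro reach_1) (auto simp: ac_simps)
  from reach_trans[OF r2(1) reach_trans[OF j j']] r2(4) s show ?case
    by (intro exI[of _ r2]) (auto simp: numeral_2_eq_2)
next
  case (bs_Wh2 a s b c t s' t' s'')
  obtain r m where s: "s = (r, m)" by force
  let ?l = "p + len a + len b"
  obtain r2 where r2: "reach P M (p, r0, m) (cost N a + cost N b) (?l, r2, m)"
      "r2 K = ev a r m" "r2 (Suc K) = ev b r m" "sagree B r2 r"
    using comp2_correct[of K B a b M N r m P p r0] bs_Wh2 s by (auto simp: ac_simps)
  have j: "reach P M (?l, r2, m) 1 (?l + 2, r2, m)"
    using bs_Wh2 s r2 by (intro reach_1) (auto simp: ac_simps)
  obtain r3 where r3: "reach P M (?l + 2, r2, m) t (?l + 2 + lenc c, r3, snd s')" "sagree B r3 (fst s')"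
    using bs_Wh2.IH(1)[of "?l + 2" r2] bs_Wh2.prems r2 s by (auto simp: ac_simps)
  have j': "reach P M (?l + 2 + lenc c, r3, snd s') 1 (p, r3, snd s')"
    using bs_Wh2.prems by (intro reach_1) (auto simp: ac_simps)
  obtain r4 where r4: "reach P M (p, r3, snd s') t' (p + lenc (Wh a b c), r4, snd s'')" "sagree B r4 (fst s'')"
    using bs_Wh2.IH(2)[of p r3] bs_Wh2.prems r3 s by (auto simp: ac_simps)
  have "reach P M (p, r0, m) (cost N a + cost N b + 2 + t + t') (p + lenc (Wh a b c), r4, snd s'')"
    by (rule reach_weaken, rule reach_trans[OF r2(1) reach_trans[OF j reach_trans[OF r3(1) reach_trans[OF j' r4(1)]]]]) auto
  with r4(2) s show ?case by auto
qed

text \<open>Worst case time if every loop makes at most \<open>N\<close> iterations.\<close>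

fun cst :: "nat \<Rightarrow> com \<Rightarrow> nat" where
  "cst N Skip = 0"
| "cst N (Asg x e) = cost N e + 2"
| "cst N (Sto a b e) = cost N a + cost N b + cost N e + 3"
| "cst N (Sq c1 c2) = cst N c1 + cst N c2"
| "cst N (Cond a b c1 c2) = cost N a + cost N b + cst N c1 + cst N c2 + 2"
| "cst N (Wh a b c) = (N + 1) * (cost N a + cost N b + 2 + cst N c)"

section \<open>Polynomial time bounds\<close>

definition poly_bounded :: "(nat \<Rightarrow> nat) \<Rightarrow> bool" where
  "poly_bounded f \<longleftrightarrow> (\<exists>c q. \<forall>N. f N \<le> c * (N + 1) ^ q)"

lemma poly_bounded_const: "poly_bounded (\<lambda>N. c)"
  unfolding poly_bounded_def by (rule exI[of _ c], rule exI[of _ 0]) auto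

lemma poly_bounded_add:
  assumes "poly_bounded f" "poly_bounded g"
  shows "poly_bounded (\<lambda>N. f N + g N)"
proof -
  obtain c q c' q' where f: "\<And>N. f N \<le> c * (N + 1) ^ q" and g: "\<And>N. g N \<le> c' * (N + 1) ^ q'"
    using assms unfolding poly_bounded_def by metis
  have "f N + g N \<le> (c + c') * (N + 1) ^ (q + q')" for N
  proof -
    have "c * (N + 1) ^ q \<le> c * (N + 1) ^ (q + q')" "c' * (N + 1) ^ q' \<le> c' * (N + 1) ^ (q + q')"
      by (intro mult_left_mono power_increasing; simp)+
    with f[of N] g[of N] show ?thesis unfolding distrib_right by linarith
  qed
  then show ?thesis unfolding poly_bounded_def by blast
qed

lemma poly_bounded_mult:
  assumes "poly_bounded f" "poly_bounded g"
  shows "poly_bounded (\<lambda>N. f N * g N)"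
proof -
  obtain c q c' q' where f: "\<And>N. f N \<le> c * (N + 1) ^ q" and g: "\<And>N. g N \<le> c' * (N + 1) ^ q'"
    using assms unfolding poly_bounded_def by metis
  have "f N * g N \<le> (c * c') * (N + 1) ^ (q + q')" for N
    using mult_mono[OF f[of N] g[of N]] by (simp add: power_add mult_ac)
  then show ?thesis unfolding poly_bounded_def by blast
qed

lemma poly_bounded_ident: "poly_bounded (\<lambda>N. N)"
  unfolding poly_bounded_def by (rule exI[of _ 1], rule exI[of _ 1]) auto

lemma poly_bounded_Suc: "poly_bounded f \<Longrightarrow> poly_bounded (\<lambda>N. Suc (f N))"
  using poly_bounded_add[OF poly_bounded_const[of 1]] by simp

lemmas poly_bounded_intros = poly_bounded_Suc poly_bounded_const poly_bounded_add poly_bounded_mult poly_bounded_ident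

lemma poly_bounded_cost: "poly_bounded (\<lambda>N. cost N e)"
  by (induction e) (auto intro!: poly_bounded_intros simp del: mult_Suc mult_Suc_right)

text \<open>The degree depends on the program text only. As \<open>N\<close> will be a power of
  \<open>n + 1\<close> with a large exponent, a fixed degree merely multiplies this exponent by a
  constant.\<close>

lemma poly_bounded_cst: "poly_bounded (\<lambda>N. cst N c)"
  by (induction c) (auto intro!: poly_bounded_intros poly_bounded_cost simp del: mult_Suc mult_Suc_right)

text \<open>Total correctness in the style of weakest preconditions. The time bound is read off the
  command, so timing needs no further argument once every loop is known to make at most
  \<open>N\<close> rounds.\<close>

definition run :: "nat \<Rightarrow> nat \<Rightarrow> com \<Rightarrow> state \<Rightarrow> (state \<Rightarrow> bool) \<Rightarrow> bool" where
  "run M N c s Q \<longleftrightarrow> (\<exists>s' t. bs M N c s t s' \<and> t \<le> cst N c \<and> Q s')"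

lemma run_mono: "run M N c s Q \<Longrightarrow> (\<And>s'. Q s' \<Longrightarrow> Q' s') \<Longrightarrow> run M N c s Q'"
  unfolding run_def by blast

lemma run_Skip: "Q s \<Longrightarrow> run M N Skip s Q"
  unfolding run_def by (intro exI[of _ s] exI[of _ 0]) (simp add: bs_Skip)

lemma run_Asg: "safe M N e r m \<Longrightarrow> Q (r(x := ev e r m), m) \<Longrightarrow> run M N (Asg x e) (r, m) Q"
  unfolding run_def using bs_Asg by force

lemma run_Sto: "\<lbrakk>safe M N (Mat a b) r m; safe M N e r m;
   Q (r, m(cell (nat \<lfloor>r 0\<rfloor>) (nat \<lfloor>ev a r m\<rfloor>) (nat \<lfloor>ev b r m\<rfloor>) := ev e r m))\<rbrakk>
  \<Longrightarrow> run M N (Sto a b e) (r, m) Q"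
  unfolding run_def by (intro exI conjI) (rule bs_Sto, auto)

lemma run_Sq: "run M N c1 s R \<Longrightarrow> (\<And>r m. R (r, m) \<Longrightarrow> run M N c2 (r, m) Q) \<Longrightarrow> run M N (Sq c1 c2) s Q"
  unfolding run_def by (metis (no_types, opaque_lifting) add_mono bs_Sq cst.simps(4) prod.collapse)

lemma run_If:
  assumes "safe M N a r m" "safe M N b r m"
    "ev a r m < ev b r m \<Longrightarrow> run M N c1 (r, m) Q" "\<not> ev a r m < ev b r m \<Longrightarrow> run M N c2 (r, m) Q"
  shows "run M N (Cond a b c1 c2) (r, m) Q"
proof (cases "ev a r m < ev b r m")
  case True
  from assms(3)[OF this] obtain s' t where *: "bs M N c1 (r, m) t s'" "t \<le> cst N c1" "Q s'"
    unfolding run_def by auto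
  show ?thesis unfolding run_def
    by (rule exI, rule exI, rule conjI, rule bs_If1[OF _ _ _ *(1)]) (use assms True * in auto)
next
  case False
  from assms(4)[OF this] obtain s' t where *: "bs M N c2 (r, m) t s'" "t \<le> cst N c2" "Q s'"
    unfolding run_def by auto
  show ?thesis unfolding run_def
    by (rule exI, rule exI, rule conjI, rule bs_If2[OF _ _ _ *(1)]) (use assms False * in auto)
qed

text \<open>The invariant is indexed by the number of rounds made so far. Since \<open>i < N\<close>
  must hold whenever the guard does, this index is the termination measure and the time bound at
  once.\<close>

lemma run_Wh_aux:
  assumes "\<And>i r m. I i (r, m) \<Longrightarrow> safe M N a r m \<and> safe M N b r m"
    "\<And>i r m. I i (r, m) \<Longrightarrow> ev a r m < ev b r m \<Longrightarrow> i < N \<and> run M N c (r, m) (I (Suc i))"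
    "\<And>i r m. I i (r, m) \<Longrightarrow> \<not> ev a r m < ev b r m \<Longrightarrow> Q (r, m)"
    "I i (r, m)" "i \<le> N"
  shows "\<exists>s' t. bs M N (Wh a b c) (r, m) t s' \<and> t \<le> (N - i + 1) * (cost N a + cost N b + 2 + cst N c) \<and> Q s'"
  using assms(4,5)
proof (induction "N - i" arbitrary: i r m)
  case 0
  then have "\<not> ev a r m < ev b r m" using assms(2)[of i r m] by auto
  with assms(1,3) 0 show ?case
    by (intro exI conjI) (rule bs_Wh1, auto)
next
  case (Suc j)
  let ?u = "cost N a + cost N b + 2"
  show ?case
  proof (cases "ev a r m < ev b r m")
    case True
    from assms(2)[OF Suc.prems(1) True] obtain r1 m1 t1 where
      1: "bs M N c (r, m) t1 (r1, m1)" "t1 \<le> cst N c" "I (Suc i) (r1, m1)" "i < N"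
      unfolding run_def by auto
    have "\<exists>s' t. bs M N (Wh a b c) (r1, m1) t s' \<and> t \<le> (N - Suc i + 1) * (?u + cst N c) \<and> Q s'"
      by (rule Suc.hyps(1)) (use 1 Suc.hyps in auto)
    then obtain s' t where 2: "bs M N (Wh a b c) (r1, m1) t s'" "t \<le> (N - Suc i + 1) * (?u + cst N c)" "Q s'" by blast
    have "bs M N (Wh a b c) (r, m) (?u + t1 + t) s'"
      by (rule bs_Wh2[OF _ _ _ 1(1) 2(1)]) (use assms(1)[OF Suc.prems(1)] True in auto)
    moreover have "N - i + 1 = Suc (N - Suc i + 1)" using 1 by simp
    then have "?u + t1 + t \<le> (N - i + 1) * (?u + cst N c)"
      using 1(2) 2(2) by simp
    ultimately show ?thesis using 2(3) by blast
  next
    case False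
    with assms(1,3) Suc.prems show ?thesis
      by (intro exI conjI) (rule bs_Wh1, auto)
  qed
qed

lemma run_Wh:
  assumes "I 0 (r, m)" "\<And>i r m. I i (r, m) \<Longrightarrow> safe M N a r m \<and> safe M N b r m"
    "\<And>i r m. I i (r, m) \<Longrightarrow> ev a r m < ev b r m \<Longrightarrow> i < N \<and> run M N c (r, m) (I (Suc i))"
    "\<And>i r m. I i (r, m) \<Longrightarrow> \<not> ev a r m < ev b r m \<Longrightarrow> Q (r, m)"
  shows "run M N (Wh a b c) (r, m) Q"
  using run_Wh_aux[of I M N a b c Q 0 r m] assms unfolding run_def by simp

fun wr :: "com \<Rightarrow> nat set" where
  "wr Skip = {}"
| "wr (Asg x e) = {x}"
| "wr (Sto a b e) = {}"
| "wr (Sq c1 c2) = wr c1 \<union> wr c2"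
| "wr (Cond a b c1 c2) = wr c1 \<union> wr c2"
| "wr (Wh a b c) = wr c"

lemma bs_frame: "bs M N c s t s' \<Longrightarrow> y \<notin> wr c \<Longrightarrow> fst s' y = fst s y"
  by (induction rule: bs.induct) auto

lemma run_frame:
  assumes "run M N c (r, m) Q"
  shows "run M N c (r, m) (\<lambda>s'. Q s' \<and> (\<forall>y. y \<notin> wr c \<longrightarrow> fst s' y = r y))"
  using assms bs_frame unfolding run_def by (metis fst_conv)

definition For :: "nat \<Rightarrow> com \<Rightarrow> com" where
  "For x c = Sq (Asg x (C 0)) (Wh (V x) (V 0) (Sq c (Asg x (Bin Pl (V x) (C 1)))))"

lemma run_For:
  assumes n: "r 0 = real n" "n \<le> N" and x: "x \<notin> wr c" "x \<noteq> 0" "0 \<notin> wr c"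
    and init: "I 0 (r(x := 0)) m"
    and body: "\<And>i r m. \<lbrakk>i < n; I i r m; r x = real i; r 0 = real n\<rbrakk> \<Longrightarrow>
      run M N c (r, m) (\<lambda>(r', m'). r' 0 = real n \<longrightarrow> r' x = real i \<longrightarrow> I (Suc i) (r'(x := real (Suc i))) m')"
    and post: "\<And>r m. \<lbrakk>I n r m; r x = real n; r 0 = real n\<rbrakk> \<Longrightarrow> Q (r, m)"
  shows "run M N (For x c) (r, m) Q"
  unfolding For_def
proof (rule run_Sq[OF run_Asg, where R = "\<lambda>s. s = (r(x := 0), m)"], simp, simp)
  fix r' m' assume "(r', m') = (r(x := 0), m)"
  define J where "J = (\<lambda>i (s::state). i \<le> n \<and> I i (fst s) (snd s) \<and> fst s x = real i \<and> fst s 0 = real n)"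
  show "run M N (Wh (V x) (V 0) (Sq c (Asg x (Bin Pl (V x) (C 1))))) (r', m') Q"
  proof (rule run_Wh[where I = J])
    show "J 0 (r', m')" using \<open>(r', m') = _\<close> init n x by (auto simp: J_def)
  next
    fix i r m assume J: "J i (r, m)" "ev (V x) r m < ev (V 0) r m"
    then have i: "i < n" "I i r m" "r x = real i" "r 0 = real n" by (auto simp: J_def)
    show "i < N \<and> run M N (Sq c (Asg x (Bin Pl (V x) (C 1)))) (r, m) (J (Suc i))"
    proof (intro conjI run_Sq)
      show "i < N" using i n by simp
      show "run M N c (r, m) (\<lambda>s'. (case s' of (r', m') \<Rightarrow> r' 0 = real n \<longrightarrow> r' x = real i \<longrightarrow>
          I (Suc i) (r'(x := real (Suc i))) m') \<and> (\<forall>y. y \<notin> wr c \<longrightarrow> fst s' y = r y))"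
        by (rule run_frame[OF body[OF i]])
    next
      fix r' m' assume *: "(case (r', m') of (r', m') \<Rightarrow> r' 0 = real n \<longrightarrow> r' x = real i \<longrightarrow>
          I (Suc i) (r'(x := real (Suc i))) m') \<and> (\<forall>y. y \<notin> wr c \<longrightarrow> fst (r', m') y = r y)"
      then have "r' x = real i" "r' 0 = real n" using x i by auto
      with * i x show "run M N (Asg x (Bin Pl (V x) (C 1))) (r', m') (J (Suc i))"
        by (intro run_Asg) (auto simp: J_def add.commute)
    qed
  next
    fix i r m assume "J i (r, m)" "\<not> ev (V x) r m < ev (V 0) r m"
    then show "Q (r, m)" by (intro post) (auto simp: J_def)
  qed auto
qed

lemma wr_For [simp]: "wr (For x c) = insert x (wr c)"
  by (auto simp: For_def)

lemma wfc_For [simp]: "wfc K B (For x c) \<longleftrightarrow> x \<in> B \<and> wfc K B c \<and> 0 \<in> B"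
  by (auto simp: For_def)

text \<open>The answer of a compiled program is whether register \<open>1\<close> is positive at the end.\<close>

definition prog :: "nat \<Rightarrow> com \<Rightarrow> instr list" where
  "prog K c = compc K c 0 @ [Const K 0, Jump_Less K 1 (lenc c + 3), Halt False, Halt True]"

lemma prog_correct:
  assumes "wfc K B c" "0 \<in> B" "1 \<in> B" "B \<subseteq> {..<K}"
    "run M N c (r, m) (\<lambda>(r', m'). 0 < r' 1 \<longleftrightarrow> b)"
  shows "\<exists>t A. runs (prog K c) (0, r, m) b t A \<and> t \<le> cst N c + 3 \<and> A \<subseteq> {..<M}"
proof -
  obtain r1 m1 t where 1: "bs M N c (r, m) t (r1, m1)" "t \<le> cst N c" "0 < r1 1 \<longleftrightarrow> b"
    using assms(5) unfolding run_def by auto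
  have "code_at (prog K c) 0 (compc K c 0)" unfolding prog_def by (rule code_at_self)
  then obtain r2 where r2: "reach (prog K c) M (0, r, m) t (lenc c, r2, m1)" "sagree B r2 r1"
    using compc_correct[OF 1(1), of K B "prog K c" 0 r] assms by (auto simp: sagree_def)
  have K: "K \<noteq> 1" "r2 1 = r1 1" using assms r2 by (auto simp: sagree_def)
  let ?l = "if b then lenc c + 3 else lenc c + 2"
  have ln: "length (prog K c) = lenc c + 4" by (simp add: prog_def)
  have nth: "prog K c ! lenc c = Const K 0" "prog K c ! Suc (lenc c) = Jump_Less K 1 (lenc c + 3)"
     "prog K c ! ?l = Halt b"
    by (auto simp: prog_def nth_append)
  have "reach (prog K c) M (lenc c, r2, m1) (Suc (Suc 0)) (?l, r2(K := 0), m1)"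
    by (rule reach_Cons; (rule reach_Cons; (rule reach_refl)?)?) (use nth ln K 1(3) in auto)
  from reach_trans[OF r2(1) this] obtain t' where
    "steps (prog K c) M (0, r, m) t' (?l, r2(K := 0), m1)" "t' \<le> t + 2"
    unfolding reach_def by auto
  then obtain A where "runs (prog K c) (0, r, m) b (Suc t') A" "A \<subseteq> {..<M}" "t' \<le> t + 2"
    using steps_runs[OF _ refl, of "prog K c" M "(0, r, m)" t' ?l "r2(K := 0)" m1 b] nth(3) ln
    by (cases b) auto
  with 1(2) show ?thesis by (intro exI[of _ "Suc t'"] exI[of _ A]) auto
qed


section \<open>Sets and lists of sets on the machine\<close>

lemma cell_eq [simp]: "\<lbrakk>j < n; j' < n\<rbrakk> \<Longrightarrow> cell n i j = cell n i' j' \<longleftrightarrow> i = i' \<and> j = j'"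
proof -
  assume a: "j < n" "j' < n"
  have "cell n i j div n = i" "cell n i j mod n = j" "cell n i' j' div n = i'" "cell n i' j' mod n = j'"
    using a by (auto simp: cell_def)
  then show ?thesis by metis
qed

lemma cell_less: "i < R \<Longrightarrow> j < n \<Longrightarrow> cell n i j < R * n"
proof -
  assume "i < R" "j < n"
  then have "cell n i j < Suc i * n" by (simp add: cell_def)
  also have "\<dots> \<le> R * n" using \<open>i < R\<close> by (intro mult_right_mono) auto
  finally show ?thesis .
qed

lemma nat_floor_add [simp]: "nat \<lfloor>real u + 11\<rfloor> = u + 11"
proof -
  have "real u + 11 = real (u + 11)" by simp
  then show ?thesis by (simp only: floor_of_nat nat_int)
qed

text \<open>A list of subsets of \<open>{..<n}\<close> is stored in one real number in \<open>[0, 1)\<close>, whose binary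
  expansion consists of blocks of \<open>n + 1\<close> bits: a bit \<open>1\<close> and the characteristic function of the set.\<close>

fun pb :: "nat \<Rightarrow> nat set \<Rightarrow> nat \<Rightarrow> real \<Rightarrow> real" where
  "pb n S 0 x = x"
| "pb n S (Suc i) x = (pb n S i x + (if n - Suc i \<in> S then 1 else 0)) / 2"

fun enc :: "nat \<Rightarrow> nat set list \<Rightarrow> real" where
  "enc n [] = 0"
| "enc n (S # L) = (1 + pb n S n (enc n L)) / 2"

text \<open>The strict upper bound makes reading exact: what follows a bit never carries into
  it.\<close>

lemma pb_bounds: "0 \<le> x \<Longrightarrow> x < 1 \<Longrightarrow> 0 \<le> pb n S i x \<and> pb n S i x < 1"
  by (induction i) auto

lemma enc_bounds: "0 \<le> enc n L \<and> enc n L < 1"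
proof (induction L)
  case (Cons S L)
  then show ?case using pb_bounds[of "enc n L" n S n] by auto
qed simp

text \<open>The purpose of the leading bit of each block: without it \<open>[{}]\<close> would be
  encoded by \<open>0\<close> like the empty list, and emptiness could not be tested by
  sign.\<close>

lemma enc_pos: "0 < enc n L \<longleftrightarrow> L \<noteq> []"
proof (cases L)
  case (Cons S L')
  then show ?thesis using pb_bounds[of "enc n L'" n S n] enc_bounds[of n L'] by auto
qed simp

lemma run_post:
  assumes "run M N c (r, m) Q"
    "\<And>r' m'. \<lbrakk>Q (r', m'); \<And>y. y \<notin> wr c \<Longrightarrow> r' y = r y\<rbrakk> \<Longrightarrow> Q' (r', m')"
  shows "run M N c (r, m) Q'"
  by (rule run_mono[OF run_frame[OF assms(1)]]) (use assms(2) in \<open>auto split: prod.splits\<close>)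

text \<open>
  Memory is addressed as a matrix with rows of length \<open>n\<close>: rows 0 to 3 contain the input, row 4 the
  representatives of the clusters, row 5 the lists, row 6 the powers of \<open>n + 1\<close>, rows 7 to 10 hold
  single sets, and the distances start at row 11. Register 0 contains \<open>n\<close>, register 2 \<open>k\<close>,
  register 3 \<open>2 * \<tau>\<close>, and register 7 the root of the current cluster; summation variables are
  registers from 30 on.
\<close>

abbreviation "Plus a b \<equiv> Bin Pl a b"
abbreviation "Minus a b \<equiv> Bin Mi a b"
abbreviation "Times a b \<equiv> Bin Ti a b"
abbreviation "Divide a b \<equiv> Bin Dv a b"

text \<open>The machine compares by \<open><\<close> only, so equality takes two tests.\<close>

definition EqI :: "aexp \<Rightarrow> aexp \<Rightarrow> aexp \<Rightarrow> aexp \<Rightarrow> aexp" where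
  "EqI a b c e = Ite a b e (Ite b a e c)"

definition Dx :: "aexp \<Rightarrow> aexp \<Rightarrow> aexp" where
  "Dx a b = Mat (Plus a (C 11)) b"

text \<open>The sum counts the members of the set in row \<open>i\<close> that lie between
  \<open>a\<close> and \<open>b\<close>; a positive count means that the pair is separated.\<close>

definition Ifc :: "int \<Rightarrow> aexp \<Rightarrow> aexp \<Rightarrow> aexp \<Rightarrow> aexp \<Rightarrow> aexp" where
  "Ifc i a b e e' = Ite (C 0) (Sm 32 (Ite (C 0) (Mat (C i) (V 32))
     (EqI (Plus (Dx a (V 32)) (Dx (V 32) b)) (Dx a b) (C 1) (C 0)) (C 0))) e' e"

definition cardx :: "int \<Rightarrow> aexp" where
  "cardx i = Sm 30 (Mat (C i) (V 30))"

text \<open>On the diagonal \<open>J\<close> relies on \<open>1 / 0 = 0\<close>, but division by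
  zero blocks the machine; hence the separate case.\<close>

definition Jx :: "int \<Rightarrow> aexp" where
  "Jx i = Sm 30 (Sm 31 (EqI (V 30) (V 31) (C 0) (Ifc i (V 30) (V 31) (Divide (C 1) (Dx (V 30) (V 31))) (C 0))))"

definition profx :: "int \<Rightarrow> aexp" where
  "profx i = Sm 30 (EqI (Mat (C 4) (V 30)) (V 7) (Ifc i (V 7) (V 30) (Mat (C 6) (Dx (V 7) (V 30))) (C 0)) (C 0))"

definition badx :: "int \<Rightarrow> aexp" where
  "badx i = Sm 30 (EqI (Mat (C 4) (V 30)) (V 7) (Ifc i (V 7) (V 30)
     (Ite (Times (C 21) (Times (V 0) (Times (V 0) (V 0)))) (Times (Dx (V 7) (V 30)) (Times (V 2) (Times (V 2) (V 2)))) (C 1) (C 0))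
     (C 0)) (C 0))"

text \<open>Prepending reverses the order, so the elements go in from \<open>n - 1\<close> down to
  \<open>0\<close>, and the marker bit of the block comes last.\<close>

definition push :: "nat \<Rightarrow> int \<Rightarrow> com" where
  "push x i = Sq (For 4 (Asg x (Divide (Plus (V x) (Mat (C i) (Minus (V 0) (Plus (V 4) (C 1))))) (C 2))))
     (Asg x (Divide (Plus (C 1) (V x)) (C 2)))"

definition pop :: "nat \<Rightarrow> int \<Rightarrow> com" where
  "pop x i = Sq (Asg x (Minus (Times (C 2) (V x)) (C 1)))
     (For 4 (Sq (Asg x (Times (C 2) (V x)))
       (Cond (V x) (C 1) (Sto (C i) (V 4) (C 0)) (Sq (Sto (C i) (V 4) (C 1)) (Asg x (Minus (V x) (C 1)))))))"

definition copy :: "int \<Rightarrow> int \<Rightarrow> com" where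
  "copy i j = For 4 (Sto (C i) (V 4) (Mat (C j) (V 4)))"

definition unionc :: com where
  "unionc = For 4 (Sto (C 7) (V 4) (Ite (C 0) (Plus (Mat (C 8) (V 4)) (Mat (C 9) (V 4))) (C 1) (C 0)))"

locale machine = tree_metric +
  fixes M N :: nat
  assumes M: "M = (n + 11) * n" and N: "n \<le> N"
begin

section \<open>Values of expressions in memory\<close>

lemma cell_less_M: "i < n + 11 \<Longrightarrow> j < n \<Longrightarrow> cell n i j < M"
  unfolding M by (rule cell_less)

text \<open>Safety and value in one judgement, so that one rule per construct proves both.\<close>

definition val :: "aexp \<Rightarrow> (nat \<Rightarrow> real) \<Rightarrow> (nat \<Rightarrow> real) \<Rightarrow> real \<Rightarrow> bool" where
  "val e r m v \<longleftrightarrow> safe M N e r m \<and> ev e r m = v"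

definition rn :: "(nat \<Rightarrow> real) \<Rightarrow> bool" where
  [simp]: "rn r \<longleftrightarrow> r 0 = real n"

lemma val_V: "r x = v \<Longrightarrow> val (V x) r m v"
  by (simp add: val_def)

lemma val_Vr: "val (V x) r m (r x)"
  by (simp add: val_def)

lemma val_V0: "rn r \<Longrightarrow> val (V 0) r m (real n)"
  by (simp add: val_def)

lemma val_C: "of_int c = v \<Longrightarrow> val (C c) r m v"
  by (simp add: val_def)

lemma val_Plus: "val a r m x \<Longrightarrow> val b r m y \<Longrightarrow> val (Plus a b) r m (x + y)"
  by (simp add: val_def)

lemma val_Minus: "val a r m x \<Longrightarrow> val b r m y \<Longrightarrow> val (Minus a b) r m (x - y)"
  by (simp add: val_def)

lemma val_Times: "val a r m x \<Longrightarrow> val b r m y \<Longrightarrow> val (Times a b) r m (x * y)"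
  by (simp add: val_def)

lemma val_Divide: "val a r m x \<Longrightarrow> val b r m y \<Longrightarrow> y \<noteq> 0 \<Longrightarrow> val (Divide a b) r m (x / y)"
  by (simp add: val_def)

lemma val_Mat:
  assumes "rn r" "val a r m (real i)" "val b r m (real j)" "i < n + 11" "j < n" "m (cell n i j) = v"
  shows "val (Mat a b) r m v"
  using assms cell_less_M[of i j] by (auto simp: val_def)

lemma val_Ite:
  assumes "val a r m x" "val b r m y" "x < y \<Longrightarrow> val c r m z" "\<not> x < y \<Longrightarrow> val e r m z'"
  shows "val (Ite a b c e) r m (if x < y then z else z')"
  using assms by (auto simp: val_def)

lemma val_EqI:
  assumes "val a r m x" "val b r m y" "x = y \<Longrightarrow> val c r m z" "x \<noteq> y \<Longrightarrow> val e r m z'"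
  shows "val (EqI a b c e) r m (if x = y then z else z')"
  using assms by (auto simp: val_def EqI_def)

lemma val_Sm:
  assumes "rn r" "\<And>i. i < n \<Longrightarrow> val e (r(x := real i)) m (f i)"
  shows "val (Sm x e) r m (\<Sum>i<n. f i)"
  using assms N by (auto simp: val_def)

lemma val_cong: "val e r m x \<Longrightarrow> x = y \<Longrightarrow> val e r m y"
  by simp

definition DM :: "(nat \<Rightarrow> real) \<Rightarrow> bool" where
  "DM m \<longleftrightarrow> (\<forall>u<n. \<forall>w<n. m (cell n (u + 11) w) = real (d u w))"

definition RP :: "(nat \<Rightarrow> real) \<Rightarrow> (nat \<Rightarrow> nat) \<Rightarrow> bool" where
  "RP m rep \<longleftrightarrow> (\<forall>u<n. m (cell n 4 u) = real (rep u))"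

definition LS :: "(nat \<Rightarrow> real) \<Rightarrow> (nat \<Rightarrow> nat set list) \<Rightarrow> bool" where
  "LS m Ls \<longleftrightarrow> (\<forall>v<n. m (cell n 5 v) = enc n (Ls v))"

definition PW :: "(nat \<Rightarrow> real) \<Rightarrow> bool" where
  "PW m \<longleftrightarrow> (\<forall>j<n. m (cell n 6 j) = real ((n + 1) ^ j))"

definition RS :: "(nat \<Rightarrow> real) \<Rightarrow> nat \<Rightarrow> nat set \<Rightarrow> bool" where
  "RS m i S \<longleftrightarrow> (\<forall>j<n. m (cell n i j) = (if j \<in> S then 1 else 0))"

definition same_out :: "nat set \<Rightarrow> (nat \<Rightarrow> real) \<Rightarrow> (nat \<Rightarrow> real) \<Rightarrow> bool" where
  "same_out R m' m \<longleftrightarrow> (\<forall>i j. j < n \<longrightarrow> i \<notin> R \<longrightarrow> m' (cell n i j) = m (cell n i j))"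

lemma same_out_refl: "same_out R m m"
  by (simp add: same_out_def)

lemma same_out_trans: "same_out R m'' m' \<Longrightarrow> same_out R' m' m \<Longrightarrow> R \<union> R' \<subseteq> R'' \<Longrightarrow> same_out R'' m'' m"
  unfolding same_out_def by (metis Un_iff subsetD)

lemma same_out_upd: "j < n \<Longrightarrow> i \<in> R \<Longrightarrow> same_out R m' m \<Longrightarrow> same_out R (m'(cell n i j := v)) m"
  unfolding same_out_def by auto

lemma same_out_rows:
  assumes "same_out R m' m"
  shows "\<forall>i\<in>R. i < 11 \<Longrightarrow> DM m \<Longrightarrow> DM m'" "4 \<notin> R \<Longrightarrow> RP m rep \<Longrightarrow> RP m' rep"
    "5 \<notin> R \<Longrightarrow> LS m Ls \<Longrightarrow> LS m' Ls" "6 \<notin> R \<Longrightarrow> PW m \<Longrightarrow> PW m'" "i \<notin> R \<Longrightarrow> RS m i S \<Longrightarrow> RS m' i S"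
proof -
  assume R: "\<forall>i\<in>R. i < 11" and D: "DM m"
  have "u + 11 \<notin> R" for u using R by force
  then show "DM m'" using assms D unfolding same_out_def DM_def by auto
qed (use assms in \<open>auto simp: same_out_def RP_def LS_def PW_def RS_def\<close>)

lemma val_Dx:
  assumes "rn r" "DM m" "val a r m (real u)" "val b r m (real w)" "u < n" "w < n"
  shows "val (Dx a b) r m (real (d u w))"
  unfolding Dx_def
proof (rule val_Mat[OF assms(1), where i = "u + 11" and j = w])
  show "val (Plus a (C 11)) r m (real (u + 11))"
    by (rule val_cong[OF val_Plus[OF assms(3) val_C]]) auto
qed (use assms in \<open>auto simp: DM_def\<close>)

lemma val_row:
  assumes "rn r" "val b r m (real j)" "j < n" "i < 11" "m (cell n i j) = v"
  shows "val (Mat (C (int i)) b) r m v"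
  by (rule val_Mat[OF assms(1) val_C assms(2) _ assms(3,5)]) (use assms in auto)

lemma val_rown:
  assumes "rn r" "val b r m (real j)" "j < n" "m (cell n (numeral k) j) = v" "numeral k < (11 :: nat)"
  shows "val (Mat (C (numeral k)) b) r m v"
  using val_row[OF assms(1,2,3), of "numeral k" v] assms(4,5) by simp

lemma val_Ifc:
  assumes r: "rn r" "DM m" "RS m i S" "i < 11" "S \<subseteq> {..<n}" "u < n" "w < n"
    and ab: "\<And>s. val a (r(32 := real s)) m (real u)" "\<And>s. val b (r(32 := real s)) m (real w)"
    and e: "conn S u w \<Longrightarrow> val e r m z" "\<not> conn S u w \<Longrightarrow> val e' r m z'"
  shows "val (Ifc (int i) a b e e') r m (if conn S u w then z else z')"
proof -
  let ?f = "\<lambda>s. if 0 < (if s \<in> S then 1 else 0 :: real) then (if real (d u s) + real (d s w) = real (d u w) then 1 else 0) else 0 :: real"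
  have v: "val (Sm 32 (Ite (C 0) (Mat (C (int i)) (V 32))
     (EqI (Plus (Dx a (V 32)) (Dx (V 32) b)) (Dx a b) (C 1) (C 0)) (C 0))) r m (\<Sum>s<n. ?f s)"
  proof (rule val_Sm[OF r(1)])
    fix s assume s: "s < n"
    let ?r = "r(32 := real s)"
    have r0: "rn ?r" using r by simp
    note vs = val_V[of ?r 32 "real s" m]
    show "val (Ite (C 0) (Mat (C (int i)) (V 32))
        (EqI (Plus (Dx a (V 32)) (Dx (V 32) b)) (Dx a b) (C 1) (C 0)) (C 0)) ?r m (?f s)"
    proof (intro val_Ite val_EqI val_Plus)
      show "val (C 0) ?r m 0" by (simp add: val_C)
      show "val (Mat (C (int i)) (V 32)) ?r m (if s \<in> S then 1 else 0)"
        by (rule val_row[OF r0 vs]) (use r s in \<open>auto simp: RS_def\<close>)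
      show "val (Dx a (V 32)) ?r m (real (d u s))" by (rule val_Dx[OF r0 r(2) ab(1) vs]) (use r s in auto)
      show "val (Dx (V 32) b) ?r m (real (d s w))" by (rule val_Dx[OF r0 r(2) vs ab(2)]) (use r s in auto)
      show "val (Dx a b) ?r m (real (d u w))" by (rule val_Dx[OF r0 r(2) ab]) (use r in auto)
    qed (auto intro: val_C)
  qed
  have nn: "\<forall>s\<in>{..<n}. 0 \<le> ?f s" by auto
  have "(\<Sum>s<n. ?f s) = 0 \<longleftrightarrow> (\<forall>s\<in>{..<n}. ?f s = 0)" by (rule sum_nonneg_eq_0_iff) (use nn in auto)
  also have "\<dots> \<longleftrightarrow> conn S u w"
    using r(5) unfolding conn_def btw_def by (auto simp flip: of_nat_add)
  finally have e0: "(\<Sum>s<n. ?f s) = 0 \<longleftrightarrow> conn S u w" .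
  have "0 \<le> (\<Sum>s<n. ?f s)" by (rule sum_nonneg) (use nn in auto)
  then have c: "0 < (\<Sum>s<n. ?f s) \<longleftrightarrow> \<not> conn S u w" unfolding e0[symmetric] by linarith
  have "val (Ite (C 0) (Sm 32 (Ite (C 0) (Mat (C (int i)) (V 32))
     (EqI (Plus (Dx a (V 32)) (Dx (V 32) b)) (Dx a b) (C 1) (C 0)) (C 0))) e' e) r m
     (if 0 < (\<Sum>s<n. ?f s) then z' else z)"
    by (rule val_Ite[OF val_C v]) (use c e in auto)
  then show ?thesis unfolding Ifc_def c by (simp split: if_splits)
qed

lemma val_cardx:
  assumes "rn r" "RS m i S" "i < 11" "S \<subseteq> {..<n}"
  shows "val (cardx (int i)) r m (real (card S))"
  unfolding cardx_def
proof (rule val_cong[OF val_Sm])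
  fix j assume j: "j < n"
  show "val (Mat (C (int i)) (V 30)) (r(30 := real j)) m (if j \<in> S then 1 else 0)"
    by (rule val_row[OF _ val_V]) (use assms j in \<open>auto simp: RS_def\<close>)
next
  have "(\<Sum>j<n. if j \<in> S then 1 else 0 :: real) = (\<Sum>j\<in>{..<n} \<inter> S. 1)"
    by (rule sum.inter_restrict[symmetric]) simp
  also have "{..<n} \<inter> S = S" using assms by auto
  finally show "(\<Sum>j<n. if j \<in> S then 1 else 0) = real (card S)" by simp
qed (use assms in auto)

lemma val_Jx:
  assumes "rn r" "DM m" "RS m i S" "i < 11" "S \<subseteq> {..<n}"
  shows "val (Jx (int i)) r m (J S)"
  unfolding Jx_def
proof (rule val_cong[OF val_Sm[OF assms(1) val_Sm]])
  fix u w assume uw: "u < n" "w < n"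
  let ?r = "r(30 := real u, 31 := real w)"
  have r0: "rn ?r" using assms by simp
  show "val (EqI (V 30) (V 31) (C 0) (Ifc (int i) (V 30) (V 31) (Divide (C 1) (Dx (V 30) (V 31))) (C 0))) ?r m
    (if real u = real w then 0 else if conn S u w then 1 / real (d u w) else 0)"
  proof (intro val_EqI val_Ifc[OF r0 assms(2-5) uw])
    assume "real u \<noteq> real w"
    then have "d u w \<noteq> 0" using d_zero uw by auto
    then show "val (Divide (C 1) (Dx (V 30) (V 31))) ?r m (1 / real (d u w))"
      by (intro val_Divide val_C val_Dx[OF r0 assms(2)] val_V) (use uw in auto)
  qed (auto intro: val_V val_C)
next
  show "(\<Sum>u<n. \<Sum>w<n. if real u = real w then 0 else if conn S u w then 1 / real (d u w) else 0) = J S"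
    unfolding J_def by (intro sum.cong refl) (auto simp: inv_d_def)
qed (use assms in auto)

lemma val_profx:
  assumes "rn r" "DM m" "RS m i S" "i < 11" "S \<subseteq> {..<n}" "RP m rep" "PW m" "r 7 = real p" "p < n"
  shows "val (profx (int i)) r m (real (prof (cl rep p) p S))"
  unfolding profx_def
proof (rule val_cong[OF val_Sm[OF assms(1)]])
  fix u assume u: "u < n"
  let ?r = "r(30 := real u)"
  have r0: "rn ?r" using assms by simp
  have r4: "val (Mat (C 4) (V 30)) ?r m (real (rep u))"
    by (rule val_rown[OF r0 val_V, where j = u]) (use u assms in \<open>auto simp: RP_def\<close>)
  show "val (EqI (Mat (C 4) (V 30)) (V 7) (Ifc (int i) (V 7) (V 30) (Mat (C 6) (Dx (V 7) (V 30))) (C 0)) (C 0)) ?r m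
    (if real (rep u) = real p then if conn S p u then real ((n + 1) ^ d p u) else 0 else 0)"
  proof (intro val_EqI[OF r4] val_Ifc[OF r0 assms(2-5) assms(9) u])
    have vD: "val (Dx (V 7) (V 30)) ?r m (real (d p u))"
      by (rule val_Dx[OF r0 assms(2) val_V val_V]) (use assms u in auto)
    show "val (Mat (C 6) (Dx (V 7) (V 30))) ?r m (real ((n + 1) ^ d p u))"
      by (rule val_rown[OF r0 vD]) (use d_less[OF assms(9) u] assms(7) in \<open>auto simp: PW_def\<close>)
  qed (use assms in \<open>auto intro: val_V val_C\<close>)
next
  have "(\<Sum>u<n. if real (rep u) = real p then if conn S p u then real ((n + 1) ^ d p u) else 0 else 0)
    = (\<Sum>u<n. if u \<in> {u \<in> cl rep p. conn S p u} then real ((n + 1) ^ d p u) else 0)"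
    by (rule sum.cong) (auto simp: cl_def)
  also have "\<dots> = (\<Sum>u\<in>{..<n} \<inter> {u \<in> cl rep p. conn S p u}. real ((n + 1) ^ d p u))"
    by (rule sum.inter_restrict[symmetric]) simp
  also have "{..<n} \<inter> {u \<in> cl rep p. conn S p u} = {u \<in> cl rep p. conn S p u}" by (auto simp: cl_def)
  finally show "(\<Sum>u<n. if real (rep u) = real p then if conn S p u then real ((n + 1) ^ d p u) else 0 else 0)
    = real (prof (cl rep p) p S)" unfolding prof_def by simp
qed

lemma val_badx:
  assumes "rn r" "DM m" "RS m i S" "i < 11" "S \<subseteq> {..<n}" "RP m rep" "r 7 = real p" "p < n"
    "r 2 = of_int k"
  shows "\<exists>v. val (badx (int i)) r m v \<and>
    (0 < v \<longleftrightarrow> \<not> (\<forall>u\<in>cl rep p. conn S p u \<longrightarrow> real (d p u) * of_int k ^ 3 \<le> 21 * real n ^ 3))"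
proof -
  let ?f = "\<lambda>u. if real (rep u) = real p then if conn S p u then
     if 21 * (real n * (real n * real n)) < real (d p u) * (of_int k * (of_int k * of_int k)) then 1 else 0 else 0 else 0 :: real"
  have "val (badx (int i)) r m (\<Sum>u<n. ?f u)"
    unfolding badx_def
  proof (rule val_Sm[OF assms(1)])
    fix u assume u: "u < n"
    let ?r = "r(30 := real u)"
    have r0: "rn ?r" using assms by simp
    have r4: "val (Mat (C 4) (V 30)) ?r m (real (rep u))"
      by (rule val_rown[OF r0 val_V, where j = u]) (use u assms in \<open>auto simp: RP_def\<close>)
    show "val (EqI (Mat (C 4) (V 30)) (V 7) (Ifc (int i) (V 7) (V 30)
     (Ite (Times (C 21) (Times (V 0) (Times (V 0) (V 0)))) (Times (Dx (V 7) (V 30)) (Times (V 2) (Times (V 2) (V 2)))) (C 1) (C 0))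
     (C 0)) (C 0)) ?r m (?f u)"
    proof (intro val_EqI[OF r4] val_Ifc[OF r0 assms(2-5) assms(8) u] val_Ite val_Times)
      show "val (Dx (V 7) (V 30)) ?r m (real (d p u))"
        by (rule val_Dx[OF r0 assms(2) val_V val_V]) (use assms u in auto)
    qed (use assms in \<open>auto intro: val_V val_C\<close>)
  qed
  moreover have "0 < (\<Sum>u<n. ?f u) \<longleftrightarrow> (\<exists>u\<in>{..<n}. ?f u \<noteq> 0)"
  proof -
    have nn: "\<forall>u\<in>{..<n}. 0 \<le> ?f u" by auto
    have "(\<Sum>u<n. ?f u) = 0 \<longleftrightarrow> (\<forall>u\<in>{..<n}. ?f u = 0)" by (rule sum_nonneg_eq_0_iff) (use nn in auto)
    moreover have "0 \<le> (\<Sum>u<n. ?f u)" by (rule sum_nonneg) (use nn in auto)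
    then have "0 < (\<Sum>u<n. ?f u) \<longleftrightarrow> \<not> ((\<Sum>u<n. ?f u) = 0)" by linarith
    ultimately show ?thesis by blast
  qed
  moreover have "(\<exists>u\<in>{..<n}. ?f u \<noteq> 0) \<longleftrightarrow>
     \<not> (\<forall>u\<in>cl rep p. conn S p u \<longrightarrow> real (d p u) * of_int k ^ 3 \<le> 21 * real n ^ 3)"
    by (auto simp: cl_def power3_eq_cube mult.assoc not_le split: if_splits)
  ultimately show ?thesis by blast
qed

section \<open>Commands on sets and packed lists\<close>

lemma run_Asg_val: "val e r m v \<Longrightarrow> Q (r(x := v), m) \<Longrightarrow> run M N (Asg x e) (r, m) Q"
  by (rule run_Asg) (auto simp: val_def)

lemma run_Sto_val:
  assumes "rn r" "val a r m (real i)" "val b r m (real j)" "val e r m v" "i < n + 11" "j < n"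
    "Q (r, m(cell n i j := v))"
  shows "run M N (Sto a b e) (r, m) Q"
  by (rule run_Sto) (use assms cell_less_M in \<open>auto simp: val_def\<close>)

lemma run_Asg_Sq:
  assumes "val e r m v" "run M N c (r(x := v), m) Q"
  shows "run M N (Sq (Asg x e) c) (r, m) Q"
  by (rule run_Sq[where R = "\<lambda>s. s = (r(x := v), m)", OF run_Asg_val[OF assms(1)]]) (use assms(2) in auto)

lemma run_Sto_Sq:
  assumes "rn r" "val a r m (real i)" "val b r m (real j)" "val e r m v" "i < n + 11" "j < n"
    "run M N c (r, m(cell n i j := v)) Q"
  shows "run M N (Sq (Sto a b e) c) (r, m) Q"
  by (rule run_Sq[where R = "\<lambda>s. s = (r, m(cell n i j := v))", OF run_Sto_val[OF assms(1-6)]]) (use assms(7) in auto)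

lemma run_If_val:
  assumes "val a r m x" "val b r m y" "x < y \<Longrightarrow> run M N c1 (r, m) Q" "\<not> x < y \<Longrightarrow> run M N c2 (r, m) Q"
  shows "run M N (Cond a b c1 c2) (r, m) Q"
  by (rule run_If) (use assms in \<open>auto simp: val_def\<close>)

lemma run_For':
  assumes n: "rn r" and x: "x \<notin> wr c" "x \<noteq> 0" "0 \<notin> wr c"
    and init: "I 0 (r(x := 0)) m"
    and body: "\<And>i r m. \<lbrakk>i < n; I i r m; r x = real i; rn r\<rbrakk> \<Longrightarrow>
      run M N c (r, m) (\<lambda>(r', m'). r' 0 = real n \<longrightarrow> r' x = real i \<longrightarrow> I (Suc i) (r'(x := real (Suc i))) m')"
    and post: "\<And>r m. \<lbrakk>I n r m; r x = real n; rn r\<rbrakk> \<Longrightarrow> Q (r, m)"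
  shows "run M N (For x c) (r, m) Q"
proof (rule run_For[where r = r and n = n and I = I])
  show "r 0 = real n" using n by simp
  fix i r m assume "i < n" "I i r m" "r x = real i" "r 0 = real n"
  then show "run M N c (r, m) (\<lambda>(r', m'). r' 0 = real n \<longrightarrow> r' x = real i \<longrightarrow> I (Suc i) (r'(x := real (Suc i))) m')"
    using body by simp
next
  fix r m assume "I n r m" "r x = real n" "r 0 = real n"
  then show "Q (r, m)" using post by simp
qed (use N x init in auto)

lemma run_push:
  assumes "rn r" "r x = enc n L" "RS m i S" "i < 11" "x \<noteq> 0" "x \<noteq> 4"
  shows "run M N (push x (int i)) (r, m) (\<lambda>s. fst s x = enc n (S # L) \<and> snd s = m)"
  unfolding push_def
proof (rule run_Sq[OF run_For'[where I = "\<lambda>j r' m'. r' x = pb n S j (enc n L) \<and> m' = m"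
      and Q = "\<lambda>s. fst s x = pb n S n (enc n L) \<and> snd s = m"]])
  show "rn r" by (rule assms(1))
next
  fix j r' m' assume j: "j < n" "r' x = pb n S j (enc n L) \<and> m' = m" "r' 4 = real j" "rn r'"
  have idx: "val (Minus (V 0) (Plus (V 4) (C 1))) r' m (real (n - Suc j))"
    by (rule val_cong[OF val_Minus[OF val_V0[OF j(4)] val_Plus[OF val_Vr val_C[OF refl]]]]) (use j in auto)
  have v: "val (Divide (Plus (V x) (Mat (C (int i)) (Minus (V 0) (Plus (V 4) (C 1))))) (C 2)) r' m
     ((pb n S j (enc n L) + (if n - Suc j \<in> S then 1 else 0)) / 2)"
    by (intro val_Divide val_Plus val_V val_C val_row[OF j(4) idx]) (use assms j in \<open>auto simp: RS_def\<close>)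
  show "run M N (Asg x (Divide (Plus (V x) (Mat (C (int i)) (Minus (V 0) (Plus (V 4) (C 1))))) (C 2))) (r', m')
    (\<lambda>(r'', m''). r'' 0 = real n \<longrightarrow> r'' 4 = real j \<longrightarrow> (r''(4 := real (Suc j))) x = pb n S (Suc j) (enc n L) \<and> m'' = m)"
    using v j assms by (intro run_Asg_val[where v = "(pb n S j (enc n L) + (if n - Suc j \<in> S then 1 else 0)) / 2"]) auto
next
  fix r' m' assume "fst (r', m') x = pb n S n (enc n L) \<and> snd (r', m') = m"
  then show "run M N (Asg x (Divide (Plus (C 1) (V x)) (C 2))) (r', m') (\<lambda>s. fst s x = enc n (S # L) \<and> snd s = m)"
    by (intro run_Asg_val[where v = "(1 + pb n S n (enc n L)) / 2"] val_Divide val_Plus val_V val_C) auto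
qed (use assms in auto)

lemma run_pop:
  assumes "rn r" "r x = enc n (S # L)" "i < 11" "x \<noteq> 0" "x \<noteq> 4"
  shows "run M N (pop x (int i)) (r, m) (\<lambda>s. fst s x = enc n L \<and> RS (snd s) i S \<and> same_out {i} (snd s) m)"
  unfolding pop_def
proof (rule run_Asg_Sq)
  show "val (Minus (Times (C 2) (V x)) (C 1)) r m (pb n S n (enc n L))"
    by (rule val_cong[OF val_Minus[OF val_Times[OF val_C[OF refl] val_Vr] val_C[OF refl]]]) (use assms in simp)
  define r1 where "r1 = r(x := pb n S n (enc n L))"
  have r1: "r1 0 = real n" "r1 x = pb n S n (enc n L)" using assms by (auto simp: r1_def)
  \<comment> \<open>After \<open>j\<close> bits have been read, the number left is the one that
    \<open>push\<close> had built after \<open>n - j\<close> of its steps, because the elements were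
    prepended in decreasing order.\<close>
  let ?I = "\<lambda>j (r'::nat\<Rightarrow>real) m'. r' x = pb n S (n - j) (enc n L) \<and> same_out {i} m' m \<and>
     (\<forall>j'<j. m' (cell n i j') = (if j' \<in> S then 1 else 0))"
  show "run M N (For 4 (Sq (Asg x (Times (C 2) (V x)))
       (Cond (V x) (C 1) (Sto (C (int i)) (V 4) (C 0)) (Sq (Sto (C (int i)) (V 4) (C 1)) (Asg x (Minus (V x) (C 1))))))) (r(x := pb n S n (enc n L)), m)
     (\<lambda>s. fst s x = enc n L \<and> RS (snd s) i S \<and> same_out {i} (snd s) m)"
    unfolding r1_def[symmetric]
  proof (rule run_For'[where I = ?I])
    fix j r' m' assume j: "j < n" "?I j r' m'" "r' 4 = real j" "rn r'"
    let ?y = "pb n S (n - Suc j) (enc n L)" let ?b = "if j \<in> S then 1 else 0 :: real"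
    have nj: "n - j = Suc (n - Suc j)" "n - Suc (n - Suc j) = j" using j by auto
    have x: "r' x = (?y + ?b) / 2" using j(2) unfolding nj(1) pb.simps nj(2) by simp
    \<comment> \<open>By these bounds \<open>?y + ?b\<close> is below \<open>1\<close> exactly when
      the bit \<open>?b\<close> is \<open>0\<close>.\<close>
    have y: "0 \<le> ?y" "?y < 1" using pb_bounds[of "enc n L" n S] enc_bounds[of n L] by auto
    define r2 where "r2 = r'(x := ?y + ?b)"
    have r2: "r2 x = ?y + ?b" "r2 4 = real j" "rn r2" using j assms by (auto simp: r2_def)
    have v1: "val (V x) r2 m'' (?y + ?b)" and v2: "val (V 4) r2 m'' (real j)" for m''
      using r2 by (simp_all add: val_def)
    have so: "same_out {i} (m'(cell n i j := v)) m" for v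
      using j by (intro same_out_upd) auto
    have cells: "(m'(cell n i j := ?b)) (cell n i j') = (if j' \<in> S then 1 else 0)" if "j' < Suc j" for j'
      using that j by (cases "j' = j") auto
    show "run M N (Sq (Asg x (Times (C 2) (V x)))
       (Cond (V x) (C 1) (Sto (C (int i)) (V 4) (C 0)) (Sq (Sto (C (int i)) (V 4) (C 1)) (Asg x (Minus (V x) (C 1)))))) (r', m')
       (\<lambda>(r'', m''). r'' 0 = real n \<longrightarrow> r'' 4 = real j \<longrightarrow> ?I (Suc j) (r''(4 := real (Suc j))) m'')"
    proof (rule run_Asg_Sq)
      show "val (Times (C 2) (V x)) r' m' (?y + ?b)"
        by (rule val_cong[OF val_Times[OF val_C[OF refl] val_Vr]]) (use x in simp)
      show "run M N (Cond (V x) (C 1) (Sto (C (int i)) (V 4) (C 0)) (Sq (Sto (C (int i)) (V 4) (C 1)) (Asg x (Minus (V x) (C 1))))) (r'(x := ?y + ?b), m')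
       (\<lambda>(r'', m''). r'' 0 = real n \<longrightarrow> r'' 4 = real j \<longrightarrow> ?I (Suc j) (r''(4 := real (Suc j))) m'')"
        unfolding r2_def[symmetric]
      proof (rule run_If_val[OF v1 val_C])
        show "real_of_int 1 = 1" by simp
        assume "?y + ?b < 1"
        then have jS: "j \<notin> S" "?b = 0" using y by (auto split: if_splits)
        show "run M N (Sto (C (int i)) (V 4) (C 0)) (r2, m')
          (\<lambda>(r'', m''). r'' 0 = real n \<longrightarrow> r'' 4 = real j \<longrightarrow> ?I (Suc j) (r''(4 := real (Suc j))) m'')"
          by (rule run_Sto_val[OF r2(3) val_C v2 val_C, where v = ?b])
             (use assms j jS r2 so cells in auto)
      next
        assume "\<not> ?y + ?b < 1"
        then have jS: "j \<in> S" "?b = 1" using y by (auto split: if_splits)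
        show "run M N (Sq (Sto (C (int i)) (V 4) (C 1)) (Asg x (Minus (V x) (C 1)))) (r2, m')
          (\<lambda>(r'', m''). r'' 0 = real n \<longrightarrow> r'' 4 = real j \<longrightarrow> ?I (Suc j) (r''(4 := real (Suc j))) m'')"
          by (rule run_Sto_Sq[OF r2(3) val_C v2 val_C, where v = ?b and i = i], (use assms j jS in auto)[4],
              rule run_Asg_val[OF val_Minus[OF v1 val_C[OF refl]]])
             (use assms jS so cells in auto)
      qed
    qed
  next
    fix r' m' assume "?I n r' m'"
    then show "fst (r', m') x = enc n L \<and> RS (snd (r', m')) i S \<and> same_out {i} (snd (r', m')) m"
      by (auto simp: RS_def)
  qed (use assms r1 N same_out_refl in auto)
qed

lemma run_copy:
  assumes "rn r" "RS m j S" "i < 11" "j < 11" "i \<noteq> j"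
  shows "run M N (copy (int i) (int j)) (r, m) (\<lambda>s. RS (snd s) i S \<and> same_out {i} (snd s) m)"
  unfolding copy_def
proof (rule run_For'[where I = "\<lambda>h r' m'. same_out {i} m' m \<and> (\<forall>h'<h. m' (cell n i h') = (if h' \<in> S then 1 else 0))"])
  fix h r' m' assume h: "h < n" "same_out {i} m' m \<and> (\<forall>h'<h. m' (cell n i h') = (if h' \<in> S then 1 else 0))"
    "r' 4 = real h" "rn r'"
  have v4: "val (V 4) r' m' (real h)" using h by (simp add: val_def)
  have v: "val (Mat (C (int j)) (V 4)) r' m' (if h \<in> S then 1 else 0)"
    by (rule val_row[OF h(4) v4]) (use h assms in \<open>auto simp: same_out_def RS_def\<close>)
  show "run M N (Sto (C (int i)) (V 4) (Mat (C (int j)) (V 4))) (r', m')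
     (\<lambda>(r'', m''). r'' 0 = real n \<longrightarrow> r'' 4 = real h \<longrightarrow> same_out {i} m'' m \<and> (\<forall>h'<Suc h. m'' (cell n i h') = (if h' \<in> S then 1 else 0)))"
    by (rule run_Sto_val[OF h(4) val_C v4 v]) (use h assms same_out_upd in \<open>auto simp: less_Suc_eq\<close>)
qed (use assms N same_out_refl in \<open>auto simp: RS_def\<close>)

lemma run_union:
  assumes "rn r" "RS m 8 S" "RS m 9 S'"
  shows "run M N unionc (r, m) (\<lambda>s. RS (snd s) 7 (S \<union> S') \<and> same_out {7} (snd s) m)"
  unfolding unionc_def
proof (rule run_For'[where I = "\<lambda>h r' m'. same_out {7} m' m \<and> (\<forall>h'<h. m' (cell n 7 h') = (if h' \<in> S \<union> S' then 1 else 0))"])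
  fix h r' m' assume h: "h < n" "same_out {7} m' m \<and> (\<forall>h'<h. m' (cell n 7 h') = (if h' \<in> S \<union> S' then 1 else 0))"
    "r' 4 = real h" "rn r'"
  have v4: "val (V 4) r' m' (real h)" using h by (simp add: val_def)
  have v8: "val (Mat (C 8) (V 4)) r' m' (if h \<in> S then 1 else 0)"
    by (rule val_rown[OF h(4) v4]) (use h assms in \<open>auto simp: same_out_def RS_def\<close>)
  have v9: "val (Mat (C 9) (V 4)) r' m' (if h \<in> S' then 1 else 0)"
    by (rule val_rown[OF h(4) v4]) (use h assms in \<open>auto simp: same_out_def RS_def\<close>)
  have v: "val (Ite (C 0) (Plus (Mat (C 8) (V 4)) (Mat (C 9) (V 4))) (C 1) (C 0)) r' m' (if h \<in> S \<union> S' then 1 else 0)"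
    by (rule val_cong[OF val_Ite[OF val_C[OF refl] val_Plus[OF v8 v9] val_C[OF refl] val_C[OF refl]]]) auto
  show "run M N (Sto (C 7) (V 4) (Ite (C 0) (Plus (Mat (C 8) (V 4)) (Mat (C 9) (V 4))) (C 1) (C 0))) (r', m')
     (\<lambda>(r'', m''). r'' 0 = real n \<longrightarrow> r'' 4 = real h \<longrightarrow> same_out {7} m'' m \<and> (\<forall>h'<Suc h. m'' (cell n 7 h') = (if h' \<in> S \<union> S' then 1 else 0)))"
    by (rule run_Sto_val[OF h(4) val_C v4 v, where i = 7]) (use h assms same_out_upd in \<open>auto simp: less_Suc_eq\<close>)
qed (use assms N same_out_refl in \<open>auto simp: RS_def\<close>)

end


section \<open>Merging two lists\<close>

text \<open>Row \<open>7\<close> holds the candidate, with size, profile and \<open>J\<close> in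
  registers \<open>18\<close>, \<open>19\<close>, \<open>20\<close>; row \<open>10\<close> and
  registers \<open>21\<close>, \<open>22\<close>, \<open>23\<close> do the same for the set just
  popped. Register \<open>11\<close> is the list being scanned, \<open>12\<close> the one being
  built, \<open>24\<close> the flag for equal signatures. When the candidate changes, only its
  \<open>J\<close> has to be updated.\<close>

definition ins_body :: com where
  "ins_body = Sq (pop 11 10) (Sq (Asg 21 (cardx 10)) (Sq (Asg 22 (profx 10))
     (Sq (Asg 24 (EqI (V 21) (V 18) (EqI (V 22) (V 19) (C 1) (C 0)) (C 0)))
     (Cond (C 0) (V 24)
        (Sq (Asg 23 (Jx 10)) (Cond (V 23) (V 20) (Sq (copy 7 10) (Asg 20 (V 23))) Skip))
        (push 12 10)))))"

definition insc :: com where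
  "insc = Sq (Asg 18 (cardx 7)) (Sq (Asg 19 (profx 7)) (Sq (Asg 20 (Jx 7)) (Sq (Asg 11 (V 10)) (Sq (Asg 12 (C 0))
     (Sq (Wh (C 0) (V 11) ins_body) (Sq (push 12 7) (Asg 10 (V 12))))))))"

definition addc :: com where
  "addc = Cond (V 2) (cardx 7) Skip (Cond (C 0) (badx 7) Skip insc)"

definition mrg_inner :: com where
  "mrg_inner = Sq (pop 9 9) (Sq unionc addc)"

text \<open>Popping consumes the copy in register \<open>9\<close> but not row \<open>5\<close>, so
  the list of the child is loaded afresh for every set in the list of the parent.\<close>

definition mrg_body :: com where
  "mrg_body = Sq (pop 8 8) (Sq (Asg 9 (Mat (C 5) (V 6))) (Wh (C 0) (V 9) mrg_inner))"

definition mrgc :: com where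
  "mrgc = Sq (Asg 8 (Mat (C 5) (V 7))) (Sq (Asg 10 (C 0)) (Sq (Wh (C 0) (V 8) mrg_body) (Sto (C 5) (V 7) (V 10))))"

text \<open>A sum serves as a search: by uniqueness of the parent at most one summand is nonzero,
  and its value is the index sought.\<close>

definition parx :: aexp where
  "parx = Sm 30 (EqI (Dx (V 6) (V 30)) (C 1) (EqI (Dx (C 0) (V 6)) (Plus (Dx (C 0) (V 30)) (C 1)) (V 30) (C 0)) (C 0))"

definition repc :: com where
  "repc = For 4 (Sto (C 4) (V 4) (EqI (Mat (C 4) (V 4)) (V 6) (V 7) (Mat (C 4) (V 4))))"

definition stepc :: com where
  "stepc = Sq (Asg 7 parx) (Sq repc mrgc)"

text \<open>The two inner comparisons leave only \<open>d 0 c = l\<close>, and the outer one removes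
  depth \<open>0\<close>, that is, the root.\<close>

definition innerc :: com where
  "innerc = Cond (C 0) (V 13) (Cond (Dx (C 0) (V 6)) (V 13) Skip (Cond (V 13) (Dx (C 0) (V 6)) Skip stepc)) Skip"

definition mainc :: com where
  "mainc = For 5 (Sq (Asg 13 (Minus (V 0) (Plus (V 5) (C 1)))) (For 6 innerc))"

definition final_body :: com where
  "final_body = Sq (pop 8 8) (Asg 1 (EqI (cardx 8) (V 2) (Ite (V 3) (Jx 8) (V 1) (C 1)) (V 1)))"

definition finalc :: com where
  "finalc = Sq (Asg 8 (Mat (C 5) (C 0))) (Sq (Asg 1 (C 0)) (Wh (C 0) (V 8) final_body))"

lemma wr_push [simp]: "wr (push x i) = {4, x}" by (auto simp: push_def)
lemma wr_pop [simp]: "wr (pop x i) = {4, x}" by (auto simp: pop_def)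
lemma wr_copy [simp]: "wr (copy i j) = {4}" by (auto simp: copy_def)
lemma wr_union [simp]: "wr unionc = {4}" by (auto simp: unionc_def)
lemma wr_ins_body [simp]: "wr ins_body = {4, 11, 12, 20, 21, 22, 23, 24}" by (auto simp: ins_body_def)
lemma wr_insc [simp]: "wr insc = {4, 10, 11, 12, 18, 19, 20, 21, 22, 23, 24}" by (auto simp: insc_def)
lemma wr_addc [simp]: "wr addc = {4, 10, 11, 12, 18, 19, 20, 21, 22, 23, 24}" by (auto simp: addc_def)
lemma wr_mrg_inner [simp]: "wr mrg_inner = {4, 9, 10, 11, 12, 18, 19, 20, 21, 22, 23, 24}" by (auto simp: mrg_inner_def)
lemma wr_mrg_body [simp]: "wr mrg_body = {4, 8, 9, 10, 11, 12, 18, 19, 20, 21, 22, 23, 24}" by (auto simp: mrg_body_def)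
lemma wr_mrgc [simp]: "wr mrgc = {4, 8, 9, 10, 11, 12, 18, 19, 20, 21, 22, 23, 24}" by (auto simp: mrgc_def)
lemma wr_repc [simp]: "wr repc = {4}" by (auto simp: repc_def)
lemma wr_stepc [simp]: "wr stepc = {4, 7, 8, 9, 10, 11, 12, 18, 19, 20, 21, 22, 23, 24}" by (auto simp: stepc_def)
lemma wr_innerc [simp]: "wr innerc = {4, 7, 8, 9, 10, 11, 12, 18, 19, 20, 21, 22, 23, 24}" by (auto simp: innerc_def)
lemma wr_final_body [simp]: "wr final_body = {1, 4, 8}" by (auto simp: final_body_def)

lemma run_Sq_post:
  assumes "run M N c1 (r, m) R"
    "\<And>r' m'. \<lbrakk>R (r', m'); \<And>y. y \<notin> wr c1 \<Longrightarrow> r' y = r y\<rbrakk> \<Longrightarrow> run M N c2 (r', m') Q"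
  shows "run M N (Sq c1 c2) (r, m) Q"
  by (rule run_Sq[OF run_frame[OF assms(1)]]) (use assms(2) in auto)

lemma run_while:
  assumes "I 0 (r, m)"
    "\<And>i r' m'. \<lbrakk>I i (r', m'); \<And>y. y \<notin> wr c \<Longrightarrow> r' y = r y; 0 < r' x\<rbrakk> \<Longrightarrow> i < N \<and> run M N c (r', m') (I (Suc i))"
    "\<And>i r' m'. \<lbrakk>I i (r', m'); \<And>y. y \<notin> wr c \<Longrightarrow> r' y = r y; \<not> 0 < r' x\<rbrakk> \<Longrightarrow> Q (r', m')"
  shows "run M N (Wh (C 0) (V x) c) (r, m) Q"
proof (rule run_Wh[where I = "\<lambda>i s. I i s \<and> (\<forall>y. y \<notin> wr c \<longrightarrow> fst s y = r y)"])
  fix i r' m' assume *: "I i (r', m') \<and> (\<forall>y. y \<notin> wr c \<longrightarrow> fst (r', m') y = r y)" "ev (C 0) r' m' < ev (V x) r' m'"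
  then have fr: "r' y = r y" if "y \<notin> wr c" for y using that by simp
  from * have h: "i < N" "run M N c (r', m') (I (Suc i))" using assms(2)[of i r' m'] fr by simp_all
  have "run M N c (r', m') (\<lambda>s. I (Suc i) s \<and> (\<forall>y. y \<notin> wr c \<longrightarrow> fst s y = r y))"
  proof (rule run_post[OF h(2)])
    fix r'' m'' assume "I (Suc i) (r'', m'')" "\<And>y. y \<notin> wr c \<Longrightarrow> r'' y = r' y"
    then show "I (Suc i) (r'', m'') \<and> (\<forall>y. y \<notin> wr c \<longrightarrow> fst (r'', m'') y = r y)" using fr by simp
  qed
  with h(1) show "i < N \<and> run M N c (r', m') (\<lambda>s. I (Suc i) s \<and> (\<forall>y. y \<notin> wr c \<longrightarrow> fst s y = r y))" by blast
next
  fix i r' m' assume *: "I i (r', m') \<and> (\<forall>y. y \<notin> wr c \<longrightarrow> fst (r', m') y = r y)" "\<not> ev (C 0) r' m' < ev (V x) r' m'"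
  then show "Q (r', m')" using assms(3)[of i r' m'] by simp
qed (use assms(1) in auto)

context machine
begin

lemma run_For_mem:
  assumes "rn r" and x: "x \<notin> wr c" "x \<noteq> 0" "0 \<notin> wr c" and init: "I 0 m"
    and body: "\<And>i r' m'. \<lbrakk>i < n; I i m'; r' x = real i; rn r'; \<And>y. y \<notin> insert x (wr c) \<Longrightarrow> r' y = r y\<rbrakk> \<Longrightarrow>
      run M N c (r', m') (\<lambda>s. I (Suc i) (snd s))"
    and post: "\<And>r' m'. \<lbrakk>I n m'; \<And>y. y \<notin> insert x (wr c) \<Longrightarrow> r' y = r y\<rbrakk> \<Longrightarrow> Q (r', m')"
  shows "run M N (For x c) (r, m) Q"
proof (rule run_For'[where I = "\<lambda>i r' m'. I i m' \<and> (\<forall>y. y \<notin> insert x (wr c) \<longrightarrow> r' y = r y)"])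
  fix i r' m' assume *: "i < n" "I i m' \<and> (\<forall>y. y \<notin> insert x (wr c) \<longrightarrow> r' y = r y)" "r' x = real i" "rn r'"
  then have fr: "r' y = r y" if "y \<notin> insert x (wr c)" for y using that by simp
  have "run M N c (r', m') (\<lambda>s. I (Suc i) (snd s))" by (rule body) (use * fr in simp_all)
  then show "run M N c (r', m') (\<lambda>(r'', m''). r'' 0 = real n \<longrightarrow> r'' x = real i \<longrightarrow>
      I (Suc i) m'' \<and> (\<forall>y. y \<notin> insert x (wr c) \<longrightarrow> (r''(x := real (Suc i))) y = r y))"
  proof (rule run_post)
    fix r'' m'' assume a: "I (Suc i) (snd (r'', m''))" "\<And>y. y \<notin> wr c \<Longrightarrow> r'' y = r' y"
    have "(r''(x := real (Suc i))) y = r y" if "y \<notin> insert x (wr c)" for y using a(2)[of y] fr[OF that] that by simp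
    with a(1) show "case (r'', m'') of (r'', m'') \<Rightarrow> r'' 0 = real n \<longrightarrow> r'' x = real i \<longrightarrow>
      I (Suc i) m'' \<and> (\<forall>y. y \<notin> insert x (wr c) \<longrightarrow> (r''(x := real (Suc i))) y = r y)" by simp
  qed
next
  fix r' m' assume "I n m' \<and> (\<forall>y. y \<notin> insert x (wr c) \<longrightarrow> r' y = r y)"
  then show "Q (r', m')" using post[of m' r'] by blast
qed (use assms(1) x init in simp_all)

lemmas run_pop10 = run_pop[where i = 10, unfolded of_nat_numeral]
  and run_pop9 = run_pop[where i = 9, unfolded of_nat_numeral]
  and run_pop8 = run_pop[where i = 8, unfolded of_nat_numeral]
  and run_push10 = run_push[where i = 10, unfolded of_nat_numeral]
  and run_push7 = run_push[where i = 7, unfolded of_nat_numeral]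
  and run_copy7 = run_copy[where i = 7 and j = 10, unfolded of_nat_numeral]
  and val_cardx10 = val_cardx[where i = 10, unfolded of_nat_numeral]
  and val_cardx8 = val_cardx[where i = 8, unfolded of_nat_numeral]
  and val_cardx7 = val_cardx[where i = 7, unfolded of_nat_numeral]
  and val_profx10 = val_profx[where i = 10, unfolded of_nat_numeral]
  and val_profx7 = val_profx[where i = 7, unfolded of_nat_numeral]
  and val_Jx10 = val_Jx[where i = 10, unfolded of_nat_numeral]
  and val_Jx8 = val_Jx[where i = 8, unfolded of_nat_numeral]
  and val_Jx7 = val_Jx[where i = 7, unfolded of_nat_numeral]
  and val_badx7 = val_badx[where i = 7, unfolded of_nat_numeral]

lemma val_C0: "val (C 0) r m 0"
  by (simp add: val_def)

text \<open>The equation between the two folds says that the remaining rounds, started from the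
  present candidate and output, lead to the final result; the part already scanned is remembered
  only through it.\<close>

definition ins_inv :: "nat set \<Rightarrow> nat \<Rightarrow> nat set \<Rightarrow> nat set list \<Rightarrow> (nat \<Rightarrow> real) \<Rightarrow> nat \<Rightarrow> state \<Rightarrow> bool" where
  "ins_inv Cl p U R m0 i s \<longleftrightarrow> (\<exists>Zs cur new. i + length Zs = length R \<and> fst s 11 = enc n Zs \<and> fst s 12 = enc n new \<and>
     RS (snd s) 7 cur \<and> cur \<subseteq> {..<n} \<and> (\<forall>W\<in>set Zs. W \<subseteq> {..<n}) \<and> fst s 18 = real (card cur) \<and>
     fst s 19 = real (prof Cl p cur) \<and> fst s 20 = J cur \<and>
     foldl (ins_step Cl p) (cur, new) Zs = foldl (ins_step Cl p) (U, []) R \<and> same_out {7, 10} (snd s) m0)"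

lemma run_ins_body:
  assumes I: "ins_inv (cl rep p) p U R m0 i (r, m)" and r: "rn r" "r 7 = real p" "0 < r 11" "p < n"
    and m0: "DM m0" "RP m0 rep" "PW m0"
  shows "i < length R \<and> run M N ins_body (r, m) (ins_inv (cl rep p) p U R m0 (Suc i))"
proof -
  let ?C = "cl rep p"
  obtain Zs cur new where Z: "i + length Zs = length R" "r 11 = enc n Zs" "r 12 = enc n new"
     "RS m 7 cur" "cur \<subseteq> {..<n}" "\<forall>W\<in>set Zs. W \<subseteq> {..<n}" "r 18 = real (card cur)"
     "r 19 = real (prof ?C p cur)" "r 20 = J cur"
     "foldl (ins_step ?C p) (cur, new) Zs = foldl (ins_step ?C p) (U, []) R" "same_out {7, 10} m m0"
    using I unfolding ins_inv_def by auto
  obtain W Zs' where W: "Zs = W # Zs'" using r(3) Z(2) enc_pos[of n Zs] by (cases Zs) auto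
  have WV: "W \<subseteq> {..<n}" "\<forall>W\<in>set Zs'. W \<subseteq> {..<n}" using Z(6) W by auto
  have fs: "foldl (ins_step ?C p) (ins_step ?C p (cur, new) W) Zs' = foldl (ins_step ?C p) (U, []) R"
    using Z(10) W by simp
  have "run M N ins_body (r, m) (ins_inv ?C p U R m0 (Suc i))"
    unfolding ins_body_def
  proof (rule run_Sq_post[OF run_pop10])
    show "rn r" "r 11 = enc n (W # Zs')" using r Z W by auto
    fix r1 m1
    assume *: "fst (r1, m1) 11 = enc n Zs' \<and> RS (snd (r1, m1)) 10 W \<and> same_out {10} (snd (r1, m1)) m"
      and f: "\<And>y. y \<notin> wr (pop 11 10) \<Longrightarrow> r1 y = r y"
    have r1: "r1 11 = enc n Zs'" "r1 12 = enc n new" "r1 18 = real (card cur)" "r1 19 = real (prof ?C p cur)"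
      "r1 20 = J cur" "r1 7 = real p" "r1 0 = real n" using * f Z r by auto
    have m1: "RS m1 10 W" "RS m1 7 cur" "same_out {7, 10} m1 m0"
      using * Z(4,11) same_out_rows(5)[of "{10}" m1 m 7 cur] same_out_trans[of "{10}" m1 m "{7, 10}" m0 "{7, 10}"] by auto
    have G: "DM m1" "RP m1 rep" "PW m1" using same_out_rows[OF m1(3)] m0 by auto
    define r2 where "r2 = r1(21 := real (card W))"
    define r3 where "r3 = r2(22 := real (prof ?C p W))"
    define fl where "fl = (if real (card W) = real (card cur) then (if real (prof ?C p W) = real (prof ?C p cur) then 1 else 0) else 0 :: real)"
    have fl: "0 < fl \<longleftrightarrow> sig ?C p W = sig ?C p cur" by (auto simp: fl_def sig_def)
    define r4 where "r4 = r3(24 := fl)"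
    have r4: "r4 11 = enc n Zs'" "r4 12 = enc n new" "r4 18 = real (card cur)" "r4 19 = real (prof ?C p cur)"
      "r4 20 = J cur" "r4 7 = real p" "rn r4" "r4 24 = fl" using r1 by (auto simp: r4_def r3_def r2_def)
    have v1: "val (cardx 10) r1 m1 (real (card W))" by (rule val_cardx10) (use r1 m1 WV in auto)
    have v2: "val (profx 10) r2 m1 (real (prof ?C p W))" by (rule val_profx10) (use r1 m1 WV G r in \<open>auto simp: r2_def\<close>)
    have v3: "val (EqI (V 21) (V 18) (EqI (V 22) (V 19) (C 1) (C 0)) (C 0)) r3 m1 fl"
      unfolding fl_def by (intro val_EqI val_V val_C) (use r1 in \<open>auto simp: r3_def r2_def\<close>)
    have main: "run M N (Cond (C 0) (V 24)
        (Sq (Asg 23 (Jx 10)) (Cond (V 23) (V 20) (Sq (copy 7 10) (Asg 20 (V 23))) Skip))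
        (push 12 10)) (r4, m1) (ins_inv ?C p U R m0 (Suc i))"
    proof (rule run_If_val[OF val_C0 val_Vr])
      assume "0 < r4 24"
      then have sg: "sig ?C p W = sig ?C p cur" using fl r4 by simp
      define r5 where "r5 = r4(23 := J W)"
      have r5: "r5 11 = enc n Zs'" "r5 12 = enc n new" "r5 18 = real (card cur)" "r5 19 = real (prof ?C p cur)"
        "r5 20 = J cur" "r5 7 = real p" "rn r5" "r5 23 = J W" using r4 by (auto simp: r5_def)
      have v: "val (Jx 10) r4 m1 (J W)" by (rule val_Jx10) (use r4 m1 WV G in auto)
      show "run M N (Sq (Asg 23 (Jx 10)) (Cond (V 23) (V 20) (Sq (copy 7 10) (Asg 20 (V 23))) Skip)) (r4, m1) (ins_inv ?C p U R m0 (Suc i))"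
      proof (rule run_Asg_Sq[OF v], fold r5_def, rule run_If_val[OF val_Vr val_Vr])
        assume "r5 23 < r5 20"
        then have st: "ins_step ?C p (cur, new) W = (W, new)" using r5 sg by (simp add: ins_step_def)
        show "run M N (Sq (copy 7 10) (Asg 20 (V 23))) (r5, m1) (ins_inv ?C p U R m0 (Suc i))"
        proof (rule run_Sq_post[OF run_copy7])
          show "rn r5" "RS m1 10 W" using r5 m1 by auto
          fix r6 m6 assume *: "RS (snd (r6, m6)) 7 W \<and> same_out {7} (snd (r6, m6)) m1"
            and f: "\<And>y. y \<notin> wr (copy 7 10) \<Longrightarrow> r6 y = r5 y"
          have so: "same_out {7, 10} m6 m0" using * same_out_trans[OF _ m1(3), of "{7}" m6] by auto
          show "run M N (Asg 20 (V 23)) (r6, m6) (ins_inv ?C p U R m0 (Suc i))"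
          proof (rule run_Asg_val[OF val_Vr])
            show "ins_inv ?C p U R m0 (Suc i) (r6(20 := r6 23), m6)"
              unfolding ins_inv_def
              by (rule exI[of _ Zs'], rule exI[of _ W], rule exI[of _ new])
                 (use * f r5 so fs st WV Z(1) W sg in \<open>auto simp: sig_def\<close>)
          qed
        qed auto
      next
        assume "\<not> r5 23 < r5 20"
        then have st: "ins_step ?C p (cur, new) W = (cur, new)" using r5 sg by (simp add: ins_step_def)
        show "run M N Skip (r5, m1) (ins_inv ?C p U R m0 (Suc i))"
        proof (rule run_Skip)
          show "ins_inv ?C p U R m0 (Suc i) (r5, m1)"
            unfolding ins_inv_def
            by (rule exI[of _ Zs'], rule exI[of _ cur], rule exI[of _ new])
               (use r5 m1 fs st WV Z(1,5) W in auto)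
        qed
      qed
    next
      assume "\<not> 0 < r4 24"
      then have st: "ins_step ?C p (cur, new) W = (cur, W # new)" using fl r4 by (simp add: ins_step_def)
      show "run M N (push 12 10) (r4, m1) (ins_inv ?C p U R m0 (Suc i))"
      proof (rule run_post[OF run_push10])
        show "rn r4" "r4 12 = enc n new" "RS m1 10 W" using r4 m1 by auto
        fix r6 m6 assume *: "fst (r6, m6) 12 = enc n (W # new) \<and> snd (r6, m6) = m1"
          and f: "\<And>y. y \<notin> wr (push 12 10) \<Longrightarrow> r6 y = r4 y"
        show "ins_inv ?C p U R m0 (Suc i) (r6, m6)"
          unfolding ins_inv_def
          by (rule exI[of _ Zs'], rule exI[of _ cur], rule exI[of _ "W # new"])
             (use * f r4 m1 fs st WV Z(1,5) W in auto)
      qed auto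
    qed
    show "run M N (Sq (Asg 21 (cardx 10)) (Sq (Asg 22 (profx 10))
     (Sq (Asg 24 (EqI (V 21) (V 18) (EqI (V 22) (V 19) (C 1) (C 0)) (C 0)))
     (Cond (C 0) (V 24)
        (Sq (Asg 23 (Jx 10)) (Cond (V 23) (V 20) (Sq (copy 7 10) (Asg 20 (V 23))) Skip))
        (push 12 10))))) (r1, m1) (ins_inv ?C p U R m0 (Suc i))"
      by (rule run_Asg_Sq[OF v1], fold r2_def, rule run_Asg_Sq[OF v2], fold r3_def, rule run_Asg_Sq[OF v3], fold r4_def, rule main)
  qed auto
  moreover have "i < length R" using Z(1) W by simp
  ultimately show ?thesis by blast
qed

lemma run_insc:
  assumes r: "rn r" "r 7 = real p" "p < n" "r 10 = enc n R" and m: "DM m" "RP m rep" "PW m" "RS m 7 U"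
    and R: "U \<subseteq> {..<n}" "\<forall>W\<in>set R. W \<subseteq> {..<n}" "length R \<le> N"
  shows "run M N insc (r, m) (\<lambda>s. fst s 10 = enc n (ins (cl rep p) p U R) \<and> same_out {7, 10} (snd s) m)"
proof -
  let ?C = "cl rep p"
  define r1 where "r1 = r(18 := real (card U))"
  define r2 where "r2 = r1(19 := real (prof ?C p U))"
  define r3 where "r3 = r2(20 := J U)"
  define r4 where "r4 = r3(11 := enc n R)"
  define r5 where "r5 = r4(12 := 0)"
  have v1: "val (cardx 7) r m (real (card U))" by (rule val_cardx7) (use r m R in auto)
  have v2: "val (profx 7) r1 m (real (prof ?C p U))" by (rule val_profx7) (use r m R in \<open>auto simp: r1_def\<close>)
  have v3: "val (Jx 7) r2 m (J U)" by (rule val_Jx7) (use r m R in \<open>auto simp: r1_def r2_def\<close>)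
  have v4: "val (V 10) r3 m (enc n R)" by (rule val_V) (use r in \<open>auto simp: r1_def r2_def r3_def\<close>)
  have r5: "r5 11 = enc n R" "r5 12 = 0" "r5 18 = real (card U)" "r5 19 = real (prof ?C p U)" "r5 20 = J U"
     "r5 7 = real p" "r5 0 = real n"
    using r by (auto simp: r5_def r4_def r3_def r2_def r1_def)
  have "run M N (Sq (Wh (C 0) (V 11) ins_body) (Sq (push 12 7) (Asg 10 (V 12)))) (r5, m)
     (\<lambda>s. fst s 10 = enc n (ins ?C p U R) \<and> same_out {7, 10} (snd s) m)"
  proof (rule run_Sq_post[OF run_while[where I = "ins_inv ?C p U R m" and
        Q = "\<lambda>s. \<exists>i. ins_inv ?C p U R m i s \<and> \<not> 0 < fst s 11 \<and> rn (fst s)"]])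
    show "ins_inv ?C p U R m 0 (r5, m)" unfolding ins_inv_def
      by (rule exI[of _ R], rule exI[of _ U], rule exI[of _ "[]"]) (use r5 m R same_out_refl in auto)
  next
    fix i r' m' assume *: "ins_inv ?C p U R m i (r', m')" "\<And>y. y \<notin> wr ins_body \<Longrightarrow> r' y = r5 y" "0 < r' 11"
    have "i < length R \<and> run M N ins_body (r', m') (ins_inv ?C p U R m (Suc i))"
      by (rule run_ins_body[OF *(1)]) (use * r5 r m in auto)
    then show "i < N \<and> run M N ins_body (r', m') (ins_inv ?C p U R m (Suc i))" using R(3) by auto
  next
    fix i r' m' assume "ins_inv ?C p U R m i (r', m')" "\<And>y. y \<notin> wr ins_body \<Longrightarrow> r' y = r5 y" "\<not> 0 < r' 11"
    then show "\<exists>i. ins_inv ?C p U R m i (r', m') \<and> \<not> 0 < fst (r', m') 11 \<and> rn (fst (r', m'))" using r5 by auto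
  next
    fix r' m' assume "\<exists>i. ins_inv ?C p U R m i (r', m') \<and> \<not> 0 < fst (r', m') 11 \<and> rn (fst (r', m'))"
    then obtain Zs cur new where Z: "r' 11 = enc n Zs" "r' 12 = enc n new" "RS m' 7 cur"
       "foldl (ins_step ?C p) (cur, new) Zs = foldl (ins_step ?C p) (U, []) R" "same_out {7, 10} m' m" "\<not> 0 < r' 11" "rn r'"
      unfolding ins_inv_def by auto
    have "Zs = []" using Z(1,6) enc_pos[of n Zs] by auto
    then have ins: "ins ?C p U R = cur # new" using Z(4) by (simp add: ins_def flip: Z(4))
    show "run M N (Sq (push 12 7) (Asg 10 (V 12))) (r', m') (\<lambda>s. fst s 10 = enc n (ins ?C p U R) \<and> same_out {7, 10} (snd s) m)"
    proof (rule run_Sq_post[OF run_push7])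
      show "rn r'" "r' 12 = enc n new" "RS m' 7 cur" using Z by auto
      fix r6 :: "nat \<Rightarrow> real" and m6 assume *: "fst (r6, m6) 12 = enc n (cur # new) \<and> snd (r6, m6) = m'"
      show "run M N (Asg 10 (V 12)) (r6, m6) (\<lambda>s. fst s 10 = enc n (ins ?C p U R) \<and> same_out {7, 10} (snd s) m)"
        by (rule run_Asg_val[OF val_Vr]) (use * Z ins in auto)
    qed auto
  qed
  then show ?thesis unfolding insc_def
    by (intro run_Asg_Sq[OF v1] run_Asg_Sq[OF v2, unfolded r1_def] run_Asg_Sq[OF v3, unfolded r2_def r1_def]
       run_Asg_Sq[OF v4, unfolded r3_def r2_def r1_def] run_Asg_Sq[OF val_C0]) (simp add: r5_def r4_def r3_def r2_def r1_def)
qed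

lemma run_addc:
  assumes r: "rn r" "r 7 = real p" "p < n" "r 10 = enc n R" "r 2 = of_int k" and m: "DM m" "RP m rep" "PW m" "RS m 7 U"
    and R: "U \<subseteq> {..<n}" "\<forall>W\<in>set R. W \<subseteq> {..<n}" "length R \<le> N"
  shows "run M N addc (r, m) (\<lambda>s. fst s 10 = enc n (add k (cl rep p) p R U) \<and> same_out {7, 10} (snd s) m)"
  unfolding addc_def
proof (rule run_If_val)
  show "val (V 2) r m (of_int k)" using r by (simp add: val_def)
  show "val (cardx 7) r m (real (card U))" by (rule val_cardx7) (use r m R in auto)
next
  assume "real_of_int k < real (card U)"
  then have "\<not> okf k (cl rep p) p U" unfolding okf_def by linarith
  then show "run M N Skip (r, m) (\<lambda>s. fst s 10 = enc n (add k (cl rep p) p R U) \<and> same_out {7, 10} (snd s) m)"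
    by (intro run_Skip) (use r same_out_refl in \<open>auto simp: add_def\<close>)
next
  assume "\<not> real_of_int k < real (card U)"
  then have k: "int (card U) \<le> k" by linarith
  obtain v where v: "val (badx 7) r m v"
    "0 < v \<longleftrightarrow> \<not> (\<forall>u\<in>cl rep p. conn U p u \<longrightarrow> real (d p u) * of_int k ^ 3 \<le> 21 * real n ^ 3)"
    using val_badx7[of r m U rep p k] r m R by auto
  show "run M N (Cond (C 0) (badx 7) Skip insc) (r, m) (\<lambda>s. fst s 10 = enc n (add k (cl rep p) p R U) \<and> same_out {7, 10} (snd s) m)"
  proof (rule run_If_val[OF val_C0 v(1)])
    assume "0 < v"
    then have "\<not> okf k (cl rep p) p U" using v(2) unfolding okf_def by blast
    then show "run M N Skip (r, m) (\<lambda>s. fst s 10 = enc n (add k (cl rep p) p R U) \<and> same_out {7, 10} (snd s) m)"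
      by (intro run_Skip) (use r same_out_refl in \<open>auto simp: add_def\<close>)
  next
    assume "\<not> 0 < v"
    then have "okf k (cl rep p) p U" using v(2) k unfolding okf_def by blast
    then have "add k (cl rep p) p R U = ins (cl rep p) p U R" by (simp add: add_def)
    then show "run M N insc (r, m) (\<lambda>s. fst s 10 = enc n (add k (cl rep p) p R U) \<and> same_out {7, 10} (snd s) m)"
      using run_insc[OF r(1-4) m R] by simp
  qed
qed

lemma val_parx:
  assumes "rn r" "DM m" "r 6 = real c" "c < n" "c \<noteq> 0"
  shows "val parx r m (real (par c))"
  unfolding parx_def
proof (rule val_cong[OF val_Sm[OF assms(1)]])
  fix p assume p: "p < n"
  let ?r = "r(30 := real p)"
  have r0: "rn ?r" using assms by simp
  have z: "val (C 0) ?r m (real 0)" by (simp add: val_def)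
  have v6: "val (V 6) ?r m (real c)" and v30: "val (V 30) ?r m (real p)" using assms by (auto simp: val_def)
  note vd = val_Dx[OF r0 assms(2)]
  show "val (EqI (Dx (V 6) (V 30)) (C 1) (EqI (Dx (C 0) (V 6)) (Plus (Dx (C 0) (V 30)) (C 1)) (V 30) (C 0)) (C 0)) ?r m
    (if real (d c p) = 1 then if real (d 0 c) = real (d 0 p) + 1 then real p else 0 else 0)"
    by (intro val_EqI val_Plus vd[OF v6 v30] vd[OF z v6] vd[OF z v30] v30) (use assms p n_pos in \<open>auto intro: val_C\<close>)
next
  have "(\<Sum>p<n. if real (d c p) = 1 then if real (d 0 c) = real (d 0 p) + 1 then real p else 0 else 0)
    = (\<Sum>p<n. if p = par c then real p else 0)"
  proof (rule sum.cong[OF refl])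
    fix p assume "p \<in> {..<n}"
    then have "real (d c p) = 1 \<and> real (d 0 c) = real (d 0 p) + 1 \<longleftrightarrow> p = par c"
      using par[OF assms(4,5)] by (metis (no_types, lifting) lessThan_iff of_nat_1 of_nat_add of_nat_eq_iff)
    then show "(if real (d c p) = 1 then if real (d 0 c) = real (d 0 p) + 1 then real p else 0 else 0)
      = (if p = par c then real p else 0)" by auto
  qed
  also have "\<dots> = real (par c)" using par(1)[OF assms(4,5)] by simp
  finally show "(\<Sum>p<n. if real (d c p) = 1 then if real (d 0 c) = real (d 0 p) + 1 then real p else 0 else 0) = real (par c)" .
qed

lemma run_repc:
  assumes "rn r" "r 6 = real c" "r 7 = real p" "RP m rep"
  shows "run M N repc (r, m) (\<lambda>s. RP (snd s) (\<lambda>u. if rep u = c then p else rep u) \<and> same_out {4} (snd s) m)"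
  unfolding repc_def
proof (rule run_For_mem[where I = "\<lambda>i m'. same_out {4} m' m \<and>
    (\<forall>u<n. m' (cell n 4 u) = real (if u < i \<and> rep u = c then p else rep u))"])
  fix i r' m' assume *: "i < n" "same_out {4} m' m \<and>
      (\<forall>u<n. m' (cell n 4 u) = real (if u < i \<and> rep u = c then p else rep u))" "r' 4 = real i" "rn r'"
    "\<And>y. y \<notin> insert 4 (wr (Sto (C 4) (V 4) (EqI (Mat (C 4) (V 4)) (V 6) (V 7) (Mat (C 4) (V 4))))) \<Longrightarrow> r' y = r y"
  have v4: "val (V 4) r' m' (real i)" "val (V 6) r' m' (real c)" "val (V 7) r' m' (real p)"
    using * assms by (simp_all add: val_def)
  have vr: "val (Mat (C 4) (V 4)) r' m' (real (rep i))"
    by (rule val_rown[OF *(4) v4(1) *(1)]) (use * in auto)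
  have v: "val (EqI (Mat (C 4) (V 4)) (V 6) (V 7) (Mat (C 4) (V 4))) r' m' (if real (rep i) = real c then real p else real (rep i))"
    by (rule val_EqI[OF vr v4(2,3) vr])
  show "run M N (Sto (C 4) (V 4) (EqI (Mat (C 4) (V 4)) (V 6) (V 7) (Mat (C 4) (V 4)))) (r', m')
     (\<lambda>s. same_out {4} (snd s) m \<and> (\<forall>u<n. snd s (cell n 4 u) = real (if u < Suc i \<and> rep u = c then p else rep u)))"
    by (rule run_Sto_val[OF *(4) val_C v4(1) v, where i = 4]) (use * same_out_upd in \<open>auto simp: less_Suc_eq\<close>)
next
  fix r' m' assume "same_out {4} m' m \<and> (\<forall>u<n. m' (cell n 4 u) = real (if u < n \<and> rep u = c then p else rep u))"
  then show "RP (snd (r', m')) (\<lambda>u. if rep u = c then p else rep u) \<and> same_out {4} (snd (r', m')) m"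
    by (auto simp: RP_def)
qed (use assms same_out_refl in \<open>auto simp: RP_def\<close>)

definition inner_inv :: "int \<Rightarrow> nat set \<Rightarrow> nat \<Rightarrow> nat set \<Rightarrow> nat set list \<Rightarrow> nat set list \<Rightarrow> (nat \<Rightarrow> real) \<Rightarrow> nat \<Rightarrow> state \<Rightarrow> bool" where
  "inner_inv k Cl p S Lc R0 m0 i s \<longleftrightarrow> (\<exists>L R. i + length L = length Lc \<and> fst s 9 = enc n L \<and> fst s 10 = enc n R \<and>
     Good k Cl p R \<and> set L \<subseteq> set Lc \<and>
     foldl (\<lambda>R S'. add k Cl p R (S \<union> S')) R L = foldl (\<lambda>R S'. add k Cl p R (S \<union> S')) R0 Lc \<and>
     RS (snd s) 8 S \<and> same_out {7, 8, 9, 10} (snd s) m0)"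

definition outer_inv :: "int \<Rightarrow> nat set \<Rightarrow> nat \<Rightarrow> nat set list \<Rightarrow> nat set list \<Rightarrow> (nat \<Rightarrow> real) \<Rightarrow> nat \<Rightarrow> state \<Rightarrow> bool" where
  "outer_inv k Cl p Lp Lc m0 i s \<longleftrightarrow> (\<exists>L R. i + length L = length Lp \<and> fst s 8 = enc n L \<and> fst s 10 = enc n R \<and>
     Good k Cl p R \<and> set L \<subseteq> set Lp \<and>
     foldl (\<lambda>R S. foldl (\<lambda>R S'. add k Cl p R (S \<union> S')) R Lc) R L = mrg k Cl p Lp Lc \<and>
     same_out {7, 8, 9, 10} (snd s) m0)"

text \<open>The invariant keeps the accumulator \<open>Good\<close> because this bounds its length,
  and hence the rounds of the scan in \<open>insc\<close>, by \<open>N\<close>.\<close>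

lemma run_mrg_inner:
  assumes I: "inner_inv k (cl rep p) p S Lc R0 m0 i (r, m)"
    and r: "rn r" "r 7 = real p" "r 2 = of_int k" "0 < r 9" "p < n"
    and m0: "DM m0" "RP m0 rep" "PW m0"
    and sub: "S \<subseteq> cl rep p" "\<forall>S\<in>set Lc. S \<subseteq> cl rep p" "\<And>R. Good k (cl rep p) p R \<Longrightarrow> length R \<le> N"
  shows "i < length Lc \<and> run M N mrg_inner (r, m) (inner_inv k (cl rep p) p S Lc R0 m0 (Suc i))"
proof -
  let ?C = "cl rep p" let ?f = "\<lambda>R S'. add k (cl rep p) p R (S \<union> S')"
  obtain L R where L: "i + length L = length Lc" "r 9 = enc n L" "r 10 = enc n R" "Good k ?C p R"
     "set L \<subseteq> set Lc" "foldl ?f R L = foldl ?f R0 Lc" "RS m 8 S" "same_out {7, 8, 9, 10} m m0"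
    using I unfolding inner_inv_def by auto
  obtain S' L' where S': "L = S' # L'" using r(4) L(2) enc_pos[of n L] by (cases L) auto
  have CV: "?C \<subseteq> {..<n}" by (auto simp: cl_def)
  have UC: "S \<union> S' \<subseteq> ?C" using sub L(5) S' by auto
  have RV: "\<forall>W\<in>set R. W \<subseteq> {..<n}" using L(4) CV unfolding Good_def by blast
  have "run M N mrg_inner (r, m) (inner_inv k ?C p S Lc R0 m0 (Suc i))"
    unfolding mrg_inner_def
  proof (rule run_Sq_post[OF run_pop9])
    show "rn r" "r 9 = enc n (S' # L')" using r L S' by auto
    fix r1 :: "nat \<Rightarrow> real" and m1
    assume *: "fst (r1, m1) 9 = enc n L' \<and> RS (snd (r1, m1)) 9 S' \<and> same_out {9} (snd (r1, m1)) m"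
      and f: "\<And>y. y \<notin> wr (pop 9 9) \<Longrightarrow> r1 y = r y"
    have m1: "RS m1 9 S'" "RS m1 8 S" "same_out {7, 8, 9, 10} m1 m0"
      using * L(7,8) same_out_rows(5)[of "{9}" m1 m 8 S] same_out_trans[of "{9}" m1 m "{7, 8, 9, 10}" m0 "{7, 8, 9, 10}"] by auto
    have r1: "rn r1" "r1 9 = enc n L'" "r1 10 = enc n R" "r1 7 = real p" "r1 2 = of_int k" using * f L r by auto
    show "run M N (Sq unionc addc) (r1, m1) (inner_inv k ?C p S Lc R0 m0 (Suc i))"
    proof (rule run_Sq_post[OF run_union[OF r1(1) m1(2,1)]])
      fix r2 :: "nat \<Rightarrow> real" and m2
      assume *: "RS (snd (r2, m2)) 7 (S \<union> S') \<and> same_out {7} (snd (r2, m2)) m1"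
        and f: "\<And>y. y \<notin> wr unionc \<Longrightarrow> r2 y = r1 y"
      have m2: "RS m2 7 (S \<union> S')" "RS m2 8 S" "same_out {7, 8, 9, 10} m2 m0"
        using * m1 same_out_rows(5)[of "{7}" m2 m1 8 S] same_out_trans[of "{7}" m2 m1 "{7, 8, 9, 10}" m0 "{7, 8, 9, 10}"] by auto
      have G: "DM m2" "RP m2 rep" "PW m2" using same_out_rows[OF m2(3)] m0 by auto
      have r2: "rn r2" "r2 9 = enc n L'" "r2 10 = enc n R" "r2 7 = real p" "r2 2 = of_int k" using f r1 by auto
      show "run M N addc (r2, m2) (inner_inv k ?C p S Lc R0 m0 (Suc i))"
      proof (rule run_post[OF run_addc[OF r2(1,4) r(5) r2(3,5) G m2(1)]])
        show "S \<union> S' \<subseteq> {..<n}" using UC CV by blast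
        show "\<forall>W\<in>set R. W \<subseteq> {..<n}" by (rule RV)
        show "length R \<le> N" by (rule sub(3)[OF L(4)])
        fix r3 :: "nat \<Rightarrow> real" and m3
        assume *: "fst (r3, m3) 10 = enc n (add k ?C p R (S \<union> S')) \<and> same_out {7, 10} (snd (r3, m3)) m2"
          and f: "\<And>y. y \<notin> wr addc \<Longrightarrow> r3 y = r2 y"
        have m3: "RS m3 8 S" "same_out {7, 8, 9, 10} m3 m0"
          using * m2 same_out_rows(5)[of "{7, 10}" m3 m2 8 S] same_out_trans[of "{7, 10}" m3 m2 "{7, 8, 9, 10}" m0 "{7, 8, 9, 10}"] by auto
        have fo: "foldl ?f (add k ?C p R (S \<union> S')) L' = foldl ?f R0 Lc" using L(6) S' by simp
        show "inner_inv k ?C p S Lc R0 m0 (Suc i) (r3, m3)"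
          unfolding inner_inv_def
          by (rule exI[of _ L'], rule exI[of _ "add k ?C p R (S \<union> S')"])
             (use * f r2 m3 fo L(1,5) S' Good_add[OF L(4) UC] in auto)
      qed
    qed
  qed auto
  moreover have "i < length Lc" using L(1) S' by simp
  ultimately show ?thesis by blast
qed

lemma run_mrg_body:
  assumes I: "outer_inv k (cl rep p) p Lp (Ls c) m0 i (r, m)"
    and r: "rn r" "r 7 = real p" "r 6 = real c" "r 2 = of_int k" "0 < r 8" "p < n" "c < n"
    and m0: "DM m0" "RP m0 rep" "PW m0" "LS m0 Ls"
    and sub: "\<forall>S\<in>set Lp. S \<subseteq> cl rep p" "\<forall>S\<in>set (Ls c). S \<subseteq> cl rep p" "\<And>R. Good k (cl rep p) p R \<Longrightarrow> length R \<le> N"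
      "length (Ls c) \<le> N"
  shows "i < length Lp \<and> run M N mrg_body (r, m) (outer_inv k (cl rep p) p Lp (Ls c) m0 (Suc i))"
proof -
  let ?C = "cl rep p" let ?Lc = "Ls c"
  let ?g = "\<lambda>R S. foldl (\<lambda>R S'. add k ?C p R (S \<union> S')) R ?Lc"
  obtain L R where L: "i + length L = length Lp" "r 8 = enc n L" "r 10 = enc n R" "Good k ?C p R"
     "set L \<subseteq> set Lp" "foldl ?g R L = mrg k ?C p Lp ?Lc" "same_out {7, 8, 9, 10} m m0"
    using I unfolding outer_inv_def by auto
  obtain S L' where S: "L = S # L'" using r(5) L(2) enc_pos[of n L] by (cases L) auto
  have SC: "S \<subseteq> ?C" using sub L(5) S by auto
  have fo: "foldl ?g (?g R S) L' = mrg k ?C p Lp ?Lc" using L(6) S by simp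
  have "run M N mrg_body (r, m) (outer_inv k ?C p Lp ?Lc m0 (Suc i))"
    unfolding mrg_body_def
  proof (rule run_Sq_post[OF run_pop8])
    show "rn r" "r 8 = enc n (S # L')" using r L S by auto
    fix r1 :: "nat \<Rightarrow> real" and m1
    assume *: "fst (r1, m1) 8 = enc n L' \<and> RS (snd (r1, m1)) 8 S \<and> same_out {8} (snd (r1, m1)) m"
      and f: "\<And>y. y \<notin> wr (pop 8 8) \<Longrightarrow> r1 y = r y"
    have m1: "RS m1 8 S" "same_out {7, 8, 9, 10} m1 m0"
      using * L(7) same_out_trans[of "{8}" m1 m "{7, 8, 9, 10}" m0 "{7, 8, 9, 10}"] by auto
    have r1: "rn r1" "r1 8 = enc n L'" "r1 10 = enc n R" "r1 7 = real p" "r1 6 = real c" "r1 2 = of_int k" using * f L r by auto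
    have v6: "val (V 6) r1 m1 (real c)" using r1 by (simp add: val_def)
    have v: "val (Mat (C 5) (V 6)) r1 m1 (enc n ?Lc)"
      by (rule val_rown[OF r1(1) v6 r(7)]) (use same_out_rows(3)[OF m1(2)] m0 r in \<open>auto simp: LS_def\<close>)
    define r2 where "r2 = r1(9 := enc n ?Lc)"
    have r2: "rn r2" "r2 8 = enc n L'" "r2 10 = enc n R" "r2 7 = real p" "r2 2 = of_int k" "r2 9 = enc n ?Lc"
      using r1 by (auto simp: r2_def)
    show "run M N (Sq (Asg 9 (Mat (C 5) (V 6))) (Wh (C 0) (V 9) mrg_inner)) (r1, m1) (outer_inv k ?C p Lp ?Lc m0 (Suc i))"
    proof (rule run_Asg_Sq[OF v], fold r2_def, rule run_while[where I = "inner_inv k ?C p S ?Lc R m0"])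
      show "inner_inv k ?C p S ?Lc R m0 0 (r2, m1)"
        unfolding inner_inv_def by (rule exI[of _ ?Lc], rule exI[of _ R]) (use r2 m1 L in auto)
    next
      fix j r' m' assume *: "inner_inv k ?C p S ?Lc R m0 j (r', m')" "\<And>y. y \<notin> wr mrg_inner \<Longrightarrow> r' y = r2 y" "0 < r' 9"
      have "j < length ?Lc \<and> run M N mrg_inner (r', m') (inner_inv k ?C p S ?Lc R m0 (Suc j))"
        by (rule run_mrg_inner[OF *(1)]) (use * r2 r m0 SC sub in auto)
      then show "j < N \<and> run M N mrg_inner (r', m') (inner_inv k ?C p S ?Lc R m0 (Suc j))" using sub(4) by auto
    next
      fix j r' m' assume *: "inner_inv k ?C p S ?Lc R m0 j (r', m')" "\<And>y. y \<notin> wr mrg_inner \<Longrightarrow> r' y = r2 y" "\<not> 0 < r' 9"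
      then obtain L2 R2 where L2: "r' 9 = enc n L2" "r' 10 = enc n R2" "Good k ?C p R2"
         "foldl (\<lambda>R S'. add k ?C p R (S \<union> S')) R2 L2 = ?g R S" "same_out {7, 8, 9, 10} m' m0"
        unfolding inner_inv_def by auto
      have "L2 = []" using L2(1) *(3) enc_pos[of n L2] by auto
      then have R2: "R2 = ?g R S" using L2(4) by simp
      have "r' 8 = enc n L'" using *(2)[of 8] r2 by simp
      then show "outer_inv k ?C p Lp ?Lc m0 (Suc i) (r', m')"
        unfolding outer_inv_def
        by (intro exI[of _ L'] exI[of _ R2]) (use L2(2,3,5) fo L(1,5) S R2 in auto)
    qed
  qed auto
  moreover have "i < length Lp" using L(1) S by simp
  ultimately show ?thesis by blast
qed

lemma run_mrgc:
  assumes r: "rn r" "r 7 = real p" "r 6 = real c" "r 2 = of_int k" "p < n" "c < n"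
    and m: "DM m" "RP m rep" "PW m" "LS m Ls"
    and sub: "\<forall>S\<in>set (Ls p). S \<subseteq> cl rep p" "\<forall>S\<in>set (Ls c). S \<subseteq> cl rep p" "\<And>R. Good k (cl rep p) p R \<Longrightarrow> length R \<le> N"
      "length (Ls c) \<le> N" "length (Ls p) \<le> N"
  shows "run M N mrgc (r, m) (\<lambda>s. LS (snd s) (Ls(p := mrg k (cl rep p) p (Ls p) (Ls c))) \<and> same_out {5, 7, 8, 9, 10} (snd s) m)"
proof -
  let ?C = "cl rep p"
  have v7: "val (V 7) r m (real p)" using r by (simp add: val_def)
  have v: "val (Mat (C 5) (V 7)) r m (enc n (Ls p))"
    by (rule val_rown[OF r(1) v7 r(5)]) (use m r in \<open>auto simp: LS_def\<close>)
  define r2 where "r2 = r(8 := enc n (Ls p), 10 := 0)"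
  have r2: "rn r2" "r2 8 = enc n (Ls p)" "r2 10 = 0" "r2 7 = real p" "r2 6 = real c" "r2 2 = of_int k"
    using r by (auto simp: r2_def)
  have "run M N (Sq (Wh (C 0) (V 8) mrg_body) (Sto (C 5) (V 7) (V 10))) (r2, m)
    (\<lambda>s. LS (snd s) (Ls(p := mrg k ?C p (Ls p) (Ls c))) \<and> same_out {5, 7, 8, 9, 10} (snd s) m)"
  proof (rule run_Sq_post[OF run_while[where I = "outer_inv k ?C p (Ls p) (Ls c) m" and
        Q = "\<lambda>s. \<exists>i. outer_inv k ?C p (Ls p) (Ls c) m i s \<and> \<not> 0 < fst s 8"]])
    show "outer_inv k ?C p (Ls p) (Ls c) m 0 (r2, m)"
      unfolding outer_inv_def by (rule exI[of _ "Ls p"], rule exI[of _ "[]"]) (use r2 same_out_refl Good_Nil in \<open>auto simp: mrg_def\<close>)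
  next
    fix j r' m' assume *: "outer_inv k ?C p (Ls p) (Ls c) m j (r', m')" "\<And>y. y \<notin> wr mrg_body \<Longrightarrow> r' y = r2 y" "0 < r' 8"
    have "j < length (Ls p) \<and> run M N mrg_body (r', m') (outer_inv k ?C p (Ls p) (Ls c) m (Suc j))"
      by (rule run_mrg_body[where Ls = Ls and c = c, OF *(1)]) (use * r2 r m sub in auto)
    then show "j < N \<and> run M N mrg_body (r', m') (outer_inv k ?C p (Ls p) (Ls c) m (Suc j))" using sub(5) by auto
  next
    fix j r' m' assume "outer_inv k ?C p (Ls p) (Ls c) m j (r', m')" "\<not> 0 < r' 8"
    then show "\<exists>i. outer_inv k ?C p (Ls p) (Ls c) m i (r', m') \<and> \<not> 0 < fst (r', m') 8" by auto
  next
    fix r' :: "nat \<Rightarrow> real" and m'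
    assume *: "\<exists>i. outer_inv k ?C p (Ls p) (Ls c) m i (r', m') \<and> \<not> 0 < fst (r', m') 8"
      and f: "\<And>y. y \<notin> wr (Wh (C 0) (V 8) mrg_body) \<Longrightarrow> r' y = r2 y"
    then obtain L R where L: "r' 8 = enc n L" "r' 10 = enc n R" "\<not> 0 < r' 8"
       "foldl (\<lambda>R S. foldl (\<lambda>R S'. add k ?C p R (S \<union> S')) R (Ls c)) R L = mrg k ?C p (Ls p) (Ls c)"
       "same_out {7, 8, 9, 10} m' m"
      unfolding outer_inv_def by auto
    have "L = []" using L(1,3) enc_pos[of n L] by auto
    then have R: "R = mrg k ?C p (Ls p) (Ls c)" using L(4) by simp
    have v7: "val (V 7) r' m' (real p)" and rn: "rn r'" using f r2 by (auto simp: val_def)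
    have LSm: "LS m' Ls" using same_out_rows(3)[OF L(5)] m by auto
    have so: "same_out {5, 7, 8, 9, 10} m' m" using same_out_trans[OF same_out_refl L(5), of "{}"] by auto
    show "run M N (Sto (C 5) (V 7) (V 10)) (r', m')
      (\<lambda>s. LS (snd s) (Ls(p := mrg k ?C p (Ls p) (Ls c))) \<and> same_out {5, 7, 8, 9, 10} (snd s) m)"
      by (rule run_Sto_val[OF rn val_C v7 val_Vr, where i = 5])
         (use L(2) R LSm so r same_out_upd in \<open>auto simp: LS_def\<close>)
  qed
  then show ?thesis unfolding mrgc_def r2_def
    by (intro run_Asg_Sq[OF v] run_Asg_Sq[OF val_C0])
qed

end


section \<open>The whole program\<close>

context machine
begin

definition SI :: "int \<Rightarrow> nat \<Rightarrow> nat \<Rightarrow> nat \<Rightarrow> (nat \<Rightarrow> real) \<Rightarrow> bool" where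
  "SI k Nb l c m \<longleftrightarrow> DM m \<and> PW m \<and> (\<exists>st. RP m (fst st) \<and> LS m (snd st) \<and> Inv k Nb (dead l c) st)"

text \<open>Only this consequence of the counting enters the correctness of the program: it covers
  the lists in memory as well as the accumulator of a merge.\<close>

definition short :: "int \<Rightarrow> nat \<Rightarrow> bool" where
  "short k Nb \<longleftrightarrow> (\<forall>C p R. C \<subseteq> {..<n} \<longrightarrow> p < n \<longrightarrow> Good k C p R \<longrightarrow> length R \<le> Nb)"

lemma run_stepc:
  assumes r: "rn r" "r 6 = real c" "r 2 = of_int k" "c < n" and l: "0 < l" "d 0 c = l"
    and m: "DM m" "PW m" "RP m (fst st)" "LS m (snd st)" "Inv k Nb (dead l c) st"
    and Nb: "short k Nb" "Nb \<le> N"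
  shows "run M N stepc (r, m) (\<lambda>s. SI k Nb l (Suc c) (snd s))"
proof -
  have c0: "c \<noteq> 0" using l d_self[OF n_pos] by (cases "c = 0") auto
  have D: "c \<notin> dead l c" "\<forall>u\<in>dead l c. d 0 c \<le> d 0 u" "\<forall>u<n. d 0 c < d 0 u \<longrightarrow> u \<in> dead l c"
  proof -
    show "c \<notin> dead l c" "\<forall>u\<in>dead l c. d 0 c \<le> d 0 u" using l by (auto simp: dead_def)
    show "\<forall>u<n. d 0 c < d 0 u \<longrightarrow> u \<in> dead l c"
    proof (intro allI impI)
      fix u assume u: "u < n" "d 0 c < d 0 u"
      then have "u \<noteq> 0" using d_self[OF n_pos] by (cases "u = 0") auto
      then show "u \<in> dead l c" using u l by (simp add: dead_def)
    qed
  qed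
  have sh: "length R \<le> Nb" if "C \<subseteq> {..<n}" "p < n" "Good k C p R" for C p R
    using Nb(1) that unfolding short_def by blast
  have step: "Inv k Nb (insert c (dead l c)) (stp k c st)"
    "\<forall>S\<in>set (snd st (par c)) \<union> set (snd st c). S \<subseteq> cl (fst (stp k c st)) (par c)"
    "length (snd st (par c)) \<le> Nb" "length (snd st c) \<le> Nb"
    by (rule Inv_step[OF m(5) r(4) c0 D], rule sh, assumption+)+
  define p where "p = par c"
  define rep where "rep = (\<lambda>u. if fst st u = c then p else fst st u)"
  have stp: "stp k c st = (rep, (snd st)(p := mrg k (cl rep p) p (snd st p) (snd st c)))"
    by (simp only: stp_def rep_def p_def Let_def)
  have pn: "p < n" using par(1)[OF r(4) c0] by (simp add: p_def)
  have sub: "\<forall>S\<in>set (snd st p). S \<subseteq> cl rep p" "\<forall>S\<in>set (snd st c). S \<subseteq> cl rep p"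
    using step(2) unfolding stp p_def[symmetric] by auto
  have len: "length (snd st c) \<le> N" "length (snd st p) \<le> N" using step(3,4) Nb(2) unfolding p_def by auto
  have good: "length R \<le> N" if "Good k (cl rep p) p R" for R
    proof (rule order_trans[OF sh[OF _ pn that] Nb(2)])
    show "cl rep p \<subseteq> {..<n}" by (auto simp: cl_def)
  qed
  have v: "val parx r m (real p)" unfolding p_def by (rule val_parx[OF r(1) m(1) r(2,4) c0])
  define r1 where "r1 = r(7 := real p)"
  have r1: "rn r1" "r1 6 = real c" "r1 7 = real p" "r1 2 = of_int k" using r by (auto simp: r1_def)
  show ?thesis unfolding stepc_def
  proof (rule run_Asg_Sq[OF v], fold r1_def, rule run_Sq_post[OF run_repc[OF r1(1-3) m(3)]])
    fix r2 :: "nat \<Rightarrow> real" and m2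
    assume *: "RP (snd (r2, m2)) (\<lambda>u. if fst st u = c then p else fst st u) \<and> same_out {4} (snd (r2, m2)) m"
      and f: "\<And>y. y \<notin> wr repc \<Longrightarrow> r2 y = r1 y"
    have r2: "rn r2" "r2 7 = real p" "r2 6 = real c" "r2 2 = of_int k" using f r1 by auto
    have so: "same_out {4} m2 m" using * by auto
    have m2: "RP m2 rep" "DM m2" "PW m2" "LS m2 (snd st)" using * same_out_rows[OF so] m by (auto simp: rep_def)
    show "run M N mrgc (r2, m2) (\<lambda>s. SI k Nb l (Suc c) (snd s))"
    proof (rule run_post[OF run_mrgc[where Ls = "snd st" and c = c, OF r2 pn r(4) m2(2,1,3,4) sub good len]])
      fix r3 :: "nat \<Rightarrow> real" and m3
      assume *: "LS (snd (r3, m3)) ((snd st)(p := mrg k (cl rep p) p (snd st p) (snd st c))) \<and> same_out {5, 7, 8, 9, 10} (snd (r3, m3)) m2"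
      then have so: "same_out {5, 7, 8, 9, 10} m3 m2" by auto
      have "DM m3" "PW m3" "RP m3 rep" using same_out_rows[OF so] m2 by auto
      moreover have "dead l (Suc c) = insert c (dead l c)" unfolding dead_Suc[OF r(4)] using l by simp
      ultimately show "SI k Nb l (Suc c) (snd (r3, m3))"
        unfolding SI_def using * step(1) stp by (metis fst_conv snd_conv)
    qed
  qed
qed

lemma run_innerc:
  assumes r: "rn r" "r 6 = real c" "r 2 = of_int k" "r 13 = real l" "c < n"
    and m: "SI k Nb l c m"
    and Nb: "short k Nb" "Nb \<le> N"
  shows "run M N innerc (r, m) (\<lambda>s. SI k Nb l (Suc c) (snd s))"
proof -
  obtain st where st: "DM m" "PW m" "RP m (fst st)" "LS m (snd st)" "Inv k Nb (dead l c) st" using m by (auto simp: SI_def)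
  have skip: "run M N Skip (r, m) (\<lambda>s. SI k Nb l (Suc c) (snd s))" if "\<not> (0 < l \<and> d 0 c = l)"
  proof (rule run_Skip)
    have "dead l (Suc c) = dead l c" unfolding dead_Suc[OF r(5)] using that by (rule if_not_P)
    then show "SI k Nb l (Suc c) (snd (r, m))" using m by (simp add: SI_def)
  qed
  have v13: "val (V 13) r m (real l)" and v6: "val (V 6) r m (real c)" and z: "val (C 0) r m (real 0)"
    using r by (simp_all add: val_def)
  have vd: "val (Dx (C 0) (V 6)) r m (real (d 0 c))" by (rule val_Dx[OF r(1) st(1) z v6 n_pos r(5)])
  show ?thesis unfolding innerc_def
  proof (rule run_If_val[OF z v13])
    assume "real 0 < real l"
    show "run M N (Cond (Dx (C 0) (V 6)) (V 13) Skip (Cond (V 13) (Dx (C 0) (V 6)) Skip stepc)) (r, m) (\<lambda>s. SI k Nb l (Suc c) (snd s))"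
    proof (rule run_If_val[OF vd v13])
      assume "\<not> real (d 0 c) < real l"
      show "run M N (Cond (V 13) (Dx (C 0) (V 6)) Skip stepc) (r, m) (\<lambda>s. SI k Nb l (Suc c) (snd s))"
      proof (rule run_If_val[OF v13 vd])
        assume "\<not> real l < real (d 0 c)"
        show "run M N stepc (r, m) (\<lambda>s. SI k Nb l (Suc c) (snd s))"
          by (rule run_stepc[OF r(1-3,5) _ _ st Nb])
             (use \<open>real 0 < real l\<close> \<open>\<not> real (d 0 c) < real l\<close> \<open>\<not> real l < real (d 0 c)\<close> in auto)
      qed (use skip in auto)
    qed (use skip in auto)
  qed (use skip in auto)
qed

lemma run_mainc:
  assumes r: "rn r" "r 2 = of_int k" and m: "SI k Nb (n - 1) 0 m"
    and Nb: "short k Nb" "Nb \<le> N"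
  shows "run M N mainc (r, m) (\<lambda>s. SI k Nb 0 0 (snd s))"
  unfolding mainc_def
proof (rule run_For_mem[where I = "\<lambda>i m. SI k Nb (n - 1 - i) 0 m"])
  fix i r' m'
  assume *: "i < n" "SI k Nb (n - 1 - i) 0 m'" "r' 5 = real i" "rn r'"
    "\<And>y. y \<notin> insert 5 (wr (Sq (Asg 13 (Minus (V 0) (Plus (V 5) (C 1)))) (For 6 innerc))) \<Longrightarrow> r' y = r y"
  let ?l = "n - 1 - i"
  have v: "val (Minus (V 0) (Plus (V 5) (C 1))) r' m' (real ?l)"
    by (rule val_cong[OF val_Minus[OF val_V0[OF *(4)] val_Plus[OF val_Vr val_C[OF refl]]]]) (use * in auto)
  define r1 where "r1 = r'(13 := real ?l)"
  have r1: "rn r1" "r1 2 = of_int k" "r1 13 = real ?l" using * r by (auto simp: r1_def)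
  show "run M N (Sq (Asg 13 (Minus (V 0) (Plus (V 5) (C 1)))) (For 6 innerc)) (r', m')
      (\<lambda>s. SI k Nb (n - 1 - Suc i) 0 (snd s))"
  proof (rule run_Asg_Sq[OF v], fold r1_def, rule run_For_mem[where I = "\<lambda>c m. SI k Nb ?l c m"])
    fix c r2 m2 assume c: "c < n" "SI k Nb ?l c m2" "r2 6 = real c" "rn r2" "\<And>y. y \<notin> insert 6 (wr innerc) \<Longrightarrow> r2 y = r1 y"
    show "run M N innerc (r2, m2) (\<lambda>s. SI k Nb ?l (Suc c) (snd s))"
      by (rule run_innerc[OF c(4,3) _ _ c(1,2) Nb]) (use c r1 in auto)
  next
    fix r2 :: "nat \<Rightarrow> real" and m2 assume "SI k Nb ?l n m2"
    \<comment> \<open>In the last round \<open>?l\<close> is \<open>0\<close> and truncated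
      subtraction keeps it there; nothing changes, as only the root has depth
      \<open>0\<close>.\<close>
    moreover have "dead ?l n = dead (n - 1 - Suc i) 0"
    proof (cases "?l = 0")
      case True
      have "0 < d 0 u" if "u < n" "u \<noteq> 0" for u using d_zero[OF n_pos that(1)] that(2) by simp
      then have "dead 0 n = dead 0 0" by (auto simp: dead_def)
      then show ?thesis using True by simp
    next
      case False
      then show ?thesis using dead_next[of ?l] by simp
    qed
    ultimately show "SI k Nb (n - 1 - Suc i) 0 (snd (r2, m2))" by (simp add: SI_def)
  qed (use * r1 in auto)
qed (use r m in auto)

lemma run_finalc:
  assumes r: "rn r" "r 2 = of_int k" "r 3 = t" and m: "DM m" "LS m Ls" and L: "length (Ls 0) \<le> N" "\<forall>S\<in>set (Ls 0). S \<subseteq> {..<n}"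
  shows "run M N finalc (r, m) (\<lambda>s. 0 < fst s 1 \<longleftrightarrow> (\<exists>S\<in>set (Ls 0). int (card S) = k \<and> J S \<le> t))"
proof -
  define good where "good = (\<lambda>S. int (card S) = k \<and> J S \<le> t)"
  define I where "I = (\<lambda>i (s :: state). i \<le> length (Ls 0) \<and> fst s 8 = enc n (drop i (Ls 0)) \<and>
     (0 < fst s 1 \<longleftrightarrow> (\<exists>S\<in>set (take i (Ls 0)). good S)) \<and> same_out {8} (snd s) m)"
  have v: "val (Mat (C 5) (C 0)) r m (enc n (Ls 0))"
    by (rule val_rown[OF r(1) val_C n_pos]) (use m n_pos in \<open>auto simp: LS_def\<close>)
  define r1 where "r1 = r(8 := enc n (Ls 0), 1 := 0)"
  have r1: "r1 0 = real n" "r1 8 = enc n (Ls 0)" "r1 1 = 0" "r1 2 = of_int k" "r1 3 = t" using r by (auto simp: r1_def)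
  have "run M N (Wh (C 0) (V 8) final_body) (r1, m) (\<lambda>s. 0 < fst s 1 \<longleftrightarrow> (\<exists>S\<in>set (Ls 0). good S))"
  proof (rule run_while[where I = I])
    show "I 0 (r1, m)" using r1 same_out_refl by (auto simp: I_def)
  next
    fix i r' m' assume *: "I i (r', m')" "\<And>y. y \<notin> wr final_body \<Longrightarrow> r' y = r1 y" "0 < r' 8"
    then have "drop i (Ls 0) \<noteq> []" using enc_pos[of n "drop i (Ls 0)"] by (auto simp: I_def)
    then have i: "i < length (Ls 0)" by simp
    define S where "S = Ls 0 ! i"
    have dr: "drop i (Ls 0) = S # drop (Suc i) (Ls 0)" "take (Suc i) (Ls 0) = take i (Ls 0) @ [S]"
      using i by (auto simp: S_def Cons_nth_drop_Suc take_Suc_conv_app_nth)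
    have SV: "S \<subseteq> {..<n}" using L i by (auto simp: S_def)
    have "run M N final_body (r', m') (I (Suc i))"
      unfolding final_body_def
    proof (rule run_Sq_post[OF run_pop8])
      show "rn r'" "r' 8 = enc n (S # drop (Suc i) (Ls 0))" using * r1 dr by (auto simp: I_def)
      fix r2 :: "nat \<Rightarrow> real" and m2
      assume **: "fst (r2, m2) 8 = enc n (drop (Suc i) (Ls 0)) \<and> RS (snd (r2, m2)) 8 S \<and> same_out {8} (snd (r2, m2)) m'"
        and f: "\<And>y. y \<notin> wr (pop 8 8) \<Longrightarrow> r2 y = r' y"
      have so: "same_out {8} m2 m" using ** * same_out_trans[of "{8}" m2 m' "{8}" m "{8}"] by (auto simp: I_def)
      have D: "DM m2" "RS m2 8 S" using same_out_rows(1)[OF so] m ** by auto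
      have r2: "rn r2" "r2 2 = of_int k" "r2 3 = t" "r2 1 = r' 1" using f * r1 by auto
      have vc: "val (cardx 8) r2 m2 (real (card S))" by (rule val_cardx8) (use r2 D SV in auto)
      have vJ: "val (Jx 8) r2 m2 (J S)" by (rule val_Jx8) (use r2 D SV in auto)
      have v2: "val (V 2) r2 m2 (of_int k)" "val (V 3) r2 m2 t" using r2 by (simp_all add: val_def)
      have va: "val (EqI (cardx 8) (V 2) (Ite (V 3) (Jx 8) (V 1) (C 1)) (V 1)) r2 m2
         (if real (card S) = of_int k then if t < J S then r2 1 else 1 else r2 1)"
        by (rule val_EqI[OF vc v2(1) val_Ite[OF v2(2) vJ val_Vr val_C] val_Vr]) auto
      have "(real (card S) = of_int k) = (int (card S) = k)" by linarith
      then have res: "0 < (if real (card S) = of_int k then if t < J S then r2 1 else 1 else r2 1) \<longleftrightarrow> good S \<or> 0 < r' 1"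
        using r2(4) by (auto simp: good_def)
      show "run M N (Asg 1 (EqI (cardx 8) (V 2) (Ite (V 3) (Jx 8) (V 1) (C 1)) (V 1))) (r2, m2) (I (Suc i))"
        by (rule run_Asg_val[OF va]) (use res ** so i * dr(2) in \<open>auto simp: I_def\<close>)
    qed auto
    then show "i < N \<and> run M N final_body (r', m') (I (Suc i))" using i L(1) by auto
  next
    fix i r' m' assume *: "I i (r', m')" "\<not> 0 < r' 8"
    then have "drop i (Ls 0) = []" using enc_pos[of n "drop i (Ls 0)"] by (auto simp: I_def)
    then have "take i (Ls 0) = Ls 0" by simp
    then show "0 < fst (r', m') 1 \<longleftrightarrow> (\<exists>S\<in>set (Ls 0). good S)" using * by (auto simp: I_def)
  qed
  then show ?thesis unfolding finalc_def good_def r1_def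
    by (intro run_Asg_Sq[OF v] run_Asg_Sq[OF val_C0])
qed

end

section \<open>Reading the input and setting up the tables\<close>

definition edgex :: aexp where
  "edgex = Plus (EqI (Mat (C 0) (Plus (C 4) (Times (C 2) (V 30)))) (V 5)
      (EqI (Mat (C 0) (Plus (C 5) (Times (C 2) (V 30)))) (V 6) (C 1) (C 0)) (C 0))
    (EqI (Mat (C 0) (Plus (C 4) (Times (C 2) (V 30)))) (V 6)
      (EqI (Mat (C 0) (Plus (C 5) (Times (C 2) (V 30)))) (V 5) (C 1) (C 0)) (C 0))"

text \<open>\<open>2 * n\<close> stands for an unknown distance: it exceeds every distance and every
  round bound with which it is compared.\<close>

definition initx :: aexp where
  "initx = EqI (V 5) (V 6) (C 0) (Ite (C 0) (Sm 30 (Ite (V 30) (V 14) edgex (C 0))) (C 1) (Times (C 2) (V 0)))"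

definition distinit :: com where
  "distinit = For 5 (For 6 (Sto (Plus (V 5) (C 11)) (V 6) initx))"

definition relx :: aexp where
  "relx = Ite (Plus (V 15) (C 1)) (Dx (V 5) (V 6)) (Ite (C 0)
     (Sm 30 (EqI (Dx (V 5) (V 30)) (Plus (V 15) (C 1)) (EqI (Dx (V 30) (V 6)) (C 1) (C 1) (C 0)) (C 0)))
     (Plus (V 15) (C 2)) (Dx (V 5) (V 6))) (Dx (V 5) (V 6))"

definition distc :: com where
  "distc = For 15 (For 5 (For 6 (Sto (Plus (V 5) (C 11)) (V 6) relx)))"

definition powc :: com where
  "powc = For 5 (Sto (C 6) (V 5) (Ite (C 0) (V 5) (Times (Mat (C 6) (Minus (V 5) (C 1))) (Plus (V 0) (C 1))) (C 1)))"

definition listc_body :: com where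
  "listc_body = Sq (Sto (C 4) (V 5) (V 5)) (Sq (For 6 (Sto (C 7) (V 6) (C 0))) (Sq (Asg 8 (C 0))
     (Sq (push 8 7) (Sq (Sto (C 7) (V 5) (C 1)) (Sq (push 8 7) (Sto (C 5) (V 5) (V 8)))))))"

definition listc :: com where
  "listc = For 5 listc_body"

text \<open>At the first read register \<open>0\<close> still holds \<open>0\<close>; the address is
  right nevertheless, because row \<open>0\<close> starts at address \<open>0\<close> for any row
  length. The threshold is doubled since \<open>J\<close> counts ordered pairs.\<close>

definition minigl :: com where
  "minigl = Sq (Asg 0 (Mat (C 0) (C 0))) (Sq (Asg 2 (Mat (C 0) (C 2))) (Sq (Asg 3 (Times (C 2) (Mat (C 0) (C 3))))
     (Sq (Asg 14 (Mat (C 0) (C 1))) (Sq distinit (Sq distc (Sq powc (Sq listc (Sq mainc finalc))))))))"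

lemma wr_listc_body [simp]: "wr listc_body = {4, 6, 8}" by (auto simp: listc_body_def)

lemma sum_pos_iff: "\<lbrakk>\<And>i :: nat. i < n \<Longrightarrow> 0 \<le> f i\<rbrakk> \<Longrightarrow> 0 < (\<Sum>i<n. f i) \<longleftrightarrow> (\<exists>i<n. 0 < (f i :: real))"
proof (induction n)
  case (Suc n)
  have "0 \<le> (\<Sum>i<n. f i)" by (rule sum_nonneg) (use Suc.prems in auto)
  moreover have "0 < (\<Sum>i<n. f i) \<longleftrightarrow> (\<exists>i<n. 0 < f i)" using Suc.IH Suc.prems by auto
  moreover have "0 \<le> f n" using Suc.prems by auto
  moreover from calculation have "0 < (\<Sum>i<n. f i) + f n \<longleftrightarrow> 0 < (\<Sum>i<n. f i) \<or> 0 < f n" by linarith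
  ultimately have "0 < (\<Sum>i<Suc n. f i) \<longleftrightarrow> (\<exists>i<n. 0 < f i) \<or> 0 < f n" unfolding sum.lessThan_Suc by blast
  then show ?case by (auto simp: less_Suc_eq)
qed simp

context machine
begin

text \<open>Row \<open>0\<close> turns the matrix address into the plain address \<open>a\<close>,
  even beyond column \<open>n\<close>, so the whole input can be read through it.\<close>

lemma val_input:
  assumes "rn r" "val b r m (real a)" "a < M" "m a = v"
  shows "val (Mat (C 0) b) r m v"
  using assms by (auto simp: val_def cell_def)

text \<open>Distances are computed in rounds: after round \<open>j\<close>, exactly those up to \<open>j + 1\<close> are known.\<close>

definition tr :: "nat \<Rightarrow> nat \<Rightarrow> nat \<Rightarrow> nat" where
  "tr j u w = (if d u w \<le> j then d u w else 2 * n)"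

text \<open>Progress within round \<open>i\<close>: the entries before \<open>(u, w)\<close> in row
  order are already updated, the others are in the state left by the previous round.\<close>

definition DT :: "nat \<Rightarrow> nat \<Rightarrow> nat \<Rightarrow> (nat \<Rightarrow> real) \<Rightarrow> bool" where
  "DT i u w m \<longleftrightarrow> (\<forall>u'<n. \<forall>w'<n. m (cell n (u' + 11) w') =
     real (tr (if u' < u \<or> u' = u \<and> w' < w then i + 2 else i + 1) u' w'))"

lemma val_Dt:
  assumes "rn r" "val a r m (real u)" "val b r m (real w)" "u < n" "w < n" "m (cell n (u + 11) w) = v"
  shows "val (Dx a b) r m v"
  unfolding Dx_def
proof (rule val_Mat[OF assms(1), where i = "u + 11" and j = w])
  show "val (Plus a (C 11)) r m (real (u + 11))"
    by (rule val_cong[OF val_Plus[OF assms(2) val_C[OF refl]]]) auto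
qed (use assms in auto)

lemma run_distc:
  assumes r: "rn r" and m: "DT 0 0 0 m"
  shows "run M N distc (r, m) (\<lambda>s. DM (snd s))"
  unfolding distc_def
proof (rule run_For_mem[where I = "\<lambda>i m. DT i 0 0 m"])
  fix i ri mi assume i: "i < n" "DT i 0 0 mi" "ri 15 = real i" "rn ri"
  show "run M N (For 5 (For 6 (Sto (Plus (V 5) (C 11)) (V 6) relx))) (ri, mi) (\<lambda>s. DT (Suc i) 0 0 (snd s))"
  proof (rule run_For_mem[where I = "\<lambda>u m. DT i u 0 m"])
    fix u ru mu assume u: "u < n" "DT i u 0 mu" "ru 5 = real u" "rn ru"
      "\<And>y. y \<notin> insert 5 (wr (For 6 (Sto (Plus (V 5) (C 11)) (V 6) relx))) \<Longrightarrow> ru y = ri y"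
    show "run M N (For 6 (Sto (Plus (V 5) (C 11)) (V 6) relx)) (ru, mu) (\<lambda>s. DT i (Suc u) 0 (snd s))"
    proof (rule run_For_mem[where I = "\<lambda>w m. DT i u w m"])
      fix w rw mw assume w: "w < n" "DT i u w mw" "rw 6 = real w" "rn rw"
        "\<And>y. y \<notin> insert 6 (wr (Sto (Plus (V 5) (C 11)) (V 6) relx)) \<Longrightarrow> rw y = ru y"
      have rw: "rw 15 = real i" "rw 5 = real u" using w(5)[of 15] w(5)[of 5] u(3) u(5)[of 15] i(3) by auto
      have v5: "val (V 5) rw mw (real u)" and v6: "val (V 6) rw mw (real w)"
        using rw w by (simp_all add: val_def)
      have D: "mw (cell n (u' + 11) w') = real (tr (if u' < u \<or> u' = u \<and> w' < w then i + 2 else i + 1) u' w')"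
        if "u' < n" "w' < n" for u' w' using w(2) that by (auto simp: DT_def)
      have vuw: "val (Dx (V 5) (V 6)) rw mw (real (tr (i + 1) u w))"
        by (rule val_Dt[OF w(4) v5 v6 u(1) w(1)]) (use D[OF u(1) w(1)] in simp)
      let ?f = "\<lambda>x. if mw (cell n (u + 11) x) = real i + 1 then if mw (cell n (x + 11) w) = 1 then 1 else 0 else 0 :: real"
      have vs: "val (Sm 30 (EqI (Dx (V 5) (V 30)) (Plus (V 15) (C 1)) (EqI (Dx (V 30) (V 6)) (C 1) (C 1) (C 0)) (C 0))) rw mw (\<Sum>x<n. ?f x)"
      proof (rule val_Sm[OF w(4)])
        fix x assume x: "x < n"
        let ?r = "rw(30 := real x)"
        have rn: "rn ?r" using w by simp
        have v: "val (V 5) ?r mw (real u)" "val (V 6) ?r mw (real w)" "val (V 30) ?r mw (real x)" "val (V 15) ?r mw (real i)"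
          using rw w by (simp_all add: val_def)
        show "val (EqI (Dx (V 5) (V 30)) (Plus (V 15) (C 1)) (EqI (Dx (V 30) (V 6)) (C 1) (C 1) (C 0)) (C 0)) ?r mw (?f x)"
          by (rule val_EqI[OF val_Dt[OF rn v(1,3) u(1) x refl] val_Plus[OF v(4) val_C]
                val_EqI[OF val_Dt[OF rn v(3,2) x w(1) refl] val_C val_C val_C] val_C]) auto
      qed
      \<comment> \<open>Updating in place is harmless: the only new value in this round is
        \<open>i + 2\<close>, whereas the search looks for \<open>i + 1\<close> and
        \<open>1\<close>.\<close>
      have d1: "mw (cell n (u + 11) x) = real i + 1 \<longleftrightarrow> d u x = i + 1" if "x < n" for x
        using D[OF u(1) that] i(1) by (auto simp: tr_def)
      have d2: "mw (cell n (x + 11) w) = 1 \<longleftrightarrow> d x w = 1" if "x < n" for x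
        using D[OF that w(1)] n_pos by (auto simp: tr_def)
      have "0 < (\<Sum>x<n. ?f x) \<longleftrightarrow> (\<exists>x<n. d u x = i + 1 \<and> d x w = 1)"
        by (subst sum_pos_iff) (auto simp: d1 d2)
      also have "\<dots> \<longleftrightarrow> d u w = i + 2" if "i + 1 < d u w"
      proof
        assume "\<exists>x<n. d u x = i + 1 \<and> d x w = 1"
        then obtain x where "x < n" "d u x = i + 1" "d x w = 1" by blast
        then show "d u w = i + 2" using d_tri[OF u(1) _ w(1), of x] that by simp
      next
        assume "d u w = i + 2"
        then show "\<exists>x<n. d u x = i + 1 \<and> d x w = 1" using d_geodesic[OF u(1) w(1), of "i + 1"] by auto
      qed
      finally have s: "i + 1 < d u w \<Longrightarrow> 0 < (\<Sum>x<n. ?f x) \<longleftrightarrow> d u w = i + 2" .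
      have v15: "val (Plus (V 15) (C 1)) rw mw (real i + 1)" "val (Plus (V 15) (C 2)) rw mw (real i + 2)"
        using rw by (simp_all add: val_def)
      have "val relx rw mw (if real i + 1 < real (tr (i + 1) u w) then if 0 < (\<Sum>x<n. ?f x) then real i + 2
         else real (tr (i + 1) u w) else real (tr (i + 1) u w))"
        unfolding relx_def by (rule val_Ite[OF v15(1) vuw val_Ite[OF val_C0 vs v15(2) vuw] vuw])
      moreover have "(if real i + 1 < real (tr (i + 1) u w) then if 0 < (\<Sum>x<n. ?f x) then real i + 2
         else real (tr (i + 1) u w) else real (tr (i + 1) u w)) = real (tr (i + 2) u w)"
      proof (cases "d u w \<le> i + 1")
        case True
        then have "tr (i + 1) u w = d u w" "tr (i + 2) u w = d u w" by (auto simp: tr_def)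
        with True show ?thesis by auto
      next
        case False
        then have "tr (i + 1) u w = 2 * n" "real i + 1 < real (2 * n)" using i(1) by (auto simp: tr_def)
        with False s show ?thesis by (auto simp: tr_def)
      qed
      ultimately have v: "val relx rw mw (real (tr (i + 2) u w))" by simp
      have v511: "val (Plus (V 5) (C 11)) rw mw (real (u + 11))" using rw by (simp add: val_def)
      show "run M N (Sto (Plus (V 5) (C 11)) (V 6) relx) (rw, mw) (\<lambda>s. DT i u (Suc w) (snd s))"
      proof (rule run_Sto_val[OF w(4) v511 v6 v])
        show "DT i u (Suc w) (snd (rw, mw(cell n (u + 11) w := real (tr (i + 2) u w))))"
          unfolding DT_def snd_conv
        proof (intro allI impI)
          fix u' w' assume a: "u' < n" "w' < n"
          show "(mw(cell n (u + 11) w := real (tr (i + 2) u w))) (cell n (u' + 11) w') =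
            real (tr (if u' < u \<or> u' = u \<and> w' < Suc w then i + 2 else i + 1) u' w')"
          proof (cases "u' = u \<and> w' = w")
            case False
            then have "cell n (u' + 11) w' \<noteq> cell n (u + 11) w" using a w(1) by simp
            moreover have "(u' < u \<or> u' = u \<and> w' < Suc w) = (u' < u \<or> u' = u \<and> w' < w)" using False by auto
            ultimately show ?thesis using D[OF a] by simp
          qed auto
        qed
      qed (use u w in auto)
    next
      fix r' :: "nat \<Rightarrow> real" and m' assume "DT i u n m'"
      then show "DT i (Suc u) 0 (snd (r', m'))" by (auto simp: DT_def less_Suc_eq)
    qed (use u in auto)
  next
    fix r' :: "nat \<Rightarrow> real" and m' assume "DT i n 0 m'"
    then show "DT (Suc i) 0 0 (snd (r', m'))" by (auto simp: DT_def)
  qed (use i in auto)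
next
  fix r' :: "nat \<Rightarrow> real" and m' assume "DT n 0 0 m'"
  moreover have "tr (n + 1) u w = d u w" if "u < n" "w < n" for u w
    using d_less[OF that] by (simp add: tr_def)
  ultimately show "DM (snd (r', m'))" by (simp add: DT_def DM_def)
qed (use r m in auto)

lemma run_powc:
  assumes r: "rn r" and m: "DM m"
  shows "run M N powc (r, m) (\<lambda>s. DM (snd s) \<and> PW (snd s))"
  unfolding powc_def
proof (rule run_For_mem[where I = "\<lambda>i m'. same_out {6} m' m \<and> (\<forall>j<i. m' (cell n 6 j) = real ((n + 1) ^ j))"])
  fix i r' m' assume *: "i < n" "same_out {6} m' m \<and> (\<forall>j<i. m' (cell n 6 j) = real ((n + 1) ^ j))" "r' 5 = real i" "rn r'"
  have v5: "val (V 5) r' m' (real i)" and v5': "val (Minus (V 5) (C 1)) r' m' (real (i - 1))" if "0 < i" using * that by (auto simp: val_def)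
  have v50: "val (V 5) r' m' (real i)" using * by (simp add: val_def)
  have v0: "val (Plus (V 0) (C 1)) r' m' (real n + 1)" using * by (simp add: val_def)
  have vp: "val (Mat (C 6) (Minus (V 5) (C 1))) r' m' (real ((n + 1) ^ (i - 1)))" if "0 < i"
    by (rule val_rown[OF *(4) v5'[OF that]]) (use * that in auto)
  have "val (Ite (C 0) (V 5) (Times (Mat (C 6) (Minus (V 5) (C 1))) (Plus (V 0) (C 1))) (C 1)) r' m'
     (if 0 < real i then real ((n + 1) ^ (i - 1)) * (real n + 1) else 1)"
    by (rule val_Ite[OF val_C0 v50 val_Times[OF vp v0] val_C]) auto
  moreover have "(if 0 < real i then real ((n + 1) ^ (i - 1)) * (real n + 1) else 1) = real ((n + 1) ^ i)"
    by (cases i) (auto simp: algebra_simps)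
  ultimately have v: "val (Ite (C 0) (V 5) (Times (Mat (C 6) (Minus (V 5) (C 1))) (Plus (V 0) (C 1))) (C 1)) r' m' (real ((n + 1) ^ i))" by simp
  have v6: "val (C 6) r' m' (real 6)" by (simp add: val_def)
  show "run M N (Sto (C 6) (V 5) (Ite (C 0) (V 5) (Times (Mat (C 6) (Minus (V 5) (C 1))) (Plus (V 0) (C 1))) (C 1))) (r', m')
     (\<lambda>s. same_out {6} (snd s) m \<and> (\<forall>j<Suc i. snd s (cell n 6 j) = real ((n + 1) ^ j)))"
  proof (rule run_Sto_val[OF *(4) v6 v50 v])
    show "same_out {6} (snd (r', m'(cell n 6 i := real ((n + 1) ^ i)))) m \<and>
       (\<forall>j<Suc i. snd (r', m'(cell n 6 i := real ((n + 1) ^ i))) (cell n 6 j) = real ((n + 1) ^ j))"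
      using * same_out_upd[of i 6 "{6}" m' m] by (auto simp: less_Suc_eq)
  qed (use * in auto)
next
  fix r' :: "nat \<Rightarrow> real" and m' assume *: "same_out {6} m' m \<and> (\<forall>j<n. m' (cell n 6 j) = real ((n + 1) ^ j))"
  then show "DM (snd (r', m')) \<and> PW (snd (r', m'))" using same_out_rows(1)[of "{6}" m' m] m by (auto simp: PW_def)
qed (use r same_out_refl in auto)

lemma run_listc:
  assumes r: "rn r" and m: "DM m" "PW m"
  shows "run M N listc (r, m) (\<lambda>s. DM (snd s) \<and> PW (snd s) \<and> RP (snd s) (fst st0) \<and> LS (snd s) (snd st0))"
  unfolding listc_def
proof (rule run_For_mem[where I = "\<lambda>i m'. DM m' \<and> PW m' \<and> (\<forall>u<i. m' (cell n 4 u) = real u) \<and> (\<forall>u<i. m' (cell n 5 u) = enc n [{u}, {}])"])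
  fix i r' m' assume *: "i < n" "DM m' \<and> PW m' \<and> (\<forall>u<i. m' (cell n 4 u) = real u) \<and> (\<forall>u<i. m' (cell n 5 u) = enc n [{u}, {}])"
    "r' 5 = real i" "rn r'"
  have v5: "val (V 5) r' m'' (real i)" for m'' using * by (simp add: val_def)
  have v4: "val (C 4) ra ma (real 4)" "val (C 7) ra ma (real 7)" "val (C 5) ra ma (real 5)" for ra ma by (simp_all add: val_def)
  let ?Q = "\<lambda>s. DM (snd s) \<and> PW (snd s) \<and> (\<forall>u<Suc i. snd s (cell n 4 u) = real u) \<and> (\<forall>u<Suc i. snd s (cell n 5 u) = enc n [{u}, {}])"
  define m1 where "m1 = m'(cell n 4 i := real i)"
  have so1: "same_out {4} m1 m'" unfolding m1_def by (rule same_out_upd) (use * same_out_refl in auto)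
  show "run M N listc_body (r', m') ?Q" unfolding listc_body_def
  proof (rule run_Sto_Sq[OF *(4) v4(1) v5 v5], simp, rule *(1), fold m1_def,
      rule run_Sq_post[where R = "\<lambda>s. RS (snd s) 7 {} \<and> same_out {7} (snd s) m1"])
    show "run M N (For 6 (Sto (C 7) (V 6) (C 0))) (r', m1) (\<lambda>s. RS (snd s) 7 {} \<and> same_out {7} (snd s) m1)"
    proof (rule run_For_mem[where I = "\<lambda>j m''. same_out {7} m'' m1 \<and> (\<forall>h<j. m'' (cell n 7 h) = 0)"])
      fix j ra ma assume a: "j < n" "same_out {7} ma m1 \<and> (\<forall>h<j. ma (cell n 7 h) = 0)" "ra 6 = real j" "rn ra"
      have v6: "val (V 6) ra ma (real j)" using a by (simp add: val_def)
      show "run M N (Sto (C 7) (V 6) (C 0)) (ra, ma) (\<lambda>s. same_out {7} (snd s) m1 \<and> (\<forall>h<Suc j. snd s (cell n 7 h) = 0))"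
        by (rule run_Sto_val[OF a(4) v4(2) v6 val_C0]) (use a same_out_upd[of j 7 "{7}" ma m1] in \<open>auto simp: less_Suc_eq\<close>)
    next
      fix ra :: "nat \<Rightarrow> real" and ma assume "same_out {7} ma m1 \<and> (\<forall>h<n. ma (cell n 7 h) = 0)"
      then show "RS (snd (ra, ma)) 7 {} \<and> same_out {7} (snd (ra, ma)) m1" by (auto simp: RS_def)
    qed (use * same_out_refl in auto)
  next
    fix r2 :: "nat \<Rightarrow> real" and m2
    assume a: "RS (snd (r2, m2)) 7 {} \<and> same_out {7} (snd (r2, m2)) m1"
      and f2: "\<And>y. y \<notin> wr (For 6 (Sto (C 7) (V 6) (C 0))) \<Longrightarrow> r2 y = r' y"
    define r3 where "r3 = r2(8 := 0)"
    have r3: "rn r3" "r3 8 = enc n []" "r3 5 = real i" using f2 * by (auto simp: r3_def)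
    have m2: "RS m2 7 {}" using a by simp
    show "run M N (Sq (Asg 8 (C 0)) (Sq (push 8 7) (Sq (Sto (C 7) (V 5) (C 1)) (Sq (push 8 7) (Sto (C 5) (V 5) (V 8)))))) (r2, m2) ?Q"
    proof (rule run_Asg_Sq[OF val_C0], fold r3_def, rule run_Sq_post[OF run_push7[OF r3(1,2) m2]])
      fix r4 :: "nat \<Rightarrow> real" and m4 assume b: "fst (r4, m4) 8 = enc n [{}] \<and> snd (r4, m4) = m2"
        and f4: "\<And>y. y \<notin> wr (push 8 7) \<Longrightarrow> r4 y = r3 y"
      have r4: "rn r4" "r4 8 = enc n [{}]" "r4 5 = real i" using f4 r3 b by auto
      have v5: "val (V 5) r4 m4 (real i)" using r4 by (simp add: val_def)
      define m5 where "m5 = m4(cell n 7 i := 1)"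
      have RS5: "RS m5 7 {i}" using m2 b *(1) by (auto simp: RS_def m5_def)
      have so5: "same_out {4, 7} m5 m'"
      proof -
        have "same_out {7} m5 m1" unfolding m5_def by (rule same_out_upd) (use a b * in auto)
        then show ?thesis using same_out_trans[OF _ so1] by auto
      qed
      have i4: "m5 (cell n 4 i) = real i" using a b *(1) by (auto simp: m5_def m1_def same_out_def)
      show "run M N (Sq (Sto (C 7) (V 5) (C 1)) (Sq (push 8 7) (Sto (C 5) (V 5) (V 8)))) (r4, m4) ?Q"
      proof (rule run_Sto_Sq[OF r4(1) v4(2) v5 val_C], rule of_int_1, simp, rule *(1), fold m5_def,
          rule run_Sq_post[OF run_push7[OF r4(1,2) RS5]])
        fix r6 :: "nat \<Rightarrow> real" and m6 assume c: "fst (r6, m6) 8 = enc n [{i}, {}] \<and> snd (r6, m6) = m5"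
          and f6: "\<And>y. y \<notin> wr (push 8 7) \<Longrightarrow> r6 y = r4 y"
        have r6: "rn r6" using f6 r4 by auto
        have v: "val (V 5) r6 m6 (real i)" "val (V 8) r6 m6 (enc n [{i}, {}])" using f6 r4 c by (auto simp: val_def)
        define m7 where "m7 = m5(cell n 5 i := enc n [{i}, {}])"
        have so7: "same_out {4, 5, 7} m7 m'"
        proof -
          have "same_out {5} m7 m5" unfolding m7_def by (rule same_out_upd) (use * same_out_refl in auto)
          then show ?thesis using same_out_trans[OF _ so5] by auto
        qed
        have D7: "DM m7" "PW m7" using same_out_rows[OF so7] * by auto
        have c4: "m7 (cell n 4 u) = real u" if "u < Suc i" for u
        proof (cases "u = i")
          case True
          then show ?thesis using i4 * by (simp add: m7_def)
        next
          case False
          then have "u < i" "u < n" using that * by auto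
          then have "m5 (cell n 4 u) = m' (cell n 4 u)" using a b * by (auto simp: m5_def m1_def same_out_def)
          then show ?thesis using * \<open>u < i\<close> \<open>u < n\<close> by (simp add: m7_def)
        qed
        have c5: "m7 (cell n 5 u) = enc n [{u}, {}]" if "u < Suc i" for u
        proof (cases "u = i")
          case False
          then have "u < i" "u < n" using that * by auto
          then show ?thesis using so5 * by (simp add: m7_def same_out_def)
        qed (simp add: m7_def)
        show "run M N (Sto (C 5) (V 5) (V 8)) (r6, m6) ?Q"
        proof (rule run_Sto_val[OF r6 v4(3) v])
          have e: "m6 = m5" using c by simp
          show "?Q (r6, m6(cell n 5 i := enc n [{i}, {}]))"
            unfolding e m7_def[symmetric] snd_conv using D7 c4 c5 by blast
        qed (use *(1) in auto)
      qed auto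
    qed auto
  qed
next
  fix r' :: "nat \<Rightarrow> real" and m'
  assume "DM m' \<and> PW m' \<and> (\<forall>u<n. m' (cell n 4 u) = real u) \<and> (\<forall>u<n. m' (cell n 5 u) = enc n [{u}, {}])"
  then show "DM (snd (r', m')) \<and> PW (snd (r', m')) \<and> RP (snd (r', m')) (fst st0) \<and> LS (snd (r', m')) (snd st0)"
    by (simp add: RP_def LS_def st0_def)
qed (use r m in auto)

text \<open>Every pair scans the edge list again, so the input has to survive while the table is
  written. It lies below \<open>4 * n\<close>, and the table starts at
  \<open>11 * n\<close>.\<close>

lemma run_distinit:
  assumes r: "rn r" "r 14 = real (length es)" and es: "length es < n"
    and m: "\<And>e. e < length es \<Longrightarrow> m (4 + 2 * e) = real (fst (es ! e)) \<and> m (5 + 2 * e) = real (snd (es ! e))"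
    and edges: "\<And>u w. \<lbrakk>u < n; w < n\<rbrakk> \<Longrightarrow> d u w = 1 \<longleftrightarrow> (\<exists>e<length es. es ! e = (u, w) \<or> es ! e = (w, u))"
  shows "run M N distinit (r, m) (\<lambda>s. DT 0 0 0 (snd s))"
  unfolding distinit_def
proof (rule run_For_mem[where I = "\<lambda>u m'. (\<forall>a<4 * n. m' a = m a) \<and> (\<forall>u'<u. \<forall>w<n. m' (cell n (u' + 11) w) = real (tr 1 u' w))"])
  fix u ru mu assume u: "u < n" "(\<forall>a<4 * n. mu a = m a) \<and> (\<forall>u'<u. \<forall>w<n. mu (cell n (u' + 11) w) = real (tr 1 u' w))"
    "ru 5 = real u" "rn ru" "\<And>y. y \<notin> insert 5 (wr (For 6 (Sto (Plus (V 5) (C 11)) (V 6) initx))) \<Longrightarrow> ru y = r y"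
  show "run M N (For 6 (Sto (Plus (V 5) (C 11)) (V 6) initx)) (ru, mu)
    (\<lambda>s. (\<forall>a<4 * n. snd s a = m a) \<and> (\<forall>u'<Suc u. \<forall>w<n. snd s (cell n (u' + 11) w) = real (tr 1 u' w)))"
  proof (rule run_For_mem[where I = "\<lambda>w m'. (\<forall>a<4 * n. m' a = m a) \<and> (\<forall>u'<u. \<forall>w<n. m' (cell n (u' + 11) w) = real (tr 1 u' w))
      \<and> (\<forall>w'<w. m' (cell n (u + 11) w') = real (tr 1 u w'))"])
    fix w rw mw assume w: "w < n" "(\<forall>a<4 * n. mw a = m a) \<and> (\<forall>u'<u. \<forall>w<n. mw (cell n (u' + 11) w) = real (tr 1 u' w))
      \<and> (\<forall>w'<w. mw (cell n (u + 11) w') = real (tr 1 u w'))" "rw 6 = real w" "rn rw"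
      "\<And>y. y \<notin> insert 6 (wr (Sto (Plus (V 5) (C 11)) (V 6) initx)) \<Longrightarrow> rw y = ru y"
    have rw: "rw 5 = real u" "rw 14 = real (length es)" using w(5)[of 5] w(5)[of 14] u(3) u(5)[of 14] r by auto
    let ?f = "\<lambda>e. if real e < real (length es) then
       (if real (fst (es ! e)) = real u then (if real (snd (es ! e)) = real w then 1 else 0) else 0) +
       (if real (fst (es ! e)) = real w then (if real (snd (es ! e)) = real u then 1 else 0) else 0) else 0 :: real"
    have vs: "val (Sm 30 (Ite (V 30) (V 14) edgex (C 0))) rw mw (\<Sum>e<n. ?f e)"
    proof (rule val_Sm[OF w(4)])
      fix e assume e: "e < n"
      let ?r = "rw(30 := real e)"
      have rn: "rn ?r" using w by simp
      have v: "val (V 5) ?r mw (real u)" "val (V 6) ?r mw (real w)" "val (V 30) ?r mw (real e)" "val (V 14) ?r mw (real (length es))"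
        using rw w by (simp_all add: val_def)
      have i4: "val (Plus (C 4) (Times (C 2) (V 30))) ?r mw (real (4 + 2 * e))" "val (Plus (C 5) (Times (C 2) (V 30))) ?r mw (real (5 + 2 * e))"
        by (simp_all add: val_def)
      have "val edgex ?r mw ((if real (fst (es ! e)) = real u then (if real (snd (es ! e)) = real w then 1 else 0) else 0) +
       (if real (fst (es ! e)) = real w then (if real (snd (es ! e)) = real u then 1 else 0) else 0))"
        if el: "e < length es"
      proof -
        have lt: "4 + 2 * e < 4 * n" "5 + 2 * e < 4 * n" using el es by auto
        have "4 * n \<le> M" unfolding M by (intro mult_right_mono) auto
        then have lM: "4 + 2 * e < M" "5 + 2 * e < M" using lt by auto
        have cells: "mw (4 + 2 * e) = real (fst (es ! e))" "mw (5 + 2 * e) = real (snd (es ! e))"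
          using w(2) lt m[OF el] by auto
        note a = val_input[OF rn i4(1) lM(1) cells(1)] note b = val_input[OF rn i4(2) lM(2) cells(2)]
        show ?thesis unfolding edgex_def
          by (rule val_Plus[OF val_EqI[OF a v(1) val_EqI[OF b v(2) val_C val_C] val_C] val_EqI[OF a v(2) val_EqI[OF b v(1) val_C val_C] val_C]]) auto
      qed
      then show "val (Ite (V 30) (V 14) edgex (C 0)) ?r mw (?f e)"
        by (intro val_Ite[OF v(3,4)]) (auto intro: val_C)
    qed
    have "0 < (\<Sum>e<n. ?f e) \<longleftrightarrow> (\<exists>e<n. 0 < ?f e)" by (rule sum_pos_iff) auto
    also have "\<dots> \<longleftrightarrow> (\<exists>e<length es. es ! e = (u, w) \<or> es ! e = (w, u))"
      using es by (auto simp: prod_eq_iff split: if_splits)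
    also have "\<dots> \<longleftrightarrow> d u w = 1" using edges[OF u(1) w(1)] by simp
    finally have s: "0 < (\<Sum>e<n. ?f e) \<longleftrightarrow> d u w = 1" .
    have v5: "val (V 5) rw mw (real u)" and v6: "val (V 6) rw mw (real w)" and v2n: "val (Times (C 2) (V 0)) rw mw (real (2 * n))"
      and v511: "val (Plus (V 5) (C 11)) rw mw (real (u + 11))"
      using rw w by (simp_all add: val_def)
    have "val initx rw mw (if real u = real w then 0 else if 0 < (\<Sum>e<n. ?f e) then 1 else real (2 * n))"
      unfolding initx_def by (rule val_EqI[OF v5 v6 val_C val_Ite[OF val_C0 vs val_C v2n]]) auto
    moreover have "(if real u = real w then 0 else if 0 < (\<Sum>e<n. ?f e) then 1 else real (2 * n)) = real (tr 1 u w)"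
      unfolding s using d_zero[OF u(1) w(1)] by (auto simp: tr_def le_Suc_eq)
    ultimately have v: "val initx rw mw (real (tr 1 u w))" by simp
    have big: "cell n (u + 11) w \<noteq> a" if "a < 4 * n" for a
    proof -
      have "11 * n \<le> (u + 11) * n" by (rule mult_right_mono) auto
      then have "11 * n \<le> cell n (u + 11) w" unfolding cell_def by linarith
      then show ?thesis using that by auto
    qed
    show "run M N (Sto (Plus (V 5) (C 11)) (V 6) initx) (rw, mw)
      (\<lambda>s. (\<forall>a<4 * n. snd s a = m a) \<and> (\<forall>u'<u. \<forall>w<n. snd s (cell n (u' + 11) w) = real (tr 1 u' w))
      \<and> (\<forall>w'<Suc w. snd s (cell n (u + 11) w') = real (tr 1 u w')))"
    proof (rule run_Sto_val[OF w(4) v511 v6 v])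
      let ?m = "snd (rw, mw(cell n (u + 11) w := real (tr 1 u w)))"
      have "?m a = m a" if "a < 4 * n" for a using big[OF that] w(2) that by auto
      moreover have "?m (cell n (u' + 11) w') = real (tr 1 u' w')" if "u' < u" "w' < n" for u' w' using w(1,2) that by auto
      moreover have "?m (cell n (u + 11) w') = real (tr 1 u w')" if "w' < Suc w" for w'
        using w(1,2) that by (cases "w' = w") auto
      ultimately show "(\<forall>a<4 * n. ?m a = m a) \<and> (\<forall>u'<u. \<forall>w<n. ?m (cell n (u' + 11) w) = real (tr 1 u' w))
        \<and> (\<forall>w'<Suc w. ?m (cell n (u + 11) w') = real (tr 1 u w'))" by blast
    qed (use u w in auto)
  qed (use u in \<open>auto simp: less_Suc_eq\<close>)
next
  fix r' :: "nat \<Rightarrow> real" and m'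
  assume "(\<forall>a<4 * n. m' a = m a) \<and> (\<forall>u'<n. \<forall>w<n. m' (cell n (u' + 11) w) = real (tr 1 u' w))"
  then show "DT 0 0 0 (snd (r', m'))" by (auto simp: DT_def)
qed (use r in auto)

end


section \<open>Running time\<close>

lemma nth_concat_pairs:
  "e < length es \<Longrightarrow> concat (map (\<lambda>(u, v). [real u, real v]) es) ! (2 * e) = real (fst (es ! e)) \<and>
    concat (map (\<lambda>(u, v). [real u, real v]) es) ! Suc (2 * e) = real (snd (es ! e))"
proof (induction es arbitrary: e)
  case (Cons a es)
  show ?case
  proof (cases e)
    case 0
    then show ?thesis by (cases a) auto
  next
    case (Suc e')
    then have "2 * e = Suc (Suc (2 * e'))" by simp
    then show ?thesis using Cons.IH[of e'] Cons.prems Suc by (cases a) auto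
  qed
qed simp

lemma length_concat_pairs [simp]: "length (concat (map (\<lambda>(u, v). [real u, real v]) es)) = 2 * length es"
  by (induction es) auto

context machine
begin

lemma run_minigl:
  fixes es :: "(nat \<times> nat) list" and k :: int and \<tau> :: real
  defines "m0 \<equiv> \<lambda>a. if a < length (encode_instance n es k \<tau>) then encode_instance n es k \<tau> ! a else 0"
  assumes es: "length es < n"
    and edges: "\<And>u w. \<lbrakk>u < n; w < n\<rbrakk> \<Longrightarrow> d u w = 1 \<longleftrightarrow> (\<exists>e<length es. es ! e = (u, w) \<or> es ! e = (w, u))"
    and Nb: "short k Nb" "Nb \<le> N" "2 \<le> Nb"
  shows "run M N minigl (\<lambda>_. 0, m0) (\<lambda>s. 0 < fst s 1 \<longleftrightarrow> (\<exists>S\<subseteq>{..<n}. int (card S) = k \<and> J S \<le> 2 * \<tau>))"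
proof -
  have "11 * n \<le> M" unfolding M by (rule mult_right_mono) auto
  then have M4: "0 < M" "1 < M" "2 < M" "3 < M" using n_pos by auto
  have xs: "m0 0 = real n" "m0 1 = real (length es)" "m0 2 = of_int k" "m0 3 = \<tau>"
    by (simp_all add: m0_def encode_instance_def)
  have xe: "m0 (4 + 2 * e) = real (fst (es ! e)) \<and> m0 (5 + 2 * e) = real (snd (es ! e))" if "e < length es" for e
  proof -
    have "5 + 2 * e = Suc (4 + 2 * e)" by simp
    moreover have "4 + 2 * e = Suc (Suc (Suc (Suc (2 * e))))" by simp
    ultimately show ?thesis using that nth_concat_pairs[OF that]
      by (simp add: m0_def encode_instance_def)
  qed
  let ?r0 = "\<lambda>_ :: nat. 0 :: real"
  have s0: "safe M N (Mat (C 0) (C 0)) ?r0 m0" "ev (Mat (C 0) (C 0)) ?r0 m0 = real n"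
    using M4 xs by (auto simp: cell_def)
  have v0: "val (Mat (C 0) (C 0)) ?r0 m0 (real n)" using s0 by (simp add: val_def)
  define r1 where "r1 = ?r0(0 := real n)"
  define r2 where "r2 = r1(2 := real_of_int k)"
  define r3 where "r3 = r2(3 := 2 * \<tau>)"
  define r4 where "r4 = r3(14 := real (length es))"
  have rn: "rn r1" "rn r2" "rn r3" by (simp_all add: r1_def r2_def r3_def)
  have cc: "val (C 1) r m (real 1)" "val (C 2) r m (real 2)" "val (C 3) r m (real 3)" for r m by (simp_all add: val_def)
  have v1: "val (Mat (C 0) (C 2)) r1 m0 (of_int k)" by (rule val_input[where a = 2 and m = m0, OF rn(1) cc(2) M4(3) xs(3)])
  have v2: "val (Times (C 2) (Mat (C 0) (C 3))) r2 m0 (2 * \<tau>)"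
    by (rule val_cong[OF val_Times[OF val_C[OF refl] val_input[where a = 3 and m = m0, OF rn(2) cc(3) M4(4) xs(4)]]]) simp
  have v3: "val (Mat (C 0) (C 1)) r3 m0 (real (length es))" by (rule val_input[where a = 1 and m = m0, OF rn(3) cc(1) M4(2) xs(2)])
  have r4: "rn r4" "r4 2 = of_int k" "r4 3 = 2 * \<tau>" "r4 14 = real (length es)"
    by (simp_all add: r4_def r3_def r2_def r1_def)
  let ?Q = "\<lambda>s :: state. 0 < fst s 1 \<longleftrightarrow> (\<exists>S\<subseteq>{..<n}. int (card S) = k \<and> J S \<le> 2 * \<tau>)"
  show ?thesis unfolding minigl_def
  proof (rule run_Asg_Sq[OF v0], fold r1_def, rule run_Asg_Sq[OF v1], fold r2_def, rule run_Asg_Sq[OF v2], fold r3_def,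
      rule run_Asg_Sq[OF v3], fold r4_def, rule run_Sq_post[OF run_distinit[OF r4(1,4) es xe edges]])
    fix r5 m5 assume a: "DT 0 0 0 (snd (r5, m5))" and f: "\<And>y. y \<notin> wr distinit \<Longrightarrow> r5 y = r4 y"
    have r5: "rn r5" "r5 2 = of_int k" "r5 3 = 2 * \<tau>" using f r4 by (auto simp: distinit_def)
    show "run M N (Sq distc (Sq powc (Sq listc (Sq mainc finalc)))) (r5, m5) ?Q"
    proof (rule run_Sq_post[OF run_distc[OF r5(1) a[unfolded snd_conv]]])
      fix r6 m6 assume a: "DM (snd (r6, m6))" and f: "\<And>y. y \<notin> wr distc \<Longrightarrow> r6 y = r5 y"
      have r6: "rn r6" "r6 2 = of_int k" "r6 3 = 2 * \<tau>" using f r5 by (auto simp: distc_def)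
      show "run M N (Sq powc (Sq listc (Sq mainc finalc))) (r6, m6) ?Q"
      proof (rule run_Sq_post[OF run_powc[OF r6(1) a[unfolded snd_conv]]])
        fix r7 m7 assume a: "DM (snd (r7, m7)) \<and> PW (snd (r7, m7))" and f: "\<And>y. y \<notin> wr powc \<Longrightarrow> r7 y = r6 y"
        have r7: "rn r7" "r7 2 = of_int k" "r7 3 = 2 * \<tau>" using f r6 by (auto simp: powc_def)
        have m7: "DM m7" "PW m7" using a by auto
        show "run M N (Sq listc (Sq mainc finalc)) (r7, m7) ?Q"
        proof (rule run_Sq_post[OF run_listc[OF r7(1) m7]])
          fix r8 m8 assume a: "DM (snd (r8, m8)) \<and> PW (snd (r8, m8)) \<and> RP (snd (r8, m8)) (fst st0) \<and> LS (snd (r8, m8)) (snd st0)"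
            and f: "\<And>y. y \<notin> wr listc \<Longrightarrow> r8 y = r7 y"
          have r8: "rn r8" "r8 2 = of_int k" "r8 3 = 2 * \<tau>" using f r7 by (auto simp: listc_def)
          have "Inv k Nb (dead (n - 1) 0) st0" unfolding dead_init by (rule Inv_init[OF Nb(3)])
          then have SI: "SI k Nb (n - 1) 0 m8" using a unfolding SI_def snd_conv by blast
          show "run M N (Sq mainc finalc) (r8, m8) ?Q"
          proof (rule run_Sq_post[OF run_mainc[OF r8(1,2) SI Nb(1,2)]])
            fix r9 m9 assume a: "SI k Nb 0 0 (snd (r9, m9))" and f: "\<And>y. y \<notin> wr mainc \<Longrightarrow> r9 y = r8 y"
            have r9: "rn r9" "r9 2 = of_int k" "r9 3 = 2 * \<tau>" using f r8 by (auto simp: mainc_def)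
            obtain st where st: "DM m9" "LS m9 (snd st)" "Inv k Nb (dead 0 0) st" using a unfolding SI_def snd_conv by blast
            have 0: "0 \<notin> dead 0 0" by (simp add: dead_def)
            note inv = conjunct1[OF conjunct2[OF st(3)[unfolded Inv_def]]]
            have cl: "cl (fst st) 0 \<subseteq> {..<n}" by (auto simp: cl_def)
            have "length (snd st 0) \<le> Nb" "\<forall>S\<in>set (snd st 0). S \<subseteq> cl (fst st) 0" using inv n_pos 0 by blast+
            then have L: "length (snd st 0) \<le> N" "\<forall>S\<in>set (snd st 0). S \<subseteq> {..<n}" using cl Nb(2) by (simp, blast)
            have r: "run M N finalc (r9, m9) (\<lambda>s. 0 < fst s 1 \<longleftrightarrow> (\<exists>S\<in>set (snd st 0). int (card S) = k \<and> J S \<le> 2 * \<tau>))"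
              by (rule run_finalc[OF r9 st(1,2) L])
            show "run M N finalc (r9, m9) ?Q"
              by (rule run_mono[OF r]) (simp only: Inv_final[OF st(3)])
          qed
        qed
      qed
    qed
  qed auto
qed

end

text \<open>Registers below \<open>30\<close> live throughout, those from \<open>30\<close> to
  \<open>39\<close> are reserved for summation variables, and the temporaries of the compiler start
  at \<open>40\<close>.\<close>

lemma wfc_minigl: "wfc 40 {..<30} minigl"
  by (simp add: minigl_def distinit_def initx_def edgex_def distc_def relx_def powc_def listc_def listc_body_def
    mainc_def innerc_def stepc_def parx_def repc_def mrgc_def mrg_body_def mrg_inner_def addc_def insc_def ins_body_def
    finalc_def final_body_def push_def pop_def copy_def unionc_def EqI_def Dx_def Ifc_def cardx_def Jx_def profx_def badx_def)

text \<open>Lists are short since either \<open>k\<close> or the possible distances to the root of a cluster are at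
  most of order \<open>n powr (3 / 4)\<close>.\<close>

definition expo :: "nat \<Rightarrow> nat" where
  "expo n = nat \<lfloor>21 * real n powr (3 / 4)\<rfloor> + 2"

lemma (in machine) short_expo: "short k ((n + 1) ^ expo n)"
  unfolding short_def
proof (intro allI impI)
  fix C p R assume a: "C \<subseteq> {..<n}" "p < n" "Good k C p R"
  let ?x = "real n powr (3 / 4)"
  have x0: "0 < ?x" using n_pos by simp
  \<comment> \<open>This says \<open>(n / ?x) ^ 3 = ?x\<close>: at the threshold \<open>?x\<close>
    for \<open>k\<close> the two bounds on the list length balance.\<close>
  have x3: "?x ^ 3 * ?x = real n ^ 3"
  proof -
    have "?x ^ 3 * ?x = ?x ^ 4" by (simp add: eval_nat_numeral)
    also have "\<dots> = ?x powr 4" using x0 by (simp add: powr_numeral)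
    also have "\<dots> = real n powr 3" by (simp add: powr_powr)
    also have "\<dots> = real n ^ 3" using n_pos by (simp add: powr_numeral)
    finally show ?thesis .
  qed
  \<comment> \<open>For small \<open>k\<close> the sets themselves are few; for large
    \<open>k\<close> the distances are short, so the signatures are few.\<close>
  show "length R \<le> (n + 1) ^ expo n"
  proof (cases "of_int k \<le> ?x")
    case True
    have "nat k \<le> expo n"
    proof -
      have "real_of_int k \<le> 21 * ?x" using True x0 by linarith
      then have "k \<le> \<lfloor>21 * ?x\<rfloor>" by (simp add: le_floor_iff)
      then show ?thesis unfolding expo_def by linarith
    qed
    then have "(n + 1) ^ nat k \<le> (n + 1) ^ expo n" by (intro power_increasing) auto
    with Good_length1[OF a(1,3)] show ?thesis by linarith
  next
    case False
    then have kx: "?x < of_int k" "0 < k" using x0 by (auto simp: not_le) (use x0 in linarith)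
    define D where "D = nat \<lfloor>21 * real n ^ 3 / of_int k ^ 3\<rfloor>"
    have k3: "0 < real_of_int k ^ 3" using kx by simp
    have q0: "0 \<le> 21 * real n ^ 3 / of_int k ^ 3" using kx by simp
    have "21 * real n ^ 3 / of_int k ^ 3 < real D + 1" unfolding D_def using q0 by linarith
    then have D1: "21 * real n ^ 3 < (real D + 1) * of_int k ^ 3" using k3 by (simp add: divide_less_eq)
    have "?x ^ 3 \<le> of_int k ^ 3" using kx x0 by (intro power_mono) auto
    then have "21 * real n ^ 3 \<le> 21 * ?x * of_int k ^ 3" unfolding x3[symmetric] using x0 by (simp add: mult.commute)
    then have "21 * real n ^ 3 / of_int k ^ 3 \<le> 21 * ?x" using k3 by (simp add: divide_le_eq)
    then have "D + 2 \<le> expo n" unfolding D_def expo_def by (simp add: floor_mono nat_mono)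
    then have "(n + 1) ^ (D + 2) \<le> (n + 1) ^ expo n" by (intro power_increasing) auto
    with Good_length2[OF a kx(2) D1] show ?thesis by linarith
  qed
qed

text \<open>The exponent \<open>f\<close> is of order \<open>n powr (3 / 4) * log 2 n\<close>, which
  grows more slowly than the bound required, and the memory is quadratic, so both bounds hold with
  room to spare.\<close>

theorem theorem2:
  "\<exists>(P :: instr list) (f :: nat \<Rightarrow> real) (s :: nat \<Rightarrow> real).
     f \<in> O(\<lambda>n. (real n * log 2 (real n)) powr (5 / 6)) \<and>
     s \<in> O(\<lambda>n. real n ^ 3) \<and>
     (\<forall>(n :: nat) (E :: nat set set) (es :: (nat \<times> nat) list) (k :: int) (\<tau> :: real).
        tree_graph {..<n} E \<longrightarrow> edge_list es E \<longrightarrow>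
        answers_within P (encode_instance n es k \<tau>) (MinIGL {..<n} E k \<tau>) (2 powr f n) (s n))"
proof -
  obtain c q where cq: "\<And>N. cst N minigl \<le> c * (N + 1) ^ q"
    using poly_bounded_cst[of minigl] unfolding poly_bounded_def by blast
  \<comment> \<open>\<open>21 * n powr (3 / 4) + 3\<close> bounds \<open>expo n + 1\<close>, where
    the extra \<open>1\<close> pays for \<open>N + 1\<close> in place of \<open>N\<close>;
    \<open>c + 3\<close> absorbs the instructions that \<open>prog\<close> appends.\<close>
  define f where "f = (\<lambda>n :: nat. log 2 (real c + 3) + real q * ((21 * real n powr (3 / 4) + 3) * log 2 (real n + 1)))"
  \<comment> \<open>\<open>12 = 1 + 11\<close> comes from \<open>(n + 11) * n\<close>, as
    \<open>n\<close> and \<open>n * n\<close> are at most \<open>n ^ 3\<close> for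
    \<open>n \<ge> 1\<close>.\<close>
  define s where "s = (\<lambda>n :: nat. 12 * real n ^ 3)"
  have "(\<lambda>n :: nat. 1) \<in> O(\<lambda>n. (real n * log 2 (real n)) powr (5 / 6))" by real_asymp
  then have 1: "(\<lambda>n :: nat. log 2 (real c + 3)) \<in> O(\<lambda>n. (real n * log 2 (real n)) powr (5 / 6))"
    by (rule landau_o.big_trans[OF bigo_const])
  have "(\<lambda>n :: nat. (21 * real n powr (3 / 4) + 3) * log 2 (real n + 1)) \<in> O(\<lambda>n. (real n * log 2 (real n)) powr (5 / 6))"
    by real_asymp
  then have 2: "(\<lambda>n :: nat. real q * ((21 * real n powr (3 / 4) + 3) * log 2 (real n + 1))) \<in> O(\<lambda>n. (real n * log 2 (real n)) powr (5 / 6))"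
    by (cases "q = 0") auto
  have f: "f \<in> O(\<lambda>n. (real n * log 2 (real n)) powr (5 / 6))"
    unfolding f_def by (rule sum_in_bigo(1)[OF 1 2])
  have s: "s \<in> O(\<lambda>n. real n ^ 3)" unfolding s_def by real_asymp
  have "answers_within (prog 40 minigl) (encode_instance n es k \<tau>) (MinIGL {..<n} E k \<tau>) (2 powr f n) (s n)"
    if tree: "tree_graph {..<n} E" and el: "edge_list es E" for n E es k \<tau>
  proof -
    interpret tree_instance n E by unfold_locales (rule tree)
    define N where "N = (n + 1) ^ expo n"
    have N2: "(n + 1) ^ 2 \<le> N" unfolding N_def expo_def by (intro power_increasing) auto
    have nN: "n \<le> N" "2 \<le> N" using N2 n_gt_0 by (simp_all add: power2_eq_square)
    interpret machine n dist "(n + 11) * n" N by unfold_locales (use nN in auto)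
    have les: "length es < n" using el card_edges n_gt_0 by (simp add: edge_list_def)
    have edges: "dist u w = 1 \<longleftrightarrow> (\<exists>e<length es. es ! e = (u, w) \<or> es ! e = (w, u))" if uw: "u < n" "w < n" for u w
    proof -
      have "dist u w = 1 \<longleftrightarrow> {u, w} \<in> E" using edge_dist[OF uw] dist_edge[of u w] by blast
      also have "\<dots> \<longleftrightarrow> {u, w} \<in> (\<lambda>(u, v). {u, v}) ` set es" using el by (simp only: edge_list_def)
      also have "\<dots> \<longleftrightarrow> (\<exists>e\<in>set es. e = (u, w) \<or> e = (w, u))"
        by (force simp: doubleton_eq_iff)
      also have "\<dots> \<longleftrightarrow> (\<exists>e<length es. es ! e = (u, w) \<or> es ! e = (w, u))"
        by (metis in_set_conv_nth)
      finally show ?thesis .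
    qed
    let ?xs = "encode_instance n es k \<tau>"
    let ?m0 = "\<lambda>a. if a < length ?xs then ?xs ! a else 0"
    have "run ((n + 11) * n) N minigl (\<lambda>_. 0, ?m0) (\<lambda>s. 0 < fst s 1 \<longleftrightarrow> MinIGL {..<n} E k \<tau>)"
      unfolding MinIGL_J by (rule run_minigl[OF les edges short_expo[folded N_def] order_refl nN(2)])
    then have "run ((n + 11) * n) N minigl (\<lambda>_. 0, ?m0) (\<lambda>(r', m'). 0 < r' 1 \<longleftrightarrow> MinIGL {..<n} E k \<tau>)"
      by (rule run_mono) auto
    from prog_correct[OF wfc_minigl _ _ _ this] obtain t A where
      t: "runs (prog 40 minigl) (0, \<lambda>_. 0, ?m0) (MinIGL {..<n} E k \<tau>) t A" "t \<le> cst N minigl + 3" "A \<subseteq> {..<(n + 11) * n}"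
      by auto
    have time: "real t \<le> 2 powr f n"
    proof -
      have "N + 1 \<le> (n + 1) ^ (expo n + 1)"
      proof -
        have "N + 1 \<le> N * (n + 1)" using nN n_gt_0 by (cases n) (auto simp: algebra_simps)
        then show ?thesis by (simp add: N_def mult.commute)
      qed
      then have "(N + 1) ^ q \<le> ((n + 1) ^ (expo n + 1)) ^ q" by (rule power_mono) simp
      then have p: "(N + 1) ^ q \<le> (n + 1) ^ ((expo n + 1) * q)" by (simp only: power_mult)
      have "t \<le> c * (N + 1) ^ q + 3" using t(2) cq[of N] by linarith
      also have "\<dots> \<le> c * (N + 1) ^ q + 3 * (N + 1) ^ q" by simp
      also have "\<dots> = (c + 3) * (N + 1) ^ q" by (simp only: distrib_right)
      also have "\<dots> \<le> (c + 3) * (n + 1) ^ ((expo n + 1) * q)" by (rule mult_left_mono[OF p]) simp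
      finally have "real t \<le> real ((c + 3) * (n + 1) ^ ((expo n + 1) * q))" by (simp only: of_nat_le_iff)
      also have "\<dots> = (real c + 3) * (real n + 1) ^ ((expo n + 1) * q)" by (simp add: add.commute)
      also have "\<dots> = (real c + 3) * (real n + 1) powr (real (expo n + 1) * real q)"
        unfolding of_nat_mult[symmetric] by (subst powr_realpow) auto
      also have "\<dots> \<le> (real c + 3) * (real n + 1) powr ((21 * real n powr (3 / 4) + 3) * real q)"
      proof (intro mult_left_mono powr_mono mult_right_mono)
        have "real (nat \<lfloor>21 * real n powr (3 / 4)\<rfloor>) \<le> 21 * real n powr (3 / 4)" by simp
        then show "real (expo n + 1) \<le> 21 * real n powr (3 / 4) + 3" by (simp add: expo_def)
      qed auto
      also have "\<dots> = 2 powr f n"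
      proof -
        have pw: "(real n + 1) powr y = 2 powr (y * log 2 (real n + 1))" for y
        proof -
          have "(real n + 1) powr y = (2 powr log 2 (real n + 1)) powr y" by simp
          also have "\<dots> = 2 powr (log 2 (real n + 1) * y)" by (rule powr_powr)
          finally show ?thesis by (simp only: mult.commute)
        qed
        have "2 powr f n = 2 powr log 2 (real c + 3) * 2 powr (real q * ((21 * real n powr (3 / 4) + 3) * log 2 (real n + 1)))"
          unfolding f_def by (rule powr_add)
        also have "2 powr log 2 (real c + 3) = real c + 3" by simp
        also have "real q * ((21 * real n powr (3 / 4) + 3) * log 2 (real n + 1)) = (21 * real n powr (3 / 4) + 3) * real q * log 2 (real n + 1)"
          by (simp only: mult_ac)
        finally show ?thesis unfolding pw by (rule sym)
      qed
      finally show ?thesis .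
    qed
    have n1: "1 \<le> real n" using n_gt_0 by simp
    have n3: "real n \<le> real n ^ 3" "real n * real n \<le> real n ^ 3"
      using power_increasing[of 1 3 "real n"] power_increasing[of 2 3 "real n"] n1 by (auto simp: power2_eq_square)
    have len: "real (length ?xs) \<le> s n"
    proof -
      have "length ?xs = 4 + 2 * length es" by (simp add: encode_instance_def)
      then have "real (length ?xs) \<le> 4 * real n + 2 * real n" using les n1 by simp
      then show ?thesis using n3 unfolding s_def by linarith
    qed
    have "real (Suc a) \<le> s n" if "a \<in> A" for a
    proof -
      have "Suc a \<le> (n + 11) * n" using that t(3) by auto
      then have "real (Suc a) \<le> real ((n + 11) * n)" by (simp only: of_nat_le_iff)
      also have "\<dots> = real n * real n + 11 * real n" by (simp add: algebra_simps)
      finally show ?thesis using n3 unfolding s_def by linarith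
    qed
    with t(1) time len show ?thesis unfolding answers_within_def init_config_def by blast
  qed
  with f s show ?thesis by blast
qed

end
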